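(* Let $\ell$ be a prime and $G$ a finite group with a normal subgroup $N$ of order prime to $\ell$ such that $G/N$ is a cyclic $\ell$-group. Let $K$ be a complete discrete valuation field of characteristic zero and residue characteristic $\ell$, $e=e(K)$. Suppose $V$ is a $2d$-dimensional $K$-vector space which is a faithful simple symplectic $K[G]$-module, $\ell>de+1$, and $K[N]$ is quasisplit. Then there exist a $G$-stable $\mathcal{O}_K$-lattice $T$ in $V$ and a perfect alternating $G$-invariant bilinear form $f':T\times T\to\mathcal{O}_K$.
   Context: $e(K)=v(\ell)$ for the normalized valuation $v$ of $K$; $\mathcal{O}_K$ is the valuation ring. A semisimple algebra is quasisplit if it is a direct sum of matrix algebras over commutative fields. A $K[G]$-module is symplectic if it carries a nondegenerate $G$-invariant alternating bilinear form. A bilinear form on a free $\mathcal{O}_K$-module $T$ is perfect if the induced maps $T\to\mathrm{Hom}(T,\mathcal{O}_K)$ are bijective. *)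

theory Defs
  imports "HOL-Algebra.Algebra"
begin

section \<open>Complete discrete valuation fields\<close>

text \<open>
  The valuation takes its values in the integers; its value at \<open>0\<close>
  is irrelevant and every use of \<open>v x\<close> below is guarded by \<open>x \<noteq> 0\<close>.
\<close>

locale discrete_valuation =
  fixes v :: "'k::field \<Rightarrow> int"
  assumes v_mult: "x \<noteq> 0 \<Longrightarrow> y \<noteq> 0 \<Longrightarrow> v (x * y) = v x + v y"
    and v_add: "x \<noteq> 0 \<Longrightarrow> y \<noteq> 0 \<Longrightarrow> x + y \<noteq> 0 \<Longrightarrow> min (v x) (v y) \<le> v (x + y)"
    and v_normalized: "\<exists>x. x \<noteq> 0 \<and> v x = 1"

definition val_at_least :: "('k::field \<Rightarrow> int) \<Rightarrow> int \<Rightarrow> 'k set" where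
  "val_at_least v M = {x. x = 0 \<or> M \<le> v x}"

definition val_Cauchy :: "('k::field \<Rightarrow> int) \<Rightarrow> (nat \<Rightarrow> 'k) \<Rightarrow> bool" where
  "val_Cauchy v s \<longleftrightarrow>
     (\<forall>M. \<exists>n0. \<forall>m\<ge>n0. \<forall>n\<ge>n0. s m - s n \<in> val_at_least v M)"

definition val_tendsto :: "('k::field \<Rightarrow> int) \<Rightarrow> (nat \<Rightarrow> 'k) \<Rightarrow> 'k \<Rightarrow> bool" where
  "val_tendsto v s L \<longleftrightarrow> (\<forall>M. \<exists>n0. \<forall>n\<ge>n0. s n - L \<in> val_at_least v M)"

locale complete_discrete_valuation = discrete_valuation +
  assumes v_complete: "val_Cauchy v s \<Longrightarrow> \<exists>L. val_tendsto v s L"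

abbreviation val_integers :: "('k::field \<Rightarrow> int) \<Rightarrow> 'k set" where
  "val_integers v \<equiv> val_at_least v 0"

definition val_ring :: "('k::field \<Rightarrow> int) \<Rightarrow> 'k ring" where
  "val_ring v =
     \<lparr>carrier = val_integers v, monoid.mult = (*), one = 1, ring.zero = 0, ring.add = (+)\<rparr>"

definition residue_field :: "('k::field \<Rightarrow> int) \<Rightarrow> 'k set ring" where
  "residue_field v = val_ring v Quot (val_at_least v 1)"

text \<open>The nonnegative generator of the kernel of the map from the integers to \<open>R\<close>.\<close>

definition ring_characteristic :: "('a, 'm) ring_scheme \<Rightarrow> nat" where
  "ring_characteristic R = Gcd {n::nat. add_pow R n \<one>\<^bsub>R\<^esub> = \<zero>\<^bsub>R\<^esub>}"

definition residue_characteristic :: "('k::field \<Rightarrow> int) \<Rightarrow> nat" where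
  "residue_characteristic v = ring_characteristic (residue_field v)"


section \<open>Quasisplit algebras and group algebras\<close>

definition mat_ring :: "nat \<Rightarrow> ('a, 'm) ring_scheme \<Rightarrow> (nat \<times> nat \<Rightarrow> 'a) ring" where
  "mat_ring n F = \<lparr>
     carrier = {..<n} \<times> {..<n} \<rightarrow>\<^sub>E carrier F,
     monoid.mult = (\<lambda>A B. \<lambda>(i, j)\<in>{..<n} \<times> {..<n}. \<Oplus>\<^bsub>F\<^esub>k\<in>{..<n}. A (i, k) \<otimes>\<^bsub>F\<^esub> B (k, j)),
     one = (\<lambda>(i, j)\<in>{..<n} \<times> {..<n}. if i = j then \<one>\<^bsub>F\<^esub> else \<zero>\<^bsub>F\<^esub>),
     ring.zero = (\<lambda>_\<in>{..<n} \<times> {..<n}. \<zero>\<^bsub>F\<^esub>),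
     ring.add = (\<lambda>A B. \<lambda>ij\<in>{..<n} \<times> {..<n}. A ij \<oplus>\<^bsub>F\<^esub> B ij)\<rparr>"

text \<open>
  The fields \<open>F\<close> are taken with carriers in the element type of \<open>A\<close>. This is no
  restriction: a field \<open>F\<close> occurring in such a decomposition embeds into \<open>A\<close> as the
  scalar matrices of its summand. If \<open>A\<close> is an algebra over a field \<open>K\<close>, then a ring
  isomorphism suffices, because it maps the image of \<open>K\<close> into the centre, which is the
  direct sum of the fields \<open>F\<close>, and thus makes each \<open>F\<close> an extension of \<open>K\<close>.
  Semisimplicity of \<open>A\<close> is implied by the decomposition.
\<close>

definition quasisplit :: "('a, 'm) ring_scheme \<Rightarrow> bool" where
  "quasisplit A \<longleftrightarrow>
     (\<exists>Fs :: (nat \<times> 'a ring) list.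
        (\<forall>(n, F)\<in>set Fs. 1 \<le> n \<and> Ring.field F) \<and>
        A \<simeq> RDirProd_list (map (\<lambda>(n, F). mat_ring n F) Fs))"

text \<open>
  The algebra \<open>K[H]\<close> of a finite group \<open>H\<close>, where \<open>K\<close> is the field given by the type
  \<open>'k\<close>. The function \<open>a\<close> stands for the formal sum of the \<open>a x \<cdot> x\<close>.
\<close>

definition group_algebra :: "('g, 'm) monoid_scheme \<Rightarrow> ('g \<Rightarrow> 'k::field) ring" where
  "group_algebra H = \<lparr>
     carrier = carrier H \<rightarrow>\<^sub>E UNIV,
     monoid.mult = (\<lambda>a b. \<lambda>x\<in>carrier H. \<Sum>y\<in>carrier H. a y * b (inv\<^bsub>H\<^esub> y \<otimes>\<^bsub>H\<^esub> x)),
     one = (\<lambda>x\<in>carrier H. if x = \<one>\<^bsub>H\<^esub> then 1 else 0),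
     ring.zero = (\<lambda>_\<in>carrier H. 0),
     ring.add = (\<lambda>a b. \<lambda>x\<in>carrier H. a x + b x)\<rparr>"


section \<open>Representations\<close>

definition linear_rep ::
    "('k::field \<Rightarrow> 'v::ab_group_add \<Rightarrow> 'v) \<Rightarrow> ('g, 'm) monoid_scheme \<Rightarrow> ('g \<Rightarrow> 'v \<Rightarrow> 'v) \<Rightarrow> bool"
  where
  "linear_rep scale G \<rho> \<longleftrightarrow>
     (\<forall>g\<in>carrier G. Vector_Spaces.linear scale scale (\<rho> g)) \<and>
     \<rho> \<one>\<^bsub>G\<^esub> = id \<and>
     (\<forall>g\<in>carrier G. \<forall>h\<in>carrier G. \<rho> (g \<otimes>\<^bsub>G\<^esub> h) = \<rho> g \<circ> \<rho> h)"

text \<open>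
  Faithfulness means that the group \<open>G\<close> acts faithfully, not that \<open>K[G]\<close> does: a simple
  module that is faithful over \<open>K[G]\<close> exists only if \<open>K[G]\<close> is a simple ring, that is, if
  \<open>G\<close> is trivial.
\<close>

definition faithful_rep :: "('g, 'm) monoid_scheme \<Rightarrow> ('g \<Rightarrow> 'v \<Rightarrow> 'v) \<Rightarrow> bool" where
  "faithful_rep G \<rho> \<longleftrightarrow> inj_on \<rho> (carrier G)"

definition stable :: "('g, 'm) monoid_scheme \<Rightarrow> ('g \<Rightarrow> 'v \<Rightarrow> 'v) \<Rightarrow> 'v set \<Rightarrow> bool" where
  "stable G \<rho> W \<longleftrightarrow> (\<forall>g\<in>carrier G. \<rho> g ` W \<subseteq> W)"

definition simple_rep ::
    "('k::field \<Rightarrow> 'v::ab_group_add \<Rightarrow> 'v) \<Rightarrow> ('g, 'm) monoid_scheme \<Rightarrow> ('g \<Rightarrow> 'v \<Rightarrow> 'v) \<Rightarrow> bool"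
  where
  "simple_rep scale G \<rho> \<longleftrightarrow>
     (\<exists>x::'v. x \<noteq> 0) \<and>
     (\<forall>W. Modules.module.subspace scale W \<and> stable G \<rho> W \<longrightarrow> W = {0} \<or> W = UNIV)"

definition invariant_form ::
    "('g, 'm) monoid_scheme \<Rightarrow> ('g \<Rightarrow> 'v \<Rightarrow> 'v) \<Rightarrow> 'v set \<Rightarrow> ('v \<Rightarrow> 'v \<Rightarrow> 'k) \<Rightarrow> bool" where
  "invariant_form G \<rho> T f \<longleftrightarrow> (\<forall>g\<in>carrier G. \<forall>x\<in>T. \<forall>y\<in>T. f (\<rho> g x) (\<rho> g y) = f x y)"

definition alternating_form :: "'v set \<Rightarrow> ('v \<Rightarrow> 'v \<Rightarrow> 'k::zero) \<Rightarrow> bool" where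
  "alternating_form T f \<longleftrightarrow> (\<forall>x\<in>T. f x x = 0)"

definition bilinear_form ::
    "('k::field \<Rightarrow> 'v::ab_group_add \<Rightarrow> 'v) \<Rightarrow> ('v \<Rightarrow> 'v \<Rightarrow> 'k) \<Rightarrow> bool" where
  "bilinear_form scale f \<longleftrightarrow>
     (\<forall>x. Vector_Spaces.linear scale (*) (\<lambda>y. f x y)) \<and>
     (\<forall>y. Vector_Spaces.linear scale (*) (\<lambda>x. f x y))"

definition nondegenerate_form :: "('v::zero \<Rightarrow> 'v \<Rightarrow> 'k::zero) \<Rightarrow> bool" where
  "nondegenerate_form f \<longleftrightarrow>
     (\<forall>x. (\<forall>y. f x y = 0) \<longrightarrow> x = 0) \<and> (\<forall>y. (\<forall>x. f x y = 0) \<longrightarrow> y = 0)"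

definition symplectic_rep ::
    "('k::field \<Rightarrow> 'v::ab_group_add \<Rightarrow> 'v) \<Rightarrow> ('g, 'm) monoid_scheme \<Rightarrow> ('g \<Rightarrow> 'v \<Rightarrow> 'v) \<Rightarrow> bool"
  where
  "symplectic_rep scale G \<rho> \<longleftrightarrow>
     (\<exists>f. bilinear_form scale f \<and> nondegenerate_form f \<and>
          alternating_form UNIV f \<and> invariant_form G \<rho> UNIV f)"


section \<open>Lattices and perfect forms\<close>

definition is_lattice ::
    "('k::field \<Rightarrow> int) \<Rightarrow> ('k \<Rightarrow> 'v::ab_group_add \<Rightarrow> 'v) \<Rightarrow> 'v set \<Rightarrow> bool" where
  "is_lattice v scale T \<longleftrightarrow>
     (\<exists>B. finite B \<and> \<not> Modules.module.dependent scale B \<and> Modules.module.span scale B = UNIV \<and>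
          T = {\<Sum>b\<in>B. scale (c b) b | c. \<forall>b\<in>B. c b \<in> val_integers v})"

text \<open>
  \<open>Hom(T, O)\<close>, where \<open>O\<close> is the valuation ring, as a set of functions that are
  \<open>undefined\<close> outside of \<open>T\<close>.
\<close>

definition lattice_dual ::
    "('k::field \<Rightarrow> int) \<Rightarrow> ('k \<Rightarrow> 'v::ab_group_add \<Rightarrow> 'v) \<Rightarrow> 'v set \<Rightarrow> ('v \<Rightarrow> 'k) set" where
  "lattice_dual v scale T =
     {\<phi> \<in> T \<rightarrow>\<^sub>E val_integers v.
        (\<forall>x\<in>T. \<forall>y\<in>T. \<phi> (x + y) = \<phi> x + \<phi> y) \<and>
        (\<forall>a\<in>val_integers v. \<forall>x\<in>T. \<phi> (scale a x) = a * \<phi> x)}"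

definition integral_bilinear_form ::
    "('k::field \<Rightarrow> int) \<Rightarrow> ('k \<Rightarrow> 'v::ab_group_add \<Rightarrow> 'v) \<Rightarrow> 'v set \<Rightarrow> ('v \<Rightarrow> 'v \<Rightarrow> 'k) \<Rightarrow> bool"
  where
  "integral_bilinear_form v scale T f \<longleftrightarrow>
     (\<forall>x\<in>T. (\<lambda>y\<in>T. f x y) \<in> lattice_dual v scale T) \<and>
     (\<forall>y\<in>T. (\<lambda>x\<in>T. f x y) \<in> lattice_dual v scale T)"

definition perfect_form ::
    "('k::field \<Rightarrow> int) \<Rightarrow> ('k \<Rightarrow> 'v::ab_group_add \<Rightarrow> 'v) \<Rightarrow> 'v set \<Rightarrow> ('v \<Rightarrow> 'v \<Rightarrow> 'k) \<Rightarrow> bool"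
  where
  "perfect_form v scale T f \<longleftrightarrow>
     bij_betw (\<lambda>x. \<lambda>y\<in>T. f x y) T (lattice_dual v scale T) \<and>
     bij_betw (\<lambda>y. \<lambda>x\<in>T. f x y) T (lattice_dual v scale T)"

end

(*
  Choose a G-stable lattice T that is maximal among those on which the given form f is integral,
  and let L be its dual, so that p L <= T <= L for a uniformizer p. If T = L or T = p L, then f or
  f / p is perfect on T. Otherwise let t be an element of l-power order that generates G modulo N.

  If t acts trivially, then V is simple over N, and as l does not divide the order of N, so is its
  reduction: an N-equivariant idempotent modulo p lifts by Newton's iteration and completeness.
  This contradicts p L < T < L.

  If t acts nontrivially, let z be a power of t that acts with order l. One of the two quotients
  L / T, T / p L has dimension at most d, and on its simple submodules under N and z a ramification
  estimate based on l > d e + 1 shows that z acts trivially. Hence [z, N] acts trivially on some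
  nonzero stable quotient, so on V, and z is central. The same kind of estimate shows that
  (z - 1) L has colength one in L. Thus the last layer (z - 1)^j L not contained in T is generated
  by one vector modulo T, and adding it to T keeps the alternating form integral, a contradiction.
*)

theory Submission
  imports Defs "HOL-Computational_Algebra.Polynomial"
begin

section \<open>Discrete valuations\<close>

text \<open>Elements of l-power order act unipotently on residue modules, so these are semisimple
  for \<open>N\<close> but in general not for \<open>G\<close>, and only
  \<open>N\<close>-equivariant idempotents are lifted. Whether z is trivial on a small simple layer
  is therefore decided in characteristic zero, on a lift of the layer. There z is replaced by its
  compression, which need not have order l; but its l-th power minus the identity still commutes
  with \<open>N\<close> and with the compression, so Schur's lemma applies, and valuations can be
  compared in the expansion of (1 + u)^l. In this comparison each power of p costs as many factors u
  as the nilpotency index of u, which is at most d. In the central case the same inequality says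
  that l - 1 steps of length two do not fit into L / p^e L, which has length 2 d e. That the form is
  alternating is decisive where one vector is added: nothing else controls the pairing of that
  vector with itself. Residue modules appear throughout as lattices between p L and L, and their
  dimensions as differences of volumes.\<close>

context discrete_valuation
begin

lemma val_1 [simp]: "v 1 = 0"
  using v_mult[of 1 1] by simp

lemma val_uminus_1 [simp]: "v (- 1) = 0"
  using v_mult[of "- 1" "- 1"] by simp

lemma val_uminus: "x \<noteq> 0 \<Longrightarrow> v (- x) = v x"
  using v_mult[of "- 1" x] by simp

lemma val_inverse: "x \<noteq> 0 \<Longrightarrow> v (inverse x) = - v x"
  using v_mult[of x "inverse x"] by simp

lemma val_divide: "x \<noteq> 0 \<Longrightarrow> y \<noteq> 0 \<Longrightarrow> v (x / y) = v x - v y"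
  by (simp add: divide_inverse v_mult val_inverse)

lemma val_power: "x \<noteq> 0 \<Longrightarrow> v (x ^ n) = int n * v x"
  by (induction n) (auto simp: v_mult algebra_simps)

lemma val_power_int: "x \<noteq> 0 \<Longrightarrow> v (x powi m) = m * v x"
  by (auto simp: power_int_def val_power val_inverse)

lemma val_at_least_0 [simp]: "0 \<in> val_at_least v M"
  by (simp add: val_at_least_def)

lemma val_at_least_add: "x \<in> val_at_least v M \<Longrightarrow> y \<in> val_at_least v M \<Longrightarrow> x + y \<in> val_at_least v M"
  using v_add[of x y] by (force simp: val_at_least_def)

lemma val_at_least_mult:
  "x \<in> val_at_least v M \<Longrightarrow> y \<in> val_at_least v N \<Longrightarrow> x * y \<in> val_at_least v (M + N)"
  by (auto simp: val_at_least_def v_mult)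

lemma val_at_least_uminus: "x \<in> val_at_least v M \<Longrightarrow> - x \<in> val_at_least v M"
  by (auto simp: val_at_least_def val_uminus)

lemma val_at_least_diff: "x \<in> val_at_least v M \<Longrightarrow> y \<in> val_at_least v M \<Longrightarrow> x - y \<in> val_at_least v M"
  using val_at_least_add[of x M "- y"] val_at_least_uminus[of y M] by simp

lemma val_at_least_sum:
  "(\<And>i. i \<in> A \<Longrightarrow> f i \<in> val_at_least v M) \<Longrightarrow> sum f A \<in> val_at_least v M"
  by (induction A rule: infinite_finite_induct) (auto intro: val_at_least_add)

lemma val_at_least_mono: "x \<in> val_at_least v M \<Longrightarrow> N \<le> M \<Longrightarrow> x \<in> val_at_least v N"
  by (auto simp: val_at_least_def)

lemma val_integers_1 [simp]: "1 \<in> val_integers v"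
  by (simp add: val_at_least_def)

lemma val_integers_mult: "x \<in> val_integers v \<Longrightarrow> y \<in> val_integers v \<Longrightarrow> x * y \<in> val_integers v"
  using val_at_least_mult[of x 0 y 0] by simp

lemma val_integers_of_nat [simp]: "of_nat n \<in> val_integers v"
  by (induction n) (auto intro: val_at_least_add)

lemma val_integers_of_int [simp]: "of_int n \<in> val_integers v"
  by (cases n rule: int_cases2) (auto intro: val_at_least_uminus)

lemma val_at_least_self: "x \<in> val_at_least v (v x)"
  by (simp add: val_at_least_def)

lemma val_at_least_all_imp_0:
  assumes "\<And>M. x \<in> val_at_least v M"
  shows "x = 0"
  using assms[of "v x + 1"] by (auto simp: val_at_least_def)

end

section \<open>Lattices in a finite-dimensional vector space\<close>

text \<open>\<open>p\<close> is a uniformizer, and \<open>bv\<close> enumerates the given basis by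
  the numbers below \<open>n\<close>. The order of the coordinates is what makes triangular
  generators of lattices available.\<close>

locale lattice_space =
  complete_discrete_valuation v + finite_dimensional_vector_space scale Basis
  for v :: "'k::field_char_0 \<Rightarrow> int"
    and scale :: "'k \<Rightarrow> 'v::ab_group_add \<Rightarrow> 'v" (infixr \<open>*s\<close> 75)
    and Basis :: "'v set" +
  fixes p :: 'k and n :: nat and bv :: "nat \<Rightarrow> 'v"
  assumes p_neq_0 [simp]: "p \<noteq> 0" and val_p [simp]: "v p = 1"
    and bv: "bij_betw bv {..<n} Basis"
begin

definition lin :: "('v \<Rightarrow> 'v) \<Rightarrow> bool" where
  "lin \<phi> \<longleftrightarrow> (\<forall>x y. \<phi> (x + y) = \<phi> x + \<phi> y) \<and> (\<forall>c x. \<phi> (c *s x) = c *s \<phi> x)"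

lemma lin_iff_linear: "lin \<phi> \<longleftrightarrow> Vector_Spaces.linear scale scale \<phi>"
  by (auto simp: lin_def Vector_Spaces.linear_iff vector_space_axioms)

lemma linI: "(\<And>x y. \<phi> (x + y) = \<phi> x + \<phi> y) \<Longrightarrow> (\<And>c x. \<phi> (c *s x) = c *s \<phi> x) \<Longrightarrow> lin \<phi>"
  by (simp add: lin_def)

context
  fixes \<phi> assumes lin: "lin \<phi>"
begin

lemma lin_add: "\<phi> (x + y) = \<phi> x + \<phi> y"
  and lin_scale: "\<phi> (c *s x) = c *s \<phi> x"
  using lin by (auto simp: lin_def)

lemma lin_0: "\<phi> 0 = 0"
  using lin_scale[of 0 0] by simp

lemma lin_minus: "\<phi> (- x) = - \<phi> x"
  using lin_scale[of "-1" x] by simp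

lemma lin_diff: "\<phi> (x - y) = \<phi> x - \<phi> y"
  using lin_add[of x "- y"] by (simp add: lin_minus)

lemma lin_sum: "\<phi> (sum g A) = (\<Sum>i\<in>A. \<phi> (g i))"
  by (induction A rule: infinite_finite_induct) (auto simp: lin_add lin_0)

end

lemma lin_id [intro]: "lin (\<lambda>x. x)"
  by (simp add: lin_def)

lemma lin_comp: "lin \<phi> \<Longrightarrow> lin \<psi> \<Longrightarrow> lin (\<lambda>x. \<phi> (\<psi> x))"
  by (simp add: lin_def)

lemma lin_minus_fun: "lin \<phi> \<Longrightarrow> lin \<psi> \<Longrightarrow> lin (\<lambda>x. \<phi> x - \<psi> x)"
  by (simp add: lin_def algebra_simps)

lemma lin_funpow: "lin \<phi> \<Longrightarrow> lin (\<phi> ^^ i)"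
  by (induction i) (auto simp: lin_def)

lemma lin_scaled: "lin \<phi> \<Longrightarrow> lin (\<lambda>x. c *s \<phi> x)"
  by (simp add: lin_def algebra_simps)

lemma lin_sum_fun: "(\<And>i. i \<in> A \<Longrightarrow> lin (\<phi> i)) \<Longrightarrow> lin (\<lambda>x. \<Sum>i\<in>A. \<phi> i x)"
  by (induction A rule: infinite_finite_induct) (auto simp: lin_def algebra_simps)

section \<open>Coordinates with respect to the enumerated basis\<close>

definition co :: "nat \<Rightarrow> 'v \<Rightarrow> 'k" where
  "co i x = representation Basis x (bv i)"

lemma co_add: "co i (x + y) = co i x + co i y"
  by (simp add: co_def representation_add independent_Basis span_Basis)

lemma co_scale: "co i (c *s x) = c * co i x"
  by (simp add: co_def representation_scale independent_Basis span_Basis)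

lemma co_0 [simp]: "co i 0 = 0"
  by (simp add: co_def representation_zero)

lemma co_diff: "co i (x - y) = co i x - co i y"
  by (simp add: co_def representation_diff independent_Basis span_Basis)

lemma co_sum: "co i (sum g A) = (\<Sum>j\<in>A. co i (g j))"
  by (induction A rule: infinite_finite_induct) (auto simp: co_add)

lemma co_expand: "(\<Sum>i<n. co i x *s bv i) = x"
proof -
  have "(\<Sum>i<n. co i x *s bv i) = (\<Sum>b\<in>Basis. representation Basis x b *s b)"
    unfolding co_def by (rule sum.reindex_bij_betw[OF bv])
  then show ?thesis
    using sum_representation_eq[OF independent_Basis _ finite_Basis order_refl, of x]
    by (simp add: span_Basis)
qed

lemma co_eqI: "(\<And>i. i < n \<Longrightarrow> co i x = co i y) \<Longrightarrow> x = y"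
  using co_expand[of x] co_expand[of y] by (metis (no_types, lifting) lessThan_iff sum.cong)

lemma co_bv: "i < n \<Longrightarrow> j < n \<Longrightarrow> co i (bv j) = (if i = j then 1 else 0)"
  using bv representation_basis[OF independent_Basis, of "bv j"]
  by (auto simp: co_def bij_betw_def inj_on_def)

lemma co_comb: "i < n \<Longrightarrow> co i (\<Sum>j<n. c j *s bv j) = c i"
  by (simp add: co_sum co_scale co_bv if_distrib[of "(*) _"] cong: if_cong)

section \<open>Modules over the valuation ring and lattices\<close>

definition omod :: "'v set \<Rightarrow> bool" where
  "omod L \<longleftrightarrow> 0 \<in> L \<and> (\<forall>x\<in>L. \<forall>y\<in>L. x + y \<in> L) \<and> (\<forall>a\<in>val_integers v. \<forall>x\<in>L. a *s x \<in> L)"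

text \<open>This is \<open>p^M\<close> times the standard lattice; the boxes are a basis of
  neighbourhoods of \<open>0\<close>.\<close>

definition box :: "int \<Rightarrow> 'v set" where
  "box M = {x. \<forall>i<n. co i x \<in> val_at_least v M}"

text \<open>Commensurability with the standard lattice is easier to check than the existence of a
  basis: a module between two lattices has it at once. Freeness is then a consequence, see
  \<open>lat_is_lattice\<close>.\<close>

definition lat :: "'v set \<Rightarrow> bool" where
  "lat L \<longleftrightarrow> omod L \<and> (\<exists>M. box M \<subseteq> L) \<and> (\<exists>M. L \<subseteq> box M)"

text \<open>The multiple \<open>p\<^sup>m L\<close>.\<close>

definition sc :: "int \<Rightarrow> 'v set \<Rightarrow> 'v set" where
  "sc m L = {x. p powi (- m) *s x \<in> L}"

lemma omodI:
  "0 \<in> L \<Longrightarrow> (\<And>x y. x \<in> L \<Longrightarrow> y \<in> L \<Longrightarrow> x + y \<in> L) \<Longrightarrow>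
   (\<And>a x. a \<in> val_integers v \<Longrightarrow> x \<in> L \<Longrightarrow> a *s x \<in> L) \<Longrightarrow> omod L"
  by (simp add: omod_def)

lemma omod_0: "omod L \<Longrightarrow> 0 \<in> L"
  and omod_add: "omod L \<Longrightarrow> x \<in> L \<Longrightarrow> y \<in> L \<Longrightarrow> x + y \<in> L"
  and omod_scale: "omod L \<Longrightarrow> a \<in> val_integers v \<Longrightarrow> x \<in> L \<Longrightarrow> a *s x \<in> L"
  by (auto simp: omod_def)

lemma omod_minus: "omod L \<Longrightarrow> x \<in> L \<Longrightarrow> - x \<in> L"
  using omod_scale[of L "- 1" x] val_at_least_uminus[OF val_integers_1] by simp

lemma omod_diff: "omod L \<Longrightarrow> x \<in> L \<Longrightarrow> y \<in> L \<Longrightarrow> x - y \<in> L"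
  using omod_add[of L x "- y"] omod_minus[of L y] by simp

lemma omod_sum: "omod L \<Longrightarrow> (\<And>i. i \<in> A \<Longrightarrow> f i \<in> L) \<Longrightarrow> sum f A \<in> L"
  by (induction A rule: infinite_finite_induct) (auto simp: omod_0 omod_add)

lemma omod_cong_mem: "omod L \<Longrightarrow> x - y \<in> L \<Longrightarrow> x \<in> L \<longleftrightarrow> y \<in> L"
  using omod_add[of L "x - y" y] omod_diff[of L x "x - y"] by auto

lemma omod_sc: "omod L \<Longrightarrow> omod (sc m L)"
proof (rule omodI)
  assume L: "omod L"
  show "0 \<in> sc m L" using L by (simp add: sc_def omod_0)
  show "x + y \<in> sc m L" if "x \<in> sc m L" "y \<in> sc m L" for x y
    using that L by (simp add: sc_def scale_right_distrib omod_add)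
  show "a *s x \<in> sc m L" if "a \<in> val_integers v" "x \<in> sc m L" for a x
    using omod_scale[OF L that(1), of "p powi (- m) *s x"] that(2)
    by (simp add: sc_def mult.commute)
qed

lemma sc_0 [simp]: "sc 0 L = L"
  by (simp add: sc_def)

lemma sc_sc: "sc a (sc b L) = sc (a + b) L"
proof -
  have "p powi (- b) * p powi (- a) = p powi (- (a + b))"
    by (simp add: add.commute flip: power_int_add)
  then show ?thesis by (simp add: sc_def)
qed

lemma sc_subset: "L \<subseteq> L' \<Longrightarrow> sc m L \<subseteq> sc m L'"
  by (auto simp: sc_def)

lemma sc_subset_iff: "sc m L \<subseteq> sc m L' \<longleftrightarrow> L \<subseteq> L'"
  using sc_subset[of "sc m L" "sc m L'" "- m"] sc_subset[of L L' m] by (auto simp: sc_sc)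

lemma powi_mem: "p powi m \<in> val_at_least v m"
  by (simp add: val_at_least_def val_power_int)

lemma mem_sc_scale:
  assumes "omod L" "a \<in> val_at_least v m" "x \<in> L"
  shows "a *s x \<in> sc m L"
proof -
  have "p powi (- m) * a \<in> val_integers v"
    using val_at_least_mult[OF powi_mem[of "- m"] assms(2)] by simp
  then show ?thesis using assms by (simp add: sc_def omod_scale)
qed

lemma mem_sc_powi: "x \<in> L \<Longrightarrow> p powi m *s x \<in> sc m L"
  by (simp add: sc_def flip: power_int_add)

lemma mem_sc_powi_iff: "p powi m *s x \<in> sc m' L \<longleftrightarrow> x \<in> sc (m' - m) L"
  by (simp add: sc_def flip: power_int_add)

lemma mem_scE:
  assumes "x \<in> sc m L"
  obtains y where "y \<in> L" "x = p powi m *s y"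
  using assms by (intro that[of "p powi (- m) *s x"]) (simp_all add: sc_def flip: power_int_add)

lemma sc_mono:
  assumes "omod L" "m \<le> m'"
  shows "sc m' L \<subseteq> sc m L"
proof
  fix x assume "x \<in> sc m' L"
  then obtain y where y: "y \<in> L" "x = p powi m' *s y" by (rule mem_scE)
  then show "x \<in> sc m L"
    using mem_sc_scale[OF assms(1) val_at_least_mono[OF powi_mem assms(2)]] by simp
qed

lemma sc_image_lin:
  assumes "lin \<phi>" "\<phi> ` L \<subseteq> L'"
  shows "\<phi> ` sc m L \<subseteq> sc m L'"
proof
  fix y assume "y \<in> \<phi> ` sc m L"
  then obtain x where "y = \<phi> x" "p powi (- m) *s x \<in> L" by (auto simp: sc_def)
  then show "y \<in> sc m L'"
    using assms(2) lin_scale[OF assms(1), of "p powi (- m)" x] by (auto simp: sc_def)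
qed

text \<open>A nonzero scalar is a unit times a power of \<open>p\<close>, so only its valuation
  matters.\<close>

lemma mem_sc_iff_of_val:
  assumes "omod L" "a \<noteq> 0"
  shows "a *s x \<in> sc m L \<longleftrightarrow> x \<in> sc (m - v a) L"
proof
  assume "x \<in> sc (m - v a) L"
  then show "a *s x \<in> sc m L"
    using mem_sc_scale[OF omod_sc[OF assms(1)] val_at_least_self, of x "m - v a" a]
    by (simp add: sc_sc)
next
  assume "a *s x \<in> sc m L"
  then have "inverse a *s a *s x \<in> sc (v (inverse a)) (sc m L)"
    by (rule mem_sc_scale[OF omod_sc[OF assms(1)] val_at_least_self])
  then show "x \<in> sc (m - v a) L"
    using assms by (simp add: sc_sc val_inverse)
qed

lemma box_eq_sc: "box M = sc M (box 0)"
proof -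
  have "a \<in> val_at_least v M \<longleftrightarrow> p powi (- M) * a \<in> val_at_least v 0" for a
    by (auto simp: val_at_least_def v_mult val_power_int)
  then show ?thesis by (simp add: box_def sc_def co_scale)
qed

lemma omod_box: "omod (box M)"
  using val_at_least_mult[of _ 0 _ M]
  by (intro omodI) (auto simp: box_def co_add co_scale intro: val_at_least_add)

lemma box_mono: "M \<le> M' \<Longrightarrow> box M' \<subseteq> box M"
  by (auto simp: box_def intro: val_at_least_mono)

lemma sc_box: "sc m (box M) = box (m + M)"
  by (subst (1 2) box_eq_sc) (simp add: sc_sc)

lemma ex_box: "\<exists>M. x \<in> box M"
proof -
  have "finite {..<n}" by simp
  then have "\<exists>M. \<forall>i\<in>{..<n}. M \<le> v (co i x)"
    by (intro exI[of _ "Min ((\<lambda>i. v (co i x)) ` {..<n})"]) auto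
  then show ?thesis by (auto simp: box_def val_at_least_def)
qed

lemma ex_common_box:
  assumes "finite A"
  shows "\<exists>M. A \<subseteq> box M"
  using assms
proof (induction A)
  case (insert x A)
  then obtain M where "A \<subseteq> box M" by auto
  moreover obtain M' where "x \<in> box M'" using ex_box by blast
  ultimately show ?case
    using box_mono[of "min M M'" M] box_mono[of "min M M'" M'] by (intro exI[of _ "min M M'"]) auto
qed auto

lemma box_all_imp_0:
  assumes "\<And>M. x \<in> box M"
  shows "x = 0"
proof (rule co_eqI)
  fix i assume "i < n"
  then show "co i x = co i 0"
    using assms by (auto simp: box_def intro!: val_at_least_all_imp_0)
qed

text \<open>Continuity of linear operators: the images of the finitely many basis vectors lie in one
  box, and \<open>C\<close> records the worst loss.\<close>

lemma lin_bounded: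
  assumes "lin \<phi>"
  shows "\<exists>C. \<forall>M. \<phi> ` box M \<subseteq> box (M + C)"
proof -
  obtain C where C: "(\<phi> \<circ> bv) ` {..<n} \<subseteq> box C"
    using ex_common_box[of "(\<phi> \<circ> bv) ` {..<n}"] by auto
  have "\<phi> x \<in> box C" if "x \<in> box 0" for x
  proof -
    have "\<phi> x = (\<Sum>i<n. co i x *s \<phi> (bv i))"
      by (subst co_expand[of x, symmetric]) (simp add: lin_sum[OF assms] lin_scale[OF assms])
    also have "\<dots> \<in> box C"
      using C that by (intro omod_sum omod_box omod_scale) (auto simp: box_def)
    finally show ?thesis .
  qed
  then have "\<phi> ` box 0 \<subseteq> box C" by auto
  from sc_image_lin[OF assms this] show ?thesis
    by (metis sc_box add_0_right)
qed

lemma lat_omod: "lat L \<Longrightarrow> omod L"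
  by (simp add: lat_def)

lemma lat_box: "lat (box M)"
  using omod_box by (auto simp: lat_def)

lemma lat_between: "omod L \<Longrightarrow> lat L1 \<Longrightarrow> lat L2 \<Longrightarrow> L1 \<subseteq> L \<Longrightarrow> L \<subseteq> L2 \<Longrightarrow> lat L"
  unfolding lat_def by (meson order_trans)

lemma lat_sc:
  assumes "lat L"
  shows "lat (sc m L)"
proof -
  obtain M M' where "box M \<subseteq> L" "L \<subseteq> box M'" using assms by (auto simp: lat_def)
  then have "sc m (box M) \<subseteq> sc m L" "sc m L \<subseteq> sc m (box M')" by (simp_all add: sc_subset)
  then show ?thesis using assms by (auto simp: lat_def sc_box intro: omod_sc)
qed

lemma lat_absorb:
  assumes "lat L" "lat L'"
  shows "\<exists>m. \<forall>m'\<ge>m. sc m' L \<subseteq> L'"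
proof -
  obtain M M' where M: "box M \<subseteq> L'" "L \<subseteq> box M'" using assms by (auto simp: lat_def)
  have "sc m' L \<subseteq> L'" if "m' \<ge> M - M'" for m'
    using sc_subset[OF M(2), of m'] box_mono[of M "m' + M'"] M(1) that by (auto simp: sc_box)
  then show ?thesis by blast
qed

lemma lat_all_sc_imp_0:
  assumes "lat L" "\<And>m. x \<in> sc m L"
  shows "x = 0"
proof (rule box_all_imp_0)
  fix M
  obtain M' where "L \<subseteq> box M'" using assms(1) by (auto simp: lat_def)
  from sc_subset[OF this, of "M - M'"] assms(2)[of "M - M'"] show "x \<in> box M"
    by (auto simp: sc_box)
qed

lemma lat_ex_sc:
  assumes "lat L"
  shows "\<exists>m. x \<in> sc m L"
proof -
  obtain M where M: "box M \<subseteq> L" using assms by (auto simp: lat_def)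
  obtain M' where "x \<in> box M'" using ex_box by blast
  then show ?thesis
    using sc_subset[OF M, of "M' - M"] by (auto simp: sc_box)
qed

section \<open>Sums, images and cyclic modules\<close>

definition lsum :: "'v set \<Rightarrow> 'v set \<Rightarrow> 'v set" where
  "lsum L L' = {x + y |x y. x \<in> L \<and> y \<in> L'}"

lemma lsumI: "x \<in> L \<Longrightarrow> y \<in> L' \<Longrightarrow> x + y \<in> lsum L L'"
  by (auto simp: lsum_def)

lemma omod_lsum:
  assumes "omod L" "omod L'"
  shows "omod (lsum L L')"
proof (rule omodI)
  show "0 \<in> lsum L L'" using lsumI[of 0 L 0 L'] assms by (simp add: omod_0)
  fix x y assume "x \<in> lsum L L'" "y \<in> lsum L L'"
  then obtain a b c d where "x = a + b" "y = c + d" "a \<in> L" "b \<in> L'" "c \<in> L" "d \<in> L'"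
    by (auto simp: lsum_def)
  then show "x + y \<in> lsum L L'"
    using lsumI[of "a + c" L "b + d" L'] assms by (simp add: omod_add algebra_simps)
next
  fix a x assume "a \<in> val_integers v" "x \<in> lsum L L'"
  then show "a *s x \<in> lsum L L'"
    using assms by (fastforce simp: lsum_def scale_right_distrib intro: omod_scale)
qed

lemma lsum_left: "omod L' \<Longrightarrow> L \<subseteq> lsum L L'"
  using lsumI[of _ L 0 L'] by (auto simp: omod_0)

lemma lsum_right: "omod L \<Longrightarrow> L' \<subseteq> lsum L L'"
  using lsumI[of 0 L _ L'] by (auto simp: omod_0)

lemma lsum_least: "omod L'' \<Longrightarrow> L \<subseteq> L'' \<Longrightarrow> L' \<subseteq> L'' \<Longrightarrow> lsum L L' \<subseteq> L''"
  by (auto simp: lsum_def intro: omod_add)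

lemma omod_image: "lin \<phi> \<Longrightarrow> omod L \<Longrightarrow> omod (\<phi> ` L)"
proof (rule omodI)
  assume a: "lin \<phi>" "omod L"
  show "0 \<in> \<phi> ` L" using lin_0[OF a(1)] omod_0[OF a(2)] by (metis imageI)
  show "x + y \<in> \<phi> ` L" if "x \<in> \<phi> ` L" "y \<in> \<phi> ` L" for x y
    using that omod_add[OF a(2)] by (auto simp flip: lin_add[OF a(1)])
  show "c *s x \<in> \<phi> ` L" if "c \<in> val_integers v" "x \<in> \<phi> ` L" for c x
    using that omod_scale[OF a(2)] by (auto simp flip: lin_scale[OF a(1)])
qed

definition oline :: "'v \<Rightarrow> 'v set" where
  "oline x = (\<lambda>a. a *s x) ` val_integers v"

lemma omod_oline: "omod (oline x)"
proof (rule omodI)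
  show "0 \<in> oline x" by (auto simp: oline_def intro!: image_eqI[of _ _ 0])
  show "y + z \<in> oline x" if "y \<in> oline x" "z \<in> oline x" for y z
    using that by (auto simp: oline_def intro: val_at_least_add simp flip: scale_left_distrib)
  show "a *s y \<in> oline x" if "a \<in> val_integers v" "y \<in> oline x" for a y
    using that by (auto simp: oline_def intro: val_integers_mult)
qed

lemma mem_oline: "x \<in> oline x"
  by (auto simp: oline_def intro!: image_eqI[of _ _ 1])

lemma oline_subset: "omod L \<Longrightarrow> x \<in> L \<Longrightarrow> oline x \<subseteq> L"
  by (auto simp: oline_def omod_scale)

end

section \<open>Lengths of lattice quotients and extremal lattices\<close>

lemma int_bounded_below_has_least:
  fixes S :: "int set"
  assumes "S \<noteq> {}" "\<And>k. k \<in> S \<Longrightarrow> b \<le> k"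
  shows "\<exists>m\<in>S. \<forall>k\<in>S. m \<le> k"
proof -
  obtain k where "k \<in> S" using assms(1) by blast
  from ex_has_least_nat[of "\<lambda>k. k \<in> S" k "\<lambda>k. nat (k - b)", OF this]
  obtain m where m: "m \<in> S" "\<And>k. k \<in> S \<Longrightarrow> nat (m - b) \<le> nat (k - b)" by auto
  have "m \<le> k" if "k \<in> S" for k
    using m(2)[OF that] assms(2)[OF that] assms(2)[OF m(1)] by linarith
  with m(1) show ?thesis by blast
qed

context lattice_space
begin

text \<open>
  The minimal valuations of leading coordinates are the diagonal of a Hermite normal form, so that
  for \<open>L \<subseteq> L'\<close> the difference \<open>vol L - vol L'\<close> is the length of \<open>L' / L\<close>.
\<close>

definition lead :: "'v set \<Rightarrow> nat \<Rightarrow> int set" where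
  "lead L i = {v (co i x) |x. x \<in> L \<and> co i x \<noteq> 0 \<and> (\<forall>j. i < j \<and> j < n \<longrightarrow> co j x = 0)}"

definition hgt :: "'v set \<Rightarrow> nat \<Rightarrow> int" where
  "hgt L i = (SOME m. m \<in> lead L i \<and> (\<forall>k\<in>lead L i. m \<le> k))"

definition vol :: "'v set \<Rightarrow> int" where
  "vol L = (\<Sum>i<n. hgt L i)"

lemma hgt:
  assumes "lat L" "i < n"
  shows "hgt L i \<in> lead L i" "k \<in> lead L i \<Longrightarrow> hgt L i \<le> k"
proof -
  obtain M M' where M: "box M \<subseteq> L" "L \<subseteq> box M'" using assms by (auto simp: lat_def)
  have "p powi M *s bv i \<in> box M"
    using assms(2) by (auto simp: box_def co_scale co_bv powi_mem)
  then have "v (co i (p powi M *s bv i)) \<in> lead L i"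
    using M(1) assms(2) by (auto simp: lead_def co_scale co_bv intro!: exI[of _ "p powi M *s bv i"])
  moreover have "M' \<le> k" if k: "k \<in> lead L i" for k
  proof -
    obtain x where "k = v (co i x)" "x \<in> L" "co i x \<noteq> 0" using k by (auto simp: lead_def)
    then show ?thesis using M(2) assms(2) by (auto simp: box_def val_at_least_def)
  qed
  ultimately have "\<exists>m\<in>lead L i. \<forall>k\<in>lead L i. m \<le> k"
    using int_bounded_below_has_least[of "lead L i" M'] by blast
  then have "hgt L i \<in> lead L i \<and> (\<forall>k\<in>lead L i. hgt L i \<le> k)"
    unfolding hgt_def by (intro someI_ex[of "\<lambda>m. m \<in> lead L i \<and> (\<forall>k\<in>lead L i. m \<le> k)"]) blast
  then show "hgt L i \<in> lead L i" "k \<in> lead L i \<Longrightarrow> hgt L i \<le> k" by auto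
qed

lemma lead_mono: "L \<subseteq> L' \<Longrightarrow> lead L i \<subseteq> lead L' i"
  by (auto simp: lead_def)

lemma hgt_antimono: "lat L \<Longrightarrow> lat L' \<Longrightarrow> L \<subseteq> L' \<Longrightarrow> i < n \<Longrightarrow> hgt L' i \<le> hgt L i"
  using hgt lead_mono by blast

lemma vol_antimono: "lat L \<Longrightarrow> lat L' \<Longrightarrow> L \<subseteq> L' \<Longrightarrow> vol L' \<le> vol L"
  unfolding vol_def by (intro sum_mono hgt_antimono) auto

lemma leading_vectors:
  assumes "lat L"
  obtains y where "\<And>i. i < n \<Longrightarrow> y i \<in> L" "\<And>i. i < n \<Longrightarrow> co i (y i) \<noteq> 0"
    "\<And>i. i < n \<Longrightarrow> v (co i (y i)) = hgt L i" "\<And>i j. i < j \<Longrightarrow> j < n \<Longrightarrow> co j (y i) = 0"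
proof -
  have "\<exists>x. x \<in> L \<and> co i x \<noteq> 0 \<and> v (co i x) = hgt L i \<and> (\<forall>j. i < j \<and> j < n \<longrightarrow> co j x = 0)"
    if "i < n" for i
    using hgt(1)[OF assms that] by (auto simp: lead_def)
  then obtain y where "\<And>i. i < n \<Longrightarrow> y i \<in> L \<and> co i (y i) \<noteq> 0 \<and> v (co i (y i)) = hgt L i
      \<and> (\<forall>j. i < j \<and> j < n \<longrightarrow> co j (y i) = 0)"
    by metis
  then show ?thesis using that[of y] by auto
qed

text \<open>Gaussian elimination from the last coordinate downwards.\<close>

lemma triangular_expansion:
  assumes "lat L" "lat L'" "L \<subseteq> L'" "\<And>i. i < n \<Longrightarrow> hgt L i = hgt L' i"
    and y: "\<And>i. i < n \<Longrightarrow> y i \<in> L" "\<And>i. i < n \<Longrightarrow> co i (y i) \<noteq> 0"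
    "\<And>i. i < n \<Longrightarrow> v (co i (y i)) = hgt L i" "\<And>i j. i < j \<Longrightarrow> j < n \<Longrightarrow> co j (y i) = 0"
    and "k \<le> n" "x \<in> L'" "\<And>j. k \<le> j \<Longrightarrow> j < n \<Longrightarrow> co j x = 0"
  shows "\<exists>c. (\<forall>i. c i \<in> val_integers v) \<and> x = (\<Sum>i<k. c i *s y i)"
  using \<open>k \<le> n\<close> \<open>x \<in> L'\<close> assms(11)
proof (induction k arbitrary: x)
  case 0
  then have "x = 0" by (intro co_eqI) auto
  then show ?case by (auto intro!: exI[of _ "\<lambda>_. 0"])
next
  case (Suc k)
  \<comment> \<open>\<open>a\<close> clears the last remaining coordinate. It is integral because
    \<open>y k\<close> has the least valuation among leading coordinates of index \<open>k\<close>,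
    in \<open>L'\<close> just as in \<open>L\<close>.\<close>
  define a where "a = co k x / co k (y k)"
  have k: "k < n" using Suc.prems by simp
  have a: "a \<in> val_integers v"
  proof (cases "co k x = 0")
    case False
    then have "v (co k x) \<in> lead L' k" using Suc.prems k by (auto simp: lead_def)
    then have "hgt L' k \<le> v (co k x)" using hgt(2)[OF assms(2) k] by blast
    then show ?thesis
      using False y(2,3)[OF k] assms(4)[OF k] by (auto simp: a_def val_at_least_def val_divide)
  qed (simp add: a_def)
  have "x - a *s y k \<in> L'"
    using assms(2,3) y(1)[OF k] a Suc.prems(2) by (auto intro!: omod_diff omod_scale lat_omod)
  moreover have "co j (x - a *s y k) = 0" if "k \<le> j" "j < n" for j
    using that y(2,4) Suc.prems(3) k by (cases "j = k") (auto simp: co_diff co_scale a_def)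
  ultimately obtain c where c: "\<And>i. c i \<in> val_integers v" "x - a *s y k = (\<Sum>i<k. c i *s y i)"
    using Suc.IH[of "x - a *s y k"] k by force
  then have "x = (\<Sum>i<k. c i *s y i) + a *s y k" by (simp add: algebra_simps)
  then have "x = (\<Sum>i<Suc k. (c(k := a)) i *s y i)" by simp
  then show ?case using c(1) a by (intro exI[of _ "c(k := a)"]) auto
qed

text \<open>Vectors of \<open>L\<close> that realize the minimal leading valuations also realize
  those of \<open>L'\<close>, so they generate both modules.\<close>

lemma lat_eqI_hgt:
  assumes "lat L" "lat L'" "L \<subseteq> L'" "\<And>i. i < n \<Longrightarrow> hgt L i = hgt L' i"
  shows "L = L'"
proof
  obtain y where y: "\<And>i. i < n \<Longrightarrow> y i \<in> L" "\<And>i. i < n \<Longrightarrow> co i (y i) \<noteq> 0"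
    "\<And>i. i < n \<Longrightarrow> v (co i (y i)) = hgt L i" "\<And>i j. i < j \<Longrightarrow> j < n \<Longrightarrow> co j (y i) = 0"
    using leading_vectors[OF assms(1)] by blast
  show "L' \<subseteq> L"
  proof
    fix x assume "x \<in> L'"
    then obtain c where "\<And>i. c i \<in> val_integers v" "x = (\<Sum>i<n. c i *s y i)"
      using triangular_expansion[OF assms y, of n x] by auto
    then show "x \<in> L" using y(1) assms(1) by (auto intro!: omod_sum omod_scale lat_omod)
  qed
qed fact

text \<open>Each height can only drop when the lattice grows, so the sums cannot agree unless all
  heights do.\<close>

lemma vol_strict:
  assumes "lat L" "lat L'" "L \<subseteq> L'" "vol L \<le> vol L'"
  shows "L = L'"
proof (rule lat_eqI_hgt[OF assms(1-3)])
  fix i assume "i < n"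
  show "hgt L i = hgt L' i"
  proof (rule ccontr)
    assume "hgt L i \<noteq> hgt L' i"
    then have "hgt L' i < hgt L i" using hgt_antimono[OF assms(1-3) \<open>i < n\<close>] by simp
    then have "vol L' < vol L"
      unfolding vol_def using \<open>i < n\<close> hgt_antimono[OF assms(1-3)]
      by (intro sum_strict_mono_ex1) auto
    then show False using assms(4) by simp
  qed
qed

lemma vol_psubset: "lat L \<Longrightarrow> lat L' \<Longrightarrow> L \<subset> L' \<Longrightarrow> vol L' < vol L"
  using vol_strict[of L L'] by force

lemma lead_sc: "k \<in> lead L i \<Longrightarrow> k + m \<in> lead (sc m L) i"
proof -
  assume "k \<in> lead L i"
  then obtain x where "k = v (co i x)" "x \<in> L" "co i x \<noteq> 0" "\<forall>j. i < j \<and> j < n \<longrightarrow> co j x = 0"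
    by (auto simp: lead_def)
  then show "k + m \<in> lead (sc m L) i"
    unfolding lead_def
    by (intro CollectI exI[of _ "p powi m *s x"]) (auto simp: co_scale v_mult val_power_int mem_sc_powi)
qed

lemma hgt_sc:
  assumes "lat L" "i < n"
  shows "hgt (sc m L) i = hgt L i + m"
proof (rule antisym)
  show "hgt (sc m L) i \<le> hgt L i + m"
    using assms by (intro hgt lat_sc lead_sc)
  have "hgt (sc m L) i - m \<in> lead L i"
    using lead_sc[OF hgt(1)[OF lat_sc[OF assms(1)] assms(2)], of m "- m"] by (simp add: sc_sc)
  then show "hgt L i + m \<le> hgt (sc m L) i"
    using hgt(2)[OF assms] by force
qed

lemma vol_sc: "lat L \<Longrightarrow> vol (sc m L) = vol L + int n * m"
  by (simp add: vol_def hgt_sc sum.distrib)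

text \<open>The triangular vectors generate \<open>L\<close> over the valuation ring, hence the
  whole space over the field; being \<open>n\<close> generators in dimension \<open>n\<close>, they
  are independent.\<close>

lemma lat_is_lattice:
  assumes "lat L"
  shows "is_lattice v scale L"
proof -
  obtain y where y: "\<And>i. i < n \<Longrightarrow> y i \<in> L" "\<And>i. i < n \<Longrightarrow> co i (y i) \<noteq> 0"
    "\<And>i. i < n \<Longrightarrow> v (co i (y i)) = hgt L i" "\<And>i j. i < j \<Longrightarrow> j < n \<Longrightarrow> co j (y i) = 0"
    using leading_vectors[OF assms] by blast
  have expand: "\<exists>c. (\<forall>i. c i \<in> val_integers v) \<and> x = (\<Sum>i<n. c i *s y i)" if "x \<in> L" for x
    using triangular_expansion[OF assms assms order_refl refl y, of n x] that by auto
  define B where "B = y ` {..<n}"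
  have "x \<in> span B" for x
  proof -
    obtain m where "x \<in> sc m L" using lat_ex_sc[OF assms] by blast
    then obtain z where z: "z \<in> L" "x = p powi m *s z" by (rule mem_scE)
    then obtain c where c: "z = (\<Sum>i<n. c i *s y i)" using expand by blast
    have "z \<in> span B" unfolding c by (intro span_sum span_scale span_base) (auto simp: B_def)
    then show ?thesis by (simp add: z span_scale)
  qed
  then have span: "span B = UNIV" by auto
  have "card Basis = n" using bv by (metis bij_betw_same_card card_lessThan)
  then have dim: "dim (UNIV :: 'v set) = n" by (simp add: dim_UNIV dimension_def)
  have "n \<le> card B"
    using dim_le_card[of UNIV B] span dim by (simp add: B_def)
  moreover have "card B \<le> n" using card_image_le[of "{..<n}" y] by (simp add: B_def)
  ultimately have card: "card B = n" by simp
  then have inj: "inj_on y {..<n}" by (auto simp: B_def intro: eq_card_imp_inj_on)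
  have ind: "independent B"
    using card_le_dim_spanning[of B UNIV] span card dim by (auto simp: B_def)
  have "L = {\<Sum>b\<in>B. c b *s b | c. \<forall>b\<in>B. c b \<in> val_integers v}" (is "L = ?R")
  proof
    show "?R \<subseteq> L" using y(1) assms by (auto simp: B_def intro!: omod_sum omod_scale lat_omod)
    show "L \<subseteq> ?R"
    proof
      fix x assume "x \<in> L"
      then obtain c where c: "\<And>i. c i \<in> val_integers v" "x = (\<Sum>i<n. c i *s y i)"
        using expand by blast
      have "x = (\<Sum>b\<in>B. c (the_inv_into {..<n} y b) *s b)"
        unfolding B_def c(2) by (simp add: sum.reindex[OF inj] the_inv_into_f_f[OF inj])
      then show "x \<in> ?R" using c(1) by (intro CollectI exI[of _ "\<lambda>b. c (the_inv_into {..<n} y b)"]) auto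
    qed
  qed
  then show ?thesis
    using ind span by (auto simp: is_lattice_def B_def intro!: exI[of _ "y ` {..<n}"])
qed

lemma lattice_basis:
  assumes "lat L"
  obtains B where "finite B" "independent B" "B \<subseteq> L"
    "L = {\<Sum>b\<in>B. c b *s b | c. \<forall>b\<in>B. c b \<in> val_integers v}"
proof -
  obtain B where B: "finite B" "independent B"
    and LB: "L = {\<Sum>b\<in>B. c b *s b | c. \<forall>b\<in>B. c b \<in> val_integers v}"
    using lat_is_lattice[OF assms] by (auto simp: is_lattice_def)
  have "b \<in> L" if b: "b \<in> B" for b
  proof -
    have "(\<Sum>a\<in>B. (if a = b then 1 else 0) *s a) = (\<Sum>a\<in>B. if a = b then a else 0)"
      by (intro sum.cong) auto
    also have "\<dots> = b" using b B(1) by simp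
    finally have "b = (\<Sum>a\<in>B. (if a = b then 1 else 0) *s a)" by (rule sym)
    then show ?thesis unfolding LB by (intro CollectI exI[of _ "\<lambda>a. if a = b then 1 else 0"]) auto
  qed
  then show ?thesis using that B LB by blast
qed

text \<open>The lower bound \<open>L0\<close> makes the length of \<open>L' / L0\<close> a natural
  number for every admissible \<open>L'\<close>. A lattice of least length works, since volumes are
  strictly monotone.\<close>

lemma lat_minimal:
  assumes "lat L" "P L" "\<And>L'. lat L' \<Longrightarrow> P L' \<Longrightarrow> L0 \<subseteq> L'" "lat L0"
  obtains S where "lat S" "P S" "\<And>L'. lat L' \<Longrightarrow> P L' \<Longrightarrow> L' \<subseteq> S \<Longrightarrow> L' = S"
proof -
  from ex_has_least_nat[of "\<lambda>L. lat L \<and> P L" L "\<lambda>L. nat (vol L0 - vol L)"]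
  obtain S where S: "lat S" "P S"
    "\<And>L'. lat L' \<Longrightarrow> P L' \<Longrightarrow> nat (vol L0 - vol S) \<le> nat (vol L0 - vol L')"
    using assms(1,2) by auto
  have "L' = S" if "lat L'" "P L'" "L' \<subseteq> S" for L'
  proof (rule vol_strict[OF that(1) S(1) that(3)])
    show "vol L' \<le> vol S"
      using S(3)[OF that(1,2)] vol_antimono[OF assms(4) that(1) assms(3)[OF that(1,2)]]
      vol_antimono[OF assms(4) S(1) assms(3)[OF S(1,2)]] by linarith
  qed
  then show ?thesis using that S by blast
qed

lemma lat_maximal:
  assumes "lat L" "P L" "\<And>L'. lat L' \<Longrightarrow> P L' \<Longrightarrow> L \<subseteq> L' \<Longrightarrow> L' \<subseteq> L0" "lat L0"
  obtains S where "lat S" "P S" "L \<subseteq> S" "\<And>L'. lat L' \<Longrightarrow> P L' \<Longrightarrow> S \<subseteq> L' \<Longrightarrow> L' = S"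
proof -
  from ex_has_least_nat[of "\<lambda>S. lat S \<and> P S \<and> L \<subseteq> S" L "\<lambda>S. nat (vol S - vol L0)"]
  obtain S where S: "lat S" "P S" "L \<subseteq> S"
    "\<And>L'. lat L' \<Longrightarrow> P L' \<Longrightarrow> L \<subseteq> L' \<Longrightarrow> nat (vol S - vol L0) \<le> nat (vol L' - vol L0)"
    using assms(1,2) by auto
  have "L' = S" if "lat L'" "P L'" "S \<subseteq> L'" for L'
  proof (rule vol_strict[OF S(1) that(1,3), symmetric])
    have "L \<subseteq> L'" using S(3) that(3) by blast
    show "vol S \<le> vol L'"
      using S(4)[OF that(1,2) \<open>L \<subseteq> L'\<close>] vol_antimono[OF that(1) assms(4) assms(3)[OF that(1,2) \<open>L \<subseteq> L'\<close>]]
      vol_antimono[OF S(1) assms(4) assms(3)[OF S(1-3)]] by linarith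
  qed
  then show ?thesis using that S by blast
qed

text \<open>The kernels of the powers of \<open>u\<close> on \<open>S / Y\<close> increase strictly
  until they become stationary, and each strict increase uses up at least one unit of the length,
  which is at most \<open>w\<close>.\<close>

lemma nilpotent_step:
  assumes "lat S" "lat Y" "Y \<subseteq> S" "lin u" "u ` S \<subseteq> S" "u ` Y \<subseteq> Y"
    and "(u ^^ N) ` S \<subseteq> Y" "vol Y - vol S \<le> int w"
  shows "(u ^^ w) ` S \<subseteq> Y"
proof -
  define Z where "Z i = {x \<in> S. (u ^^ i) x \<in> Y}" for i
  have Z0: "Z 0 = Y" using assms(3) by (auto simp: Z_def)
  have Z_mono: "Z i \<subseteq> Z (Suc i)" for i using assms(6) by (auto simp: Z_def)
  have Y_Z: "Y \<subseteq> Z i" for i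
    using Z0 lift_Suc_mono_le[of Z 0 i, OF Z_mono] by simp
  have omod_Z: "omod (Z i)" for i
    using lin_funpow[OF assms(4), of i] assms(1,2)[THEN lat_omod]
    by (intro omodI) (auto simp: Z_def lin_0 lin_add lin_scale intro: omod_0 omod_add omod_scale)
  have lat_Z: "lat (Z i)" for i
    by (rule lat_between[OF omod_Z assms(2,1) Y_Z]) (auto simp: Z_def)
  \<comment> \<open>Once two consecutive kernels agree, all later ones do; the exponent
    \<open>N\<close> identifies their common value with \<open>S\<close>.\<close>
  have stop: "Z i = S" if "Z (Suc i) = Z i" for i
  proof -
    have *: "Z (i + k) = Z i" for k
    proof (induction k)
      case (Suc k)
      have "Z (Suc (i + k)) \<subseteq> Z (Suc i)"
      proof
        fix x assume x: "x \<in> Z (Suc (i + k))"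
        then have "u x \<in> Z (i + k)" using assms(5) by (auto simp: Z_def funpow_swap1)
        then show "x \<in> Z (Suc i)" using x Suc by (auto simp: Z_def funpow_swap1)
      qed
      then show ?case using Suc that Z_mono[of "i + k"] by auto
    qed simp
    have "S \<subseteq> Z N" using assms(7) by (auto simp: Z_def)
    also have "Z N \<subseteq> Z (i + N)" using lift_Suc_mono_le[of Z N "i + N", OF Z_mono] by simp
    finally show ?thesis using * by (auto simp: Z_def)
  qed
  have "Z i = S \<or> vol (Z i) \<le> vol Y - int i" for i
  proof (induction i)
    case (Suc i)
    show ?case
    proof (cases "Z (Suc i) = Z i")
      case True
      then show ?thesis using stop by auto
    next
      case False
      then have "vol (Z (Suc i)) < vol (Z i)" using lat_Z Z_mono by (intro vol_psubset) auto
      moreover have "Z i \<noteq> S" using False Z_mono[of i] by (auto simp: Z_def)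
      ultimately show ?thesis using Suc by auto
    qed
  qed (simp add: Z0)
  from this[of w] have "Z w = S"
  proof
    assume "vol (Z w) \<le> vol Y - int w"
    then show "Z w = S" using assms(8) lat_Z assms(1) by (intro vol_strict) (auto simp: Z_def)
  qed
  then show ?thesis by (auto simp: Z_def)
qed

section \<open>Convergence of vectors\<close>

definition vtends :: "(nat \<Rightarrow> 'v) \<Rightarrow> 'v \<Rightarrow> bool" where
  "vtends s y \<longleftrightarrow> (\<forall>m. \<exists>n0. \<forall>j\<ge>n0. s j - y \<in> box m)"

text \<open>Completeness of the field is applied to each of the finitely many coordinates.\<close>

lemma vtends_exists:
  assumes "\<And>m. \<exists>n0. \<forall>i\<ge>n0. \<forall>j\<ge>n0. s i - s j \<in> box m"
  shows "\<exists>y. vtends s y"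
proof -
  have "\<exists>L. val_tendsto v (\<lambda>j. co i (s j)) L" if "i < n" for i
  proof (rule v_complete)
    show "val_Cauchy v (\<lambda>j. co i (s j))"
      unfolding val_Cauchy_def
    proof
      fix m
      obtain n0 where "\<forall>k\<ge>n0. \<forall>j\<ge>n0. s k - s j \<in> box m" using assms by blast
      then show "\<exists>n0. \<forall>k\<ge>n0. \<forall>j\<ge>n0. co i (s k) - co i (s j) \<in> val_at_least v m"
        using that by (auto simp: box_def co_diff)
    qed
  qed
  then obtain c where c: "\<And>i. i < n \<Longrightarrow> val_tendsto v (\<lambda>j. co i (s j)) (c i)" by metis
  have "vtends s (\<Sum>i<n. c i *s bv i)"
    unfolding vtends_def
  proof
    fix m
    have "\<exists>n0. \<forall>j\<ge>n0. co i (s j) - c i \<in> val_at_least v m" if "i < n" for i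
      using c[OF that] by (auto simp: val_tendsto_def)
    then obtain N where N: "\<And>i j. i < n \<Longrightarrow> N i \<le> j \<Longrightarrow> co i (s j) - c i \<in> val_at_least v m" by metis
    have "s j - (\<Sum>i<n. c i *s bv i) \<in> box m" if "(\<Sum>i<n. N i) \<le> j" for j
    proof -
      have "N i \<le> j" if "i < n" for i
        using member_le_sum[of i "{..<n}" N] that \<open>(\<Sum>i<n. N i) \<le> j\<close> by auto
      then show ?thesis using N by (auto simp: box_def co_diff co_comb)
    qed
    then show "\<exists>n0. \<forall>j\<ge>n0. s j - (\<Sum>i<n. c i *s bv i) \<in> box m" by blast
  qed
  then show ?thesis by blast
qed

lemma vtends_unique:
  assumes "vtends s y" "vtends s z"
  shows "y = z"
proof -
  have "y - z \<in> box m" for m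
  proof -
    obtain n0 n1 where "\<forall>j\<ge>n0. s j - y \<in> box m" "\<forall>j\<ge>n1. s j - z \<in> box m"
      using assms by (auto simp: vtends_def) metis
    then have "s (max n0 n1) - z - (s (max n0 n1) - y) \<in> box m" by (intro omod_diff[OF omod_box, of "_ - _" _ "_ - _"]) auto
    then show ?thesis by simp
  qed
  then show ?thesis using box_all_imp_0[of "y - z"] by auto
qed

lemma vtends_add:
  assumes "vtends s y" "vtends t z"
  shows "vtends (\<lambda>j. s j + t j) (y + z)"
  unfolding vtends_def
proof
  fix m
  obtain n0 n1 where "\<forall>j\<ge>n0. s j - y \<in> box m" "\<forall>j\<ge>n1. t j - z \<in> box m"
    using assms by (auto simp: vtends_def) metis
  then have "(s j - y) + (t j - z) \<in> box m" if "j \<ge> max n0 n1" for j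
    using that by (intro omod_add omod_box) auto
  then show "\<exists>n0. \<forall>j\<ge>n0. s j + t j - (y + z) \<in> box m"
    by (intro exI[of _ "max n0 n1"]) (auto simp: algebra_simps)
qed

lemma vtends_lin:
  assumes "vtends s y" "lin \<phi>"
  shows "vtends (\<lambda>j. \<phi> (s j)) (\<phi> y)"
  unfolding vtends_def
proof
  fix m
  obtain C where C: "\<And>M. \<phi> ` box M \<subseteq> box (M + C)" using lin_bounded[OF assms(2)] by blast
  obtain n0 where "\<forall>j\<ge>n0. s j - y \<in> box (m - C)" using assms(1) by (auto simp: vtends_def)
  then have "\<phi> (s j - y) \<in> box m" if "j \<ge> n0" for j using that C[of "m - C"] by auto
  then show "\<exists>n0. \<forall>j\<ge>n0. \<phi> (s j) - \<phi> y \<in> box m" by (auto simp: lin_diff[OF assms(2)])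
qed

lemma vtends_mem_lat:
  assumes "lat L" "vtends s y" "\<And>j. j \<ge> n0 \<Longrightarrow> s j - x \<in> L"
  shows "y - x \<in> L"
proof -
  obtain M where M: "box M \<subseteq> L" using assms(1) by (auto simp: lat_def)
  obtain n1 where "\<forall>j\<ge>n1. s j - y \<in> box M" using assms(2) by (auto simp: vtends_def)
  then have "s (max n0 n1) - x - (s (max n0 n1) - y) \<in> L"
    using M assms(3)[of "max n0 n1"] by (intro omod_diff[OF lat_omod[OF assms(1)], of "_ - _" "_ - _"]) auto
  then show ?thesis by simp
qed

end

section \<open>Integer polynomials in a linear operator and lifting of idempotents\<close>

text \<open>The middle binomial coefficients are divisible by \<open>l\<close>. The linear term is
  kept apart because its coefficient is exactly \<open>l\<close>: this is what allows
  \<open>u\<close> to be recovered from the \<open>l\<close>-th power of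
  \<open>1 + u\<close>.\<close>

lemma prime_power_expansion:
  assumes "Factorial_Ring.prime (l::nat)"
  shows "\<exists>h::int poly. [:1, 1:] ^ l = 1 + [:0, 1:] ^ l + of_nat l * ([:0, 1:] + [:0, 1:] ^ 2 * h)"
proof -
  define t :: "int poly" where "t = [:0, 1:]"
  have l: "l \<ge> 2" using assms by (rule prime_ge_2_nat)
  have "[:1, 1:] = t + 1" by (simp add: t_def one_pCons)
  then have "[:1, 1:] ^ l = (\<Sum>k\<le>l. of_nat (l choose k) * t ^ k)"
    by (simp add: binomial_ring)
  also have "{..l} = {0, 1, l} \<union> {2..<l}" using l by auto
  also have "(\<Sum>k\<in>{0, 1, l} \<union> {2..<l}. of_nat (l choose k) * t ^ k) =
      (\<Sum>k\<in>{0, 1, l}. of_nat (l choose k) * t ^ k) + (\<Sum>k\<in>{2..<l}. of_nat (l choose k) * t ^ k)"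
    using l by (intro sum.union_disjoint) auto
  also have "(\<Sum>k\<in>{0, 1, l}. of_nat (l choose k) * t ^ k) = 1 + t ^ l + of_nat l * t"
    using l by simp
  also have "(\<Sum>k\<in>{2..<l}. of_nat (l choose k) * t ^ k)
      = (\<Sum>k\<in>{2..<l}. of_nat l * (t ^ 2 * (of_nat ((l choose k) div l) * t ^ (k - 2))))"
  proof (rule sum.cong)
    fix k assume k: "k \<in> {2..<l}"
    then have "l dvd (l choose k)" using assms by (intro dvd_choose_prime) auto
    then have "of_nat (l choose k) = of_nat l * (of_nat ((l choose k) div l) :: int poly)"
      by (metis dvd_mult_div_cancel of_nat_mult)
    moreover have "t ^ k = t ^ 2 * t ^ (k - 2)" using k by (metis atLeastLessThan_iff le_add_diff_inverse power_add)
    ultimately show "of_nat (l choose k) * t ^ k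
        = of_nat l * (t ^ 2 * (of_nat ((l choose k) div l) * t ^ (k - 2)))"
      by (simp add: algebra_simps)
  qed simp
  also have "\<dots> = of_nat l * (t ^ 2 * (\<Sum>k\<in>{2..<l}. of_nat ((l choose k) div l) * t ^ (k - 2)))"
    by (simp add: sum_distrib_left)
  finally have "[:1, 1:] ^ l = 1 + t ^ l + of_nat l *
      (t + t ^ 2 * (\<Sum>k\<in>{2..<l}. of_nat ((l choose k) div l) * t ^ (k - 2)))"
    by (simp only: algebra_simps)
  then show ?thesis unfolding t_def by blast
qed

text \<open>Newton's step \<open>x - (x^2 - x) / (2 x - 1)\<close> for the equation
  \<open>x^2 = x\<close>, with the inverse of \<open>2 x - 1\<close> replaced by
  \<open>2 x - 1\<close> itself, whose square is \<open>1 + 4 (x^2 - x)\<close>. Thus no division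
  occurs and all iterates are integer polynomials in the initial operator.\<close>

fun newton :: "nat \<Rightarrow> int poly" where
  "newton 0 = [:0, 1:]"
| "newton (Suc j) = 3 * newton j ^ 2 - 2 * newton j ^ 3"

definition newton_err :: "nat \<Rightarrow> int poly" where
  "newton_err j = newton j ^ 2 - newton j"

text \<open>Quadratic convergence; the cofactor has integer coefficients and so does no harm to a
  stable lattice.\<close>

lemma newton_err_Suc: "newton_err (Suc j) = newton_err j * newton_err j * (4 * newton_err j - 3)"
proof -
  have "(3 * x ^ 2 - 2 * x ^ 3) ^ 2 - (3 * x ^ 2 - 2 * x ^ 3)
      = (x ^ 2 - x) * (x ^ 2 - x) * (4 * (x ^ 2 - x) - 3)" for x :: "int poly"
    by (simp add: algebra_simps power2_eq_square power3_eq_cube)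
  then show ?thesis by (simp only: newton_err_def newton.simps)
qed

lemma newton_diff: "newton (Suc j) - newton j = (1 - 2 * newton j) * newton_err j"
proof -
  have "3 * x ^ 2 - 2 * x ^ 3 - x = (1 - 2 * x) * (x ^ 2 - x)" for x :: "int poly"
    by (simp add: algebra_simps power2_eq_square power3_eq_cube)
  then show ?thesis by (simp only: newton_err_def newton.simps)
qed

section \<open>Evaluation of integer polynomials at an operator, and idempotents\<close>

context lattice_space
begin

definition papp :: "('v \<Rightarrow> 'v) \<Rightarrow> int poly \<Rightarrow> 'v \<Rightarrow> 'v" where
  "papp u q x = (\<Sum>i\<le>Polynomial.degree q. of_int (Polynomial.coeff q i) *s (u ^^ i) x)"

lemma papp_ge_degree:
  assumes "Polynomial.degree q \<le> N"
  shows "papp u q x = (\<Sum>i\<le>N. of_int (Polynomial.coeff q i) *s (u ^^ i) x)"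
  unfolding papp_def using assms
  by (intro sum.mono_neutral_left) (auto simp: Polynomial.coeff_eq_0)

lemma papp_add: "papp u (q + r) x = papp u q x + papp u r x"
proof -
  define N where "N = max (Polynomial.degree q) (Polynomial.degree r)"
  have "Polynomial.degree (q + r) \<le> N" unfolding N_def by (rule Polynomial.degree_add_le_max)
  then show ?thesis
    using papp_ge_degree[of q N] papp_ge_degree[of r N] papp_ge_degree[of "q + r" N]
    by (simp add: N_def scale_left_distrib sum.distrib)
qed

lemma papp_smult: "papp u (Polynomial.smult c q) x = of_int c *s papp u q x"
  using papp_ge_degree[OF Polynomial.degree_smult_le[of c q]]
  by (simp add: papp_def scale_sum_right)

lemma papp_diff: "papp u (q - r) x = papp u q x - papp u r x"
  using papp_add[of u "q - r" r x] by simp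

lemma papp_const: "papp u [:c:] x = of_int c *s x"
  by (simp add: papp_def)

lemma papp_0 [simp]: "papp u 0 x = 0"
  by (simp add: papp_def)

lemma papp_1 [simp]: "papp u 1 x = x"
  by (simp add: papp_def)

lemma papp_pCons:
  assumes "lin u"
  shows "papp u (pCons c q) x = of_int c *s x + u (papp u q x)"
proof -
  have "papp u (pCons c q) x
      = (\<Sum>i\<le>Suc (Polynomial.degree q). of_int (Polynomial.coeff (pCons c q) i) *s (u ^^ i) x)"
    by (intro papp_ge_degree Polynomial.degree_pCons_le)
  then show ?thesis
    by (simp add: sum.atMost_Suc_shift papp_def lin_sum[OF assms] lin_scale[OF assms] del: sum.atMost_Suc)
qed

lemma papp_t: "lin u \<Longrightarrow> papp u [:0, 1:] x = u x"
  by (simp add: papp_pCons lin_0)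

lemma papp_mult:
  assumes "lin u"
  shows "papp u (q * r) x = papp u q (papp u r x)"
proof (induction q rule: pCons_induct)
  case (pCons c q)
  then show ?case
    by (simp add: papp_add papp_smult papp_pCons[OF assms])
qed simp

lemma papp_power: "lin u \<Longrightarrow> papp u (q ^ k) x = (papp u q ^^ k) x"
  by (induction k) (simp_all add: papp_mult)

lemma papp_of_nat: "papp u (of_nat c) x = of_nat c *s x"
  using papp_const[of u "int c" x] by (simp add: of_nat_poly)

lemma lin_papp: "lin u \<Longrightarrow> lin (papp u q)"
  unfolding papp_def by (intro lin_sum_fun lin_scaled lin_funpow)

lemma papp_mem:
  assumes "lin u" "omod L" "u ` L \<subseteq> L" "x \<in> L"
  shows "papp u q x \<in> L"
  using assms(4)
proof (induction q arbitrary: x rule: pCons_induct)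
  case (pCons c q)
  then have "papp u q x \<in> L" by simp
  then have "u (papp u q x) \<in> L" using assms(3) by auto
  then show ?case using pCons.prems assms(2) by (simp add: papp_pCons[OF assms(1)] omod_add omod_scale)
qed (simp add: assms omod_0)

lemma papp_commute:
  assumes "lin u" "lin g" "\<And>x. g (u x) = u (g x)"
  shows "g (papp u q x) = papp u q (g x)"
proof (induction q rule: pCons_induct)
  case (pCons c q)
  then show ?case by (simp add: papp_pCons[OF assms(1)] lin_add[OF assms(2)] lin_scale[OF assms(2)] assms(3))
qed (simp add: lin_0 assms)

text \<open>The polynomial \<open>h\<close> is fixed before the operator is chosen: the expansion is
  later applied both to \<open>z - 1\<close> and to its compression.\<close>

lemma prime_power_operator:
  assumes "Factorial_Ring.prime l"
  obtains h where "\<And>(u :: 'v \<Rightarrow> 'v) x. lin u \<Longrightarrow>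
    ((\<lambda>x. x + u x) ^^ l) x = x + (u ^^ l) x + of_nat l *s (u x + papp u h (u (u x)))"
proof -
  obtain h :: "int poly" where h: "[:1, 1:] ^ l = 1 + [:0, 1:] ^ l + of_nat l * ([:0, 1:] + [:0, 1:] ^ 2 * h)"
    using prime_power_expansion[OF assms] by blast
  have "((\<lambda>x. x + u x) ^^ l) x = x + (u ^^ l) x + of_nat l *s (u x + papp u h (u (u x)))"
    if "lin u" for u x
  proof -
    have "papp u [:1, 1:] = (\<lambda>x. x + u x)" "papp u [:0, 1:] = u"
      using that by (auto simp: papp_pCons lin_0 fun_eq_iff)
    then have *: "papp u ([:1, 1:] ^ l) x = ((\<lambda>x. x + u x) ^^ l) x" "papp u ([:0, 1:] ^ l) x = (u ^^ l) x"
      "papp u ([:0, 1:] ^ 2) x = u (u x)" for x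
      unfolding numeral_2_eq_2 papp_power[OF that] by simp_all
    have "papp u ([:0, 1:] ^ 2 * h) x = papp u h (u (u x))"
      using papp_mult[OF that, of h "[:0, 1:] ^ 2" x] by (simp add: *(3) mult.commute)
    then show ?thesis
      using arg_cong[OF h, of "\<lambda>q. papp u q x"]
      by (simp add: *(1,2) papp_add papp_mult[OF that] papp_of_nat papp_t[OF that])
  qed
  then show ?thesis using that by blast
qed

text \<open>\<open>Q\<close> is the pointwise limit of the Newton iterates of \<open>P\<close>. Each
  iterate is a polynomial in \<open>P\<close>, which is why operators commuting with
  \<open>P\<close> commute with the limit.\<close>

lemma idempotent_lift:
  assumes T: "lat T" and P: "lin P" "P ` T \<subseteq> T" "\<And>x. x \<in> T \<Longrightarrow> P (P x) - P x \<in> sc 1 T"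
  shows "\<exists>Q. lin Q \<and> (\<forall>x. Q (Q x) = Q x) \<and> (\<forall>x\<in>T. Q x - P x \<in> sc 1 T) \<and>
    (\<forall>g. lin g \<longrightarrow> (\<forall>x. g (P x) = P (g x)) \<longrightarrow> (\<forall>x. g (Q x) = Q (g x)))"
proof -
  note oT = lat_omod[OF T]
  define s where "s j = papp P (newton j)" for j
  have lin_s: "lin (s j)" for j unfolding s_def by (rule lin_papp[OF P(1)])
  have mem: "papp P q x \<in> sc m T" if "x \<in> sc m T" for q m x
    using sc_image_lin[OF P(1) P(2)] that by (intro papp_mem[OF P(1) omod_sc[OF oT]]) auto
  \<comment> \<open>Of the quadratic convergence only one power of \<open>p\<close> per step is
    kept, which already gives a Cauchy sequence.\<close>
  have err: "papp P (newton_err j) x \<in> sc (int j + 1 + m) T" if "x \<in> sc m T" for j m x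
    using that
  proof (induction j arbitrary: m x)
    case 0
    have "papp P (newton_err 0) ` T \<subseteq> sc 1 T"
      using P(3) unfolding newton_err_def newton.simps papp_diff papp_power[OF P(1)] numeral_2_eq_2
      by (auto simp: papp_t[OF P(1)])
    from sc_image_lin[OF lin_papp[OF P(1)] this, of m] show ?case
      using 0 by (auto simp: sc_sc add.commute)
  next
    case (Suc j)
    have "papp P (4 * newton_err j - 3) x \<in> sc m T" using mem Suc.prems by blast
    then have "papp P (newton_err j) (papp P (newton_err j) (papp P (4 * newton_err j - 3) x))
        \<in> sc (int j + 1 + (int j + 1 + m)) T"
      by (intro Suc.IH)
    then show ?case
      using sc_mono[OF oT, of "int (Suc j) + 1 + m" "int j + 1 + (int j + 1 + m)"]
      by (auto simp: newton_err_Suc papp_mult[OF P(1)])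
  qed
  have step: "s (Suc j) x - s j x \<in> sc (int j + 1 + m) T" if "x \<in> sc m T" for j m x
  proof -
    have "s (Suc j) x - s j x = papp P ((1 - 2 * newton j) * newton_err j) x"
      unfolding newton_diff[symmetric] by (simp add: s_def papp_diff)
    then show ?thesis using mem err[OF that] by (simp add: papp_mult[OF P(1)])
  qed
  have cau: "s (j + k) x - s j x \<in> sc (int j + 1 + m) T" if "x \<in> sc m T" for j k m x
  proof (induction k)
    case (Suc k)
    have "s (Suc (j + k)) x - s (j + k) x \<in> sc (int j + 1 + m) T"
      using step[OF that, of "j + k"] sc_mono[OF oT, of "int j + 1 + m" "int (j + k) + 1 + m"] by auto
    from omod_add[OF omod_sc[OF oT] this Suc] show ?case by simp
  qed (simp add: omod_0[OF omod_sc[OF oT]])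
  have "\<exists>y. vtends (\<lambda>j. s j x) y" for x
  proof (rule vtends_exists)
    fix M
    obtain m where m: "x \<in> sc m T" using lat_ex_sc[OF T] by blast
    obtain m0 where m0: "\<And>m'. m' \<ge> m0 \<Longrightarrow> sc m' T \<subseteq> box M" using lat_absorb[OF T lat_box] by blast
    define j0 where "j0 = nat (m0 - m)"
    have *: "s i x - s j0 x \<in> box M" if "i \<ge> j0" for i
    proof -
      have "m0 \<le> int j0 + 1 + m" by (simp add: j0_def)
      then show ?thesis using cau[OF m, of j0 "i - j0"] that m0[of "int j0 + 1 + m"] by auto
    qed
    have "s i x - s j x \<in> box M" if "i \<ge> j0" "j \<ge> j0" for i j
      using omod_diff[OF omod_box *[OF that(1)] *[OF that(2)]] by simp
    then show "\<exists>n0. \<forall>i\<ge>n0. \<forall>j\<ge>n0. s i x - s j x \<in> box M" by blast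
  qed
  then obtain Q where Q: "\<And>x. vtends (\<lambda>j. s j x) (Q x)" by metis
  have near: "Q x - s j x \<in> sc (int j + 1) T" if "x \<in> T" for x j
  proof (rule vtends_mem_lat[OF lat_sc[OF T] Q])
    fix i assume "i \<ge> j"
    then show "s i x - s j x \<in> sc (int j + 1) T"
      using cau[of x 0 j "i - j"] that by simp
  qed
  have lin_Q: "lin Q"
  proof (rule linI)
    show "Q (x + y) = Q x + Q y" for x y
      using vtends_unique[OF Q[of "x + y"]] vtends_add[OF Q[of x] Q[of y]] by (simp add: lin_add[OF lin_s])
    show "Q (c *s x) = c *s Q x" for c x
      using vtends_unique[OF Q[of "c *s x"]] vtends_lin[OF Q[of x] lin_scaled[OF lin_id, of c]]
      by (simp add: lin_scale[OF lin_s])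
  qed
  have QT: "Q x \<in> T" if "x \<in> T" for x
  proof -
    have "Q x - s 0 x \<in> T" using near[OF that, of 0] sc_mono[OF oT, of 0 1] by auto
    moreover have "s 0 x \<in> T" using mem[of x 0] that by (simp add: s_def)
    ultimately show ?thesis using omod_cong_mem[OF oT] by blast
  qed
  have idem_T: "Q (Q x) = Q x" if "x \<in> T" for x
  proof -
    have "Q (Q x) - Q x \<in> sc m T" for m
    proof -
      define j where "j = nat m"
      note om = omod_sc[OF oT, of "int j + 1"]
      have 1: "Q x - s j x \<in> sc (int j + 1) T" by (rule near[OF that])
      then have 2: "s j (Q x - s j x) \<in> sc (int j + 1) T" unfolding s_def by (rule mem)
      have 3: "Q (Q x) - s j (Q x) \<in> sc (int j + 1) T" by (rule near[OF QT[OF that]])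
      have 4: "s j (s j x) - s j x \<in> sc (int j + 1) T"
        using err[of x 0 j] that
        by (simp add: s_def newton_err_def papp_diff papp_mult[OF P(1)] power2_eq_square)
      \<comment> \<open>The failure of \<open>Q\<close> to be idempotent is reduced to that of the
        \<open>j\<close>-th iterate; all four differences are divisible by \<open>p^(j+1)\<close>,
        and \<open>j\<close> is arbitrarily large.\<close>
      have "(Q (Q x) - s j (Q x)) + s j (Q x - s j x) + (s j (s j x) - s j x) - (Q x - s j x)
          \<in> sc (int j + 1) T"
        by (rule omod_diff[OF om omod_add[OF om omod_add[OF om 3 2] 4] 1])
      then have "Q (Q x) - Q x \<in> sc (int j + 1) T" by (simp add: lin_diff[OF lin_s] algebra_simps)
      moreover have "m \<le> int j + 1" by (simp add: j_def)
      ultimately show ?thesis using sc_mono[OF oT, of m "int j + 1"] by blast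
    qed
    then show ?thesis using lat_all_sc_imp_0[OF T, of "Q (Q x) - Q x"] by simp
  qed
  have "Q (Q x) = Q x" for x
  proof -
    obtain m where "x \<in> sc m T" using lat_ex_sc[OF T] by blast
    then obtain y where "y \<in> T" "x = p powi m *s y" by (rule mem_scE)
    then show ?thesis using idem_T by (simp add: lin_scale[OF lin_Q])
  qed
  moreover have "\<forall>x\<in>T. Q x - P x \<in> sc 1 T"
    using near[of _ 0] by (simp add: s_def papp_t[OF P(1)])
  moreover have "g (Q x) = Q (g x)" if "lin g" "\<And>x. g (P x) = P (g x)" for g x
    using vtends_unique[OF Q[of "g x"]] vtends_lin[OF Q[of x] that(1)]
      papp_commute[OF P(1) that(1) that(2)]
    by (simp add: s_def)
  ultimately show ?thesis using lin_Q by blast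
qed

text \<open>\<open>Y\<close> represents a complement of \<open>S / p T\<close> in
  \<open>T / p T\<close>, found as a maximal lattice that meets \<open>S\<close> only in
  \<open>p T\<close>. The projection along it is lifted by prescribing its values on a basis of
  \<open>T\<close>.\<close>

lemma lattice_complement:
  assumes T: "lat T" and S: "lat S" "sc 1 T \<subseteq> S" "S \<subseteq> T"
  shows "\<exists>P. lin P \<and> P ` T \<subseteq> S \<and> (\<forall>x\<in>S. P x - x \<in> sc 1 T)"
proof -
  note oT = lat_omod[OF T] and oS = lat_omod[OF S(1)]
  have T1: "sc 1 T \<subseteq> T" using sc_mono[OF oT, of 0 1] by simp
  obtain Y where Y: "lat Y" "Y \<subseteq> T" "Y \<inter> S \<subseteq> sc 1 T" "sc 1 T \<subseteq> Y"
    and max: "\<And>Y'. lat Y' \<Longrightarrow> Y' \<subseteq> T \<and> Y' \<inter> S \<subseteq> sc 1 T \<Longrightarrow> Y \<subseteq> Y' \<Longrightarrow> Y' = Y"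
    by (rule lat_maximal[of "sc 1 T" "\<lambda>Y. Y \<subseteq> T \<and> Y \<inter> S \<subseteq> sc 1 T" T])
      (use lat_sc[OF T] T T1 in auto)
  note oY = lat_omod[OF Y(1)]
  have sum: "x \<in> lsum S Y" if x: "x \<in> T" for x
  proof (rule ccontr)
    assume nx: "x \<notin> lsum S Y"
    define Y' where "Y' = lsum Y (oline x)"
    have o': "omod Y'" unfolding Y'_def by (intro omod_lsum omod_oline oY)
    have sub: "Y \<subseteq> Y'" unfolding Y'_def by (rule lsum_left[OF omod_oline])
    have "Y' \<subseteq> T" unfolding Y'_def by (intro lsum_least oline_subset oT Y(2) x)
    moreover have "w \<in> sc 1 T" if w: "w \<in> Y'" "w \<in> S" for w
    proof -
      obtain y c where yc: "w = y + c *s x" "y \<in> Y" "c \<in> val_integers v"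
        using w(1) by (auto simp: Y'_def lsum_def oline_def)
      \<comment> \<open>A unit \<open>c\<close> could be divided out, and \<open>x\<close> would lie
        in the sum of \<open>S\<close> and \<open>Y\<close>.\<close>
      have "c \<in> val_at_least v 1"
      proof (rule ccontr)
        assume "c \<notin> val_at_least v 1"
        then have c: "c \<noteq> 0" "v c = 0" using yc(3) by (auto simp: val_at_least_def)
        then have ic: "inverse c \<in> val_integers v" by (simp add: val_at_least_def val_inverse)
        have "x = inverse c *s w + inverse c *s (- y)" using yc(1) c(1) by (simp add: algebra_simps)
        moreover have "inverse c *s w \<in> S" "inverse c *s (- y) \<in> Y"
          using omod_scale[OF oS ic w(2)] omod_scale[OF oY ic omod_minus[OF oY yc(2)]] by auto
        ultimately show False using nx lsumI by metis
      qed
      then have "c *s x \<in> Y" using mem_sc_scale[OF oT _ x] Y(4) by blast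
      then have "w \<in> Y" using yc oY by (simp add: omod_add)
      then show ?thesis using Y(3) w(2) by blast
    qed
    ultimately have "Y' = Y"
      using max[OF lat_between[OF o' Y(1) T sub]] sub by blast
    moreover have "x \<in> Y'"
      using lsum_right[OF oY, of "oline x"] mem_oline by (auto simp: Y'_def)
    ultimately show False using nx lsum_right[OF oS, of Y] by blast
  qed
  obtain B where B: "finite B" "independent B" and BT: "\<And>b. b \<in> B \<Longrightarrow> b \<in> T"
    and TB: "T = {\<Sum>b\<in>B. c b *s b | c. \<forall>b\<in>B. c b \<in> val_integers v}"
    by (rule lattice_basis[OF T]) blast
  have "\<exists>s\<in>S. b - s \<in> Y" if b: "b \<in> B" for b
  proof -
    obtain s y where "b = s + y" "s \<in> S" "y \<in> Y" using sum[OF BT[OF b]] by (auto simp: lsum_def)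
    then show ?thesis by (intro bexI[of _ s]) auto
  qed
  then obtain s where s: "\<And>b. b \<in> B \<Longrightarrow> s b \<in> S" "\<And>b. b \<in> B \<Longrightarrow> b - s b \<in> Y" by metis
  interpret vector_space_pair scale scale by unfold_locales
  obtain P where P: "lin P" "\<And>b. b \<in> B \<Longrightarrow> P b = s b"
    using linear_independent_extend[OF B(2), of s] by (auto simp: lin_iff_linear)
  have PT: "P x \<in> S" "x - P x \<in> Y" if x: "x \<in> T" for x
  proof -
    obtain c where c: "x = (\<Sum>b\<in>B. c b *s b)" "\<And>b. b \<in> B \<Longrightarrow> c b \<in> val_integers v"
      using x unfolding TB by blast
    have "P x = (\<Sum>b\<in>B. P (c b *s b))" unfolding c(1) by (rule lin_sum[OF P(1)])
    also have "\<dots> = (\<Sum>b\<in>B. c b *s s b)"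
      by (rule sum.cong) (simp_all add: lin_scale[OF P(1)] P(2))
    finally have Px: "P x = (\<Sum>b\<in>B. c b *s s b)" .
    then show "P x \<in> S" using s(1) c(2) by (auto intro!: omod_sum[OF oS] omod_scale[OF oS])
    have "x - P x = (\<Sum>b\<in>B. c b *s (b - s b))"
      unfolding Px by (simp add: c(1) scale_right_diff_distrib sum_subtractf)
    also have "\<dots> \<in> Y" using s(2) c(2) by (auto intro!: omod_sum[OF oY] omod_scale[OF oY])
    finally show "x - P x \<in> Y" .
  qed
  have "P x - x \<in> sc 1 T" if "x \<in> S" for x
  proof -
    have "x - P x \<in> Y" "x - P x \<in> S" using PT[of x] that S(3) by (auto intro: omod_diff[OF oS])
    then have "x - P x \<in> sc 1 T" using Y(3) by blast
    from omod_minus[OF omod_sc[OF oT] this] show ?thesis by simp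
  qed
  then show ?thesis using P(1) PT(1) by blast
qed

end

section \<open>Lattices stable under a group action\<close>

text \<open>\<open>e\<close> is the absolute ramification index. The residue characteristic enters
  only through \<open>val_l\<close> and \<open>val_coprime\<close>: \<open>l\<close> is a nonunit,
  and integers prime to \<open>l\<close> are units.\<close>

locale lattice_rep = lattice_space + group G
  for G :: "'g monoid" (structure) +
  fixes \<rho> :: "'g \<Rightarrow> 'b \<Rightarrow> 'b" and N :: "'g set" and l e :: nat
  assumes finite_G: "finite (carrier G)" and rep: "linear_rep scale G \<rho>"
    and normal_N: "N \<lhd> G" and coprime_N: "coprime (card N) l"
    and prime_l: "Factorial_Ring.prime l"
    and e_pos: "0 < e" and val_l: "v (of_nat l) = int e"
    and val_coprime: "coprime m l \<Longrightarrow> v (of_nat m) = 0"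
begin

lemma lin_rho: "g \<in> carrier G \<Longrightarrow> lin (\<rho> g)"
  using rep by (simp add: linear_rep_def lin_iff_linear)

lemma rho_1: "\<rho> \<one> x = x"
  using rep by (simp add: linear_rep_def)

lemma rho_mult: "g \<in> carrier G \<Longrightarrow> h \<in> carrier G \<Longrightarrow> \<rho> (g \<otimes> h) x = \<rho> g (\<rho> h x)"
  using rep by (simp add: linear_rep_def)

lemma rho_inv [simp]:
  assumes "g \<in> carrier G"
  shows "\<rho> (inv g) (\<rho> g x) = x" "\<rho> g (\<rho> (inv g) x) = x"
  using assms rho_mult[of "inv g" g x] rho_mult[of g "inv g" x] by (auto simp: rho_1)

lemma rho_pow: "g \<in> carrier G \<Longrightarrow> \<rho> (g [^] (k::nat)) x = (\<rho> g ^^ k) x"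
  by (induction k arbitrary: x) (auto simp: rho_1 rho_mult funpow_swap1)

lemma subgroup_N: "subgroup N G"
  using normal_N by (rule normal_imp_subgroup)

lemma N_carrier: "g \<in> N \<Longrightarrow> g \<in> carrier G"
  using subgroup.subset[OF subgroup_N] by blast

lemma finite_sub: "subgroup H G \<Longrightarrow> finite H"
  using finite_G subgroup.subset finite_subset by metis

lemma conj_N: "g \<in> carrier G \<Longrightarrow> m \<in> N \<Longrightarrow> g \<otimes> m \<otimes> inv g \<in> N"
  by (rule normal.inv_op_closed2[OF normal_N])

lemma rho_conj: "g \<in> carrier G \<Longrightarrow> m \<in> carrier G \<Longrightarrow> \<rho> g (\<rho> m x) = \<rho> (g \<otimes> m \<otimes> inv g) (\<rho> g x)"
  by (simp add: rho_mult)

section \<open>Averaging over a subgroup of order prime to \<open>l\<close>\<close>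

definition avg :: "'g set \<Rightarrow> ('b \<Rightarrow> 'b) \<Rightarrow> 'b \<Rightarrow> 'b" where
  "avg H P x = inverse (of_nat (card H)) *s (\<Sum>g\<in>H. \<rho> g (P (\<rho> (inv g) x)))"

definition fixproj :: "'g set \<Rightarrow> 'b \<Rightarrow> 'b" where
  "fixproj H x = inverse (of_nat (card H)) *s (\<Sum>g\<in>H. \<rho> g x)"

lemma left_mult_bij:
  assumes "subgroup H G" "m \<in> H"
  shows "bij_betw (\<lambda>g. m \<otimes> g) H H"
proof (rule bij_betw_byWitness[where f' = "\<lambda>g. inv m \<otimes> g"])
  note H = subgroup.mem_carrier[OF assms(1)]
  show "\<forall>a\<in>H. inv m \<otimes> (m \<otimes> a) = a" "\<forall>a\<in>H. m \<otimes> (inv m \<otimes> a) = a"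
    using H assms(2) by (auto simp flip: m_assoc)
  show "(\<otimes>) m ` H \<subseteq> H" "(\<otimes>) (inv m) ` H \<subseteq> H"
    using assms by (auto intro: subgroup.m_closed subgroup.m_inv_closed)
qed

context
  fixes H assumes H: "subgroup H G" and card_H: "coprime (card H) l"
begin

lemma inverse_card_H: "inverse (of_nat (card H)) \<in> val_integers v"
  using val_coprime[OF card_H] by (cases "of_nat (card H) = (0::'a)") (auto simp: val_at_least_def val_inverse)

lemma card_H_neq_0: "of_nat (card H) \<noteq> (0::'a)"
  using finite_sub[OF H] subgroup.one_closed[OF H] by auto

lemma avg_commute:
  assumes "lin P" "m \<in> H"
  shows "\<rho> m (avg H P x) = avg H P (\<rho> m x)"
proof -
  note Hc = subgroup.mem_carrier[OF H]
  have "(\<Sum>g\<in>H. \<rho> m (\<rho> g (P (\<rho> (inv g) x)))) = (\<Sum>g\<in>H. \<rho> (m \<otimes> g) (P (\<rho> (inv (m \<otimes> g)) (\<rho> m x))))"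
    using Hc assms(2) by (intro sum.cong) (auto simp: rho_mult inv_mult_group)
  also have "\<dots> = (\<Sum>g\<in>H. \<rho> g (P (\<rho> (inv g) (\<rho> m x))))"
    by (rule sum.reindex_bij_betw[OF left_mult_bij[OF H assms(2)]])
  finally show ?thesis
    using lin_rho[OF Hc[OF assms(2)]] by (simp add: avg_def lin_scale lin_sum)
qed

lemma lin_avg: "lin P \<Longrightarrow> lin (avg H P)"
  using subgroup.mem_carrier[OF H] unfolding avg_def
  by (intro lin_scaled lin_sum_fun lin_comp[of "\<rho> _" "\<lambda>x. P (\<rho> (inv _) x)"] lin_comp[of P "\<rho> (inv _)"] lin_rho) auto

lemma avg_mem:
  assumes "omod S" "\<And>g. g \<in> H \<Longrightarrow> \<rho> g ` S \<subseteq> S" "\<And>g. g \<in> H \<Longrightarrow> \<rho> g ` T \<subseteq> T" "P ` T \<subseteq> S" "x \<in> T"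
  shows "avg H P x \<in> S"
  unfolding avg_def
proof (intro omod_scale[OF assms(1)] inverse_card_H omod_sum[OF assms(1)])
  fix g assume g: "g \<in> H"
  then have "\<rho> (inv g) x \<in> T" using assms(3,5) subgroup.m_inv_closed[OF H] by blast
  then show "\<rho> g (P (\<rho> (inv g) x)) \<in> S" using assms(2)[OF g] assms(4) by blast
qed

lemma avg_near_id:
  assumes "omod L" "\<And>g. g \<in> H \<Longrightarrow> \<rho> g ` L \<subseteq> L" "\<And>g. g \<in> H \<Longrightarrow> \<rho> g ` S \<subseteq> S"
    "\<And>y. y \<in> S \<Longrightarrow> P y - y \<in> L" "x \<in> S"
  shows "avg H P x - x \<in> L"
proof -
  note Hc = subgroup.mem_carrier[OF H]
  have "(\<Sum>g\<in>H. \<rho> g (P (\<rho> (inv g) x) - \<rho> (inv g) x))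
      = (\<Sum>g\<in>H. \<rho> g (P (\<rho> (inv g) x))) - (\<Sum>g\<in>H. x)"
    unfolding sum_subtractf[symmetric]
    using Hc by (intro sum.cong) (auto simp: lin_diff[OF lin_rho])
  then have "avg H P x - x = inverse (of_nat (card H)) *s (\<Sum>g\<in>H. \<rho> g (P (\<rho> (inv g) x) - \<rho> (inv g) x))"
    using card_H_neq_0 by (simp add: avg_def scale_right_diff_distrib sum_constant_scale)
  also have "\<dots> \<in> L"
  proof (intro omod_scale[OF assms(1)] inverse_card_H omod_sum[OF assms(1)])
    fix g assume g: "g \<in> H"
    then have "\<rho> (inv g) x \<in> S" using assms(3,5) subgroup.m_inv_closed[OF H] by blast
    then show "\<rho> g (P (\<rho> (inv g) x) - \<rho> (inv g) x) \<in> L" using assms(2)[OF g] assms(4) by blast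
  qed
  finally show ?thesis .
qed

lemma fixproj_fixed:
  assumes "m \<in> H"
  shows "\<rho> m (fixproj H x) = fixproj H x"
proof -
  note Hc = subgroup.mem_carrier[OF H]
  have "(\<Sum>g\<in>H. \<rho> m (\<rho> g x)) = (\<Sum>g\<in>H. \<rho> (m \<otimes> g) x)"
    using Hc assms by (intro sum.cong) (auto simp: rho_mult)
  also have "\<dots> = (\<Sum>g\<in>H. \<rho> g x)"
    by (rule sum.reindex_bij_betw[OF left_mult_bij[OF H assms]])
  finally show ?thesis
    using lin_rho[OF Hc[OF assms]] by (simp add: fixproj_def lin_scale lin_sum)
qed

text \<open>Averaging moves a vector that is fixed modulo \<open>L\<close> only within
  \<open>L\<close>. In this way fixed residue vectors are lifted to fixed vectors.\<close>

lemma fixproj_near_id: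
  assumes "omod L" "\<And>g. g \<in> H \<Longrightarrow> \<rho> g x - x \<in> L"
  shows "fixproj H x - x \<in> L"
proof -
  have "fixproj H x - x = inverse (of_nat (card H)) *s (\<Sum>g\<in>H. \<rho> g x - x)"
    using card_H_neq_0 by (simp add: fixproj_def scale_right_diff_distrib sum_constant_scale sum_subtractf)
  also have "\<dots> \<in> L"
    by (intro omod_scale[OF assms(1)] inverse_card_H omod_sum[OF assms(1)] assms(2))
  finally show ?thesis .
qed

end

text \<open>Maschke's theorem modulo \<open>p\<close>, followed by lifting. The averaged
  \<open>P\<close> maps \<open>T\<close> into \<open>S\<close> and is the identity on
  \<open>S\<close> modulo \<open>p T\<close>, so it is idempotent modulo \<open>p\<close>; since
  \<open>S\<close> contains \<open>p T\<close>, the lift still maps \<open>T\<close> into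
  \<open>S\<close>.\<close>

lemma equivariant_idempotent:
  assumes T: "lat T" and S: "lat S" "sc 1 T \<subseteq> S" "S \<subseteq> T"
    and stab: "\<And>g. g \<in> N \<Longrightarrow> \<rho> g ` T \<subseteq> T" "\<And>g. g \<in> N \<Longrightarrow> \<rho> g ` S \<subseteq> S"
  obtains Q where "lin Q" "\<And>x. Q (Q x) = Q x" "\<And>g x. g \<in> N \<Longrightarrow> \<rho> g (Q x) = Q (\<rho> g x)"
    "Q ` T \<subseteq> S" "\<And>x. x \<in> S \<Longrightarrow> Q x - x \<in> sc 1 T"
proof -
  note oT = lat_omod[OF T] and oS = lat_omod[OF S(1)]
  obtain P0 where P0: "lin P0" "P0 ` T \<subseteq> S" "\<And>x. x \<in> S \<Longrightarrow> P0 x - x \<in> sc 1 T"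
    using lattice_complement[OF assms(1-4)] by blast
  define P where "P = avg N P0"
  have lP: "lin P" unfolding P_def by (rule lin_avg[OF subgroup_N coprime_N P0(1)])
  have cP: "\<rho> g (P x) = P (\<rho> g x)" if "g \<in> N" for g x
    unfolding P_def by (rule avg_commute[OF subgroup_N coprime_N P0(1) that])
  have PS: "P x \<in> S" if "x \<in> T" for x
    unfolding P_def by (rule avg_mem[OF subgroup_N coprime_N oS stab(2,1) P0(2) that])
  have near: "P x - x \<in> sc 1 T" if "x \<in> S" for x
    unfolding P_def
    by (rule avg_near_id[OF subgroup_N coprime_N omod_sc[OF oT] sc_image_lin[OF lin_rho[OF N_carrier] stab(1)]
          stab(2) P0(3) that])
  have "P ` T \<subseteq> T" "\<And>x. x \<in> T \<Longrightarrow> P (P x) - P x \<in> sc 1 T"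
    using PS S(3) near by auto
  from idempotent_lift[OF T lP this]
  obtain Q where Q: "lin Q" "\<And>x. Q (Q x) = Q x" "\<And>x. x \<in> T \<Longrightarrow> Q x - P x \<in> sc 1 T"
    "\<And>g x. lin g \<Longrightarrow> (\<And>x. g (P x) = P (g x)) \<Longrightarrow> g (Q x) = Q (g x)"
    by metis
  have "Q ` T \<subseteq> S"
  proof
    fix y assume "y \<in> Q ` T"
    then obtain x where x: "y = Q x" "x \<in> T" by blast
    then show "y \<in> S" using omod_cong_mem[OF oS, of "Q x" "P x"] Q(3)[OF x(2)] S(2) PS[OF x(2)] by blast
  qed
  moreover have "Q x - x \<in> sc 1 T" if "x \<in> S" for x
    using omod_add[OF omod_sc[OF oT] Q(3)[of x] near[OF that]] that S(3) by auto
  ultimately show ?thesis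
    using that[of Q] Q(1,2) Q(4)[OF lin_rho[OF N_carrier] cP] by blast
qed

text \<open>
  The \<open>N\<close>-equivariant projection onto a lift of \<open>S / p T\<close> turns \<open>\<rho> z\<close> into an operator
  \<open>a\<close> whose \<open>l\<close>-th power commutes with \<open>N\<close> and \<open>a\<close>. By simplicity, \<open>a ^ l - 1\<close> has the
  same divisibility by \<open>p\<close> on every primitive vector. Comparing it with
  \<open>u ^ l + l (u + \<dots>)\<close>, where \<open>u = a - 1\<close> has nilpotency index at most \<open>w\<close> modulo \<open>p\<close>,
  gives a contradiction if that index exceeds \<open>1\<close>.
\<close>

lemma prime_order_trivial_on_small_simple:
  assumes z: "z \<in> carrier G" "\<And>x. (\<rho> z ^^ l) x = x"
    and T: "lat T" and S: "lat S" "sc 1 T \<subseteq> S" "S \<subseteq> T"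
    and stabT: "\<And>g. g \<in> insert z N \<Longrightarrow> \<rho> g ` T \<subseteq> T"
    and stabS: "\<And>g. g \<in> insert z N \<Longrightarrow> \<rho> g ` S \<subseteq> S"
    and simple: "\<And>S'. lat S' \<Longrightarrow> sc 1 T \<subseteq> S' \<Longrightarrow> S' \<subseteq> S \<Longrightarrow> (\<And>g. g \<in> insert z N \<Longrightarrow> \<rho> g ` S' \<subseteq> S')
      \<Longrightarrow> S' = sc 1 T \<or> S' = S"
    and w: "vol (sc 1 T) - vol S \<le> int w" "e * w + 1 < l"
    and x: "x \<in> S"
  shows "\<rho> z x - x \<in> sc 1 T"
proof -
  note oT = lat_omod[OF T] and oS = lat_omod[OF S(1)]
  note oT' = omod_sc[OF oT]
  note lz = lin_rho[OF z(1)]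
  obtain Q where Q: "lin Q" "\<And>x. Q (Q x) = Q x" "\<And>g x. g \<in> N \<Longrightarrow> \<rho> g (Q x) = Q (\<rho> g x)"
    "Q ` T \<subseteq> S" "\<And>x. x \<in> S \<Longrightarrow> Q x - x \<in> sc 1 T"
    by (rule equivariant_idempotent[OF T S, OF stabT stabS]) (auto intro: insertI2)
  \<comment> \<open>\<open>a\<close> is the compression of \<open>\<rho> z\<close> to the image of
    \<open>Q\<close>, and \<open>T0\<close> is a lift of \<open>S / p T\<close>. Modulo
    \<open>p\<close> the operator \<open>a\<close> acts on \<open>T0\<close> as
    \<open>\<rho> z\<close> acts on \<open>S / p T\<close>, but \<open>a\<close> itself need not
    have order \<open>l\<close>.\<close>
  define a where "a x = Q (\<rho> z (Q x))" for x
  define u where "u x = a x - x" for x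
  define T0 where "T0 = {y \<in> T. Q y = y}"
  have la: "lin a" unfolding a_def by (intro lin_comp[OF Q(1)] lin_comp[OF lz Q(1)])
  have lu: "lin u" unfolding u_def by (intro lin_minus_fun la lin_id)
  have T0_S: "T0 \<subseteq> S" using Q(4) by (force simp: T0_def)
  have QT0: "Q x \<in> T0" if "x \<in> T" for x using Q(2,4) S(3) that by (auto simp: T0_def)
  have aT: "a ` T \<subseteq> T"
  proof
    fix y assume "y \<in> a ` T"
    then obtain x where x: "y = Q (\<rho> z (Q x))" "x \<in> T" by (auto simp: a_def)
    have "Q x \<in> T" using Q(4) S(3) x(2) by blast
    then have "\<rho> z (Q x) \<in> T" using stabT[of z] by blast
    then show "y \<in> T" using Q(4) S(3) x(1) by blast
  qed
  have aT0: "a y \<in> T0" if "y \<in> T0" for y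
    using that aT by (auto simp: T0_def a_def Q(2))
  have uT0: "u y \<in> T0" if "y \<in> T0" for y
    using aT0[OF that] that by (auto simp: u_def T0_def lin_diff[OF Q(1)] intro: omod_diff[OF oT])
  have uT: "u ` T \<subseteq> T" using aT by (auto simp: u_def intro!: omod_diff[OF oT])
  have upow_T0: "(u ^^ i) y \<in> T0" if "y \<in> T0" for i y
    by (induction i) (auto simp: that uT0)
  \<comment> \<open>Saturation of \<open>T0\<close> in \<open>T\<close>: vectors can be divided by
    powers of \<open>p\<close> without leaving \<open>T0\<close>.\<close>
  have T0_div: "p powi (- m) *s y \<in> T0" if "y \<in> sc m T" "Q y = y" for y m
    using that by (simp add: T0_def sc_def lin_scale[OF Q(1)])
  have T0_sc: "\<exists>y'\<in>T0. y = p powi m *s y'" if "y \<in> sc m T" "Q y = y" for y m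
    using T0_div[OF that] by (intro bexI[of _ "p powi (- m) *s y"]) (auto simp flip: power_int_add)

  define D where "D x = \<rho> z x - x" for x
  have lD: "lin D" unfolding D_def by (intro lin_minus_fun lz lin_id)
  have D_inv: "D ` L \<subseteq> L" if L: "omod L" "\<rho> z ` L \<subseteq> L" for L
    using L(2) by (auto simp: D_def intro!: omod_diff[OF L(1)])
  have z_sc: "\<rho> z ` sc 1 T \<subseteq> sc 1 T" using sc_image_lin[OF lz stabT[of z]] by simp
  obtain h where h: "\<And>(u :: 'b \<Rightarrow> 'b) x. lin u \<Longrightarrow>
      ((\<lambda>x. x + u x) ^^ l) x = x + (u ^^ l) x + of_nat l *s (u x + papp u h (u (u x)))"
    using prime_power_operator[OF prime_l] by blast
  have l_mem: "of_nat l \<in> val_at_least v (int e)"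
    by (simp add: val_at_least_def val_l)
  have l_sc: "of_nat l *s y \<in> sc (int e + m) T" if "y \<in> sc m T" for y m
    using mem_sc_scale[OF oT' l_mem that] by (simp add: sc_sc)
  \<comment> \<open>As \<open>z\<close> acts with \<open>l\<close>-th power \<open>1\<close>, the
    expansion makes the \<open>l\<close>-th power of \<open>D\<close> a multiple of
    \<open>l\<close>. So \<open>D\<close> is nilpotent on \<open>S / p T\<close>, and the length of
    that quotient bounds the exponent by \<open>w\<close>.\<close>
  have "(D ^^ l) ` S \<subseteq> sc 1 T"
  proof
    fix y assume "y \<in> (D ^^ l) ` S"
    then obtain x where x: "y = (D ^^ l) x" "x \<in> S" by blast
    have "(\<lambda>x. x + D x) = \<rho> z" by (auto simp: D_def)
    then have "(D ^^ l) x + of_nat l *s (D x + papp D h (D (D x))) = 0"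
      using h[OF lD, of x] z(2)[of x] by (simp add: add.assoc)
    then have "y = - (of_nat l *s (D x + papp D h (D (D x))))"
      unfolding x(1) by (simp only: eq_neg_iff_add_eq_0)
    moreover have "D x + papp D h (D (D x)) \<in> T"
    proof -
      have DT: "D ` T \<subseteq> T" using D_inv[OF oT stabT[of z]] by simp
      then have "D x \<in> T" using x(2) S(3) by blast
      then show ?thesis using DT by (intro omod_add[OF oT] papp_mem[OF lD oT DT]) blast+
    qed
    ultimately have "y \<in> sc (int e) T" using l_sc[of _ 0] omod_minus[OF oT'] by simp
    then show "y \<in> sc 1 T" using sc_mono[OF oT, of 1 "int e"] e_pos by auto
  qed
  then have Dw: "(D ^^ w) ` S \<subseteq> sc 1 T"
    using nilpotent_step[OF S(1) lat_sc[OF T] S(2) lD D_inv[OF oS stabS[of z]] D_inv[OF oT' z_sc] _ w(1)] by simp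
  have near: "a y - \<rho> z y \<in> sc 1 T" if "y \<in> T0" for y
  proof -
    have "\<rho> z y \<in> S" using that T0_S stabS[of z] by auto
    then show ?thesis using Q(5) that by (simp add: a_def T0_def)
  qed
  have "(u ^^ i) y - (D ^^ i) y \<in> sc 1 T" if "y \<in> T0" for i y
  proof (induction i)
    case (Suc i)
    have "u ((u ^^ i) y) - D ((u ^^ i) y) \<in> sc 1 T"
      using near[OF upow_T0[OF that, of i]] by (simp add: u_def D_def)
    moreover have "D ((u ^^ i) y - (D ^^ i) y) \<in> sc 1 T"
      using Suc D_inv[OF oT' z_sc] by blast
    ultimately have "(u ((u ^^ i) y) - D ((u ^^ i) y)) + D ((u ^^ i) y - (D ^^ i) y) \<in> sc 1 T"
      by (rule omod_add[OF oT'])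
    then show ?case by (simp add: lin_diff[OF lD])
  qed (simp add: omod_0[OF oT'])
  then have uw: "(u ^^ w) y \<in> sc 1 T" if "y \<in> T0" for y
    using omod_cong_mem[OF oT'] Dw that T0_S by blast

  \<comment> \<open>\<open>i0\<close> is the nilpotency index of \<open>u\<close> modulo
    \<open>p\<close> on \<open>T0\<close>. The aim is \<open>i0 <= 1\<close>.\<close>
  define i0 where "i0 = (LEAST i. \<forall>y\<in>T0. (u ^^ i) y \<in> sc 1 T)"
  have i0: "\<And>y. y \<in> T0 \<Longrightarrow> (u ^^ i0) y \<in> sc 1 T"
    using LeastI[of "\<lambda>i. \<forall>y\<in>T0. (u ^^ i) y \<in> sc 1 T" w] uw by (auto simp: i0_def)
  have "i0 \<le> w"
    unfolding i0_def using uw by (intro Least_le) auto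
  then have i0w: "e * i0 + 1 < l" using w(2) by (meson add_le_mono1 le_less_trans mult_le_mono2)
  have i0_min: "\<exists>y\<in>T0. (u ^^ i) y \<notin> sc 1 T" if "i < i0" for i
    using not_less_Least[of i "\<lambda>i. \<forall>y\<in>T0. (u ^^ i) y \<in> sc 1 T"] that by (auto simp: i0_def)
  have Q_upow: "Q ((u ^^ i) y) = (u ^^ i) y" if "y \<in> T0" for i y
    using upow_T0[OF that] by (simp add: T0_def)
  \<comment> \<open>After division by \<open>p^k\<close> the vector lies in \<open>T0\<close> again,
    so \<open>i0\<close> more applications of \<open>u\<close> gain another factor
    \<open>p\<close>.\<close>
  have u_deep: "(u ^^ m) y \<in> sc (int k) T" if "y \<in> T0" "k * i0 \<le> m" for m k y
    using that(2)
  proof (induction k arbitrary: m)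
    case 0
    then show ?case using upow_T0[OF that(1)] by (simp add: T0_def)
  next
    case (Suc k)
    then have "(u ^^ (m - i0)) y \<in> sc (int k) T" by simp
    from T0_sc[OF this Q_upow[OF that(1)]]
    obtain y' where y': "y' \<in> T0" "(u ^^ (m - i0)) y = p powi (int k) *s y'" by blast
    have "(u ^^ m) y = (u ^^ i0) ((u ^^ (m - i0)) y)"
      using Suc.prems by (simp flip: funpow_add[THEN fun_cong, unfolded comp_def])
    also have "\<dots> = p powi (int k) *s (u ^^ i0) y'"
      unfolding y'(2) by (rule lin_scale[OF lin_funpow[OF lu]])
    also have "\<dots> \<in> sc (int (Suc k)) T"
      using i0[OF y'(1)] unfolding mem_sc_powi_iff by simp
    finally show ?case .
  qed

  \<comment> \<open>\<open>g\<close> measures how far the compression is from having order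
    \<open>l\<close>.\<close>
  define g where "g x = (a ^^ l) x - x" for x
  have lg: "lin g" unfolding g_def by (intro lin_minus_fun lin_funpow la lin_id)
  have g_u: "g y = (u ^^ l) y + of_nat l *s (u y + papp u h (u (u y)))" for y
  proof -
    have "(\<lambda>x. x + u x) = a" by (auto simp: u_def)
    then show ?thesis using h[OF lu, of y] by (simp add: g_def)
  qed
  have ga: "g (a y) = a (g y)" for y
    by (simp add: g_def lin_diff[OF la] funpow_swap1)
  \<comment> \<open>Since \<open>Q\<close> commutes with \<open>N\<close>, the operator
    \<open>a\<close> conjugates the action of \<open>N\<close> exactly as \<open>z\<close> does.
    After \<open>l\<close> factors this is conjugation by \<open>z^l\<close>, which acts as the
    identity; hence \<open>g\<close> commutes with \<open>N\<close>.\<close>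
  have a_conj: "a (\<rho> m y) = \<rho> (z \<otimes> m \<otimes> inv z) (a y)" if "m \<in> N" for m y
    using that by (simp add: a_def Q(3)[symmetric] rho_conj[OF z(1) N_carrier] Q(3)[OF conj_N[OF z(1)]])
  have apow_conj: "(a ^^ i) (\<rho> m y) = \<rho> (z [^] i \<otimes> m \<otimes> inv (z [^] i)) ((a ^^ i) y)" if "m \<in> N" for i m y
  proof (induction i)
    case (Suc i)
    have "z [^] Suc i = z \<otimes> z [^] i" using z(1) by (metis nat_pow_Suc2)
    then have "z [^] Suc i \<otimes> m \<otimes> inv (z [^] Suc i) = z \<otimes> (z [^] i \<otimes> m \<otimes> inv (z [^] i)) \<otimes> inv z"
      using z(1) N_carrier[OF that] by (simp add: inv_mult_group m_assoc)
    then show ?case using Suc a_conj[OF conj_N[OF nat_pow_closed[OF z(1)] that]] by simp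
  qed (use N_carrier[OF that] in simp)
  have gN: "g (\<rho> m y) = \<rho> m (g y)" if "m \<in> N" for m y
  proof -
    have zl: "\<rho> (z [^] l) x = x" for x using rho_pow[OF z(1)] z(2) by simp
    have zl': "\<rho> (inv (z [^] l)) x = x" for x
      using rho_inv(1)[OF nat_pow_closed[OF z(1)], of l x] by (simp add: zl)
    have "(a ^^ l) (\<rho> m y) = \<rho> m ((a ^^ l) y)"
      using apow_conj[OF that, of l y] z(1) N_carrier[OF that] by (simp add: rho_mult zl zl')
    then show ?thesis by (simp add: g_def lin_diff[OF lin_rho[OF N_carrier[OF that]]])
  qed
  have gT: "g ` T \<subseteq> T"
  proof -
    have "(a ^^ i) y \<in> T" if "y \<in> T" for i y using that aT by (induction i) auto
    then show ?thesis by (auto simp: g_def intro: omod_diff[OF oT])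
  qed

  \<comment> \<open>Schur's lemma for the endomorphism of \<open>S / p T\<close> induced by
    \<open>p^(-m) g\<close>. Its kernel is \<open>S' / p T\<close> with the \<open>S'\<close>
    defined below; it is stable under \<open>N\<close> and \<open>z\<close>, so it vanishes when the
    endomorphism is nonzero.\<close>
  have schur: "y0 \<in> sc 1 T"
    if s: "\<And>y. y \<in> T0 \<Longrightarrow> g y \<in> sc m T" "\<exists>y\<in>T0. g y \<notin> sc (m + 1) T"
      and y0: "y0 \<in> T0" "g y0 \<in> sc (m + 1) T" for m y0
  proof -
    define S' where "S' = {x \<in> S. \<exists>y\<in>T0. g y \<in> sc (m + 1) T \<and> x - y \<in> sc 1 T}"
    have zero: "0 \<in> T0" by (simp add: T0_def omod_0[OF oT] lin_0[OF Q(1)])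
    have addT0: "x + y \<in> T0" if "x \<in> T0" "y \<in> T0" for x y
      using that by (simp add: T0_def lin_add[OF Q(1)] omod_add[OF oT])
    have scT0: "c *s y \<in> T0" if "c \<in> val_integers v" "y \<in> T0" for c y
      using that by (simp add: T0_def lin_scale[OF Q(1)] omod_scale[OF oT])
    have oS': "omod S'"
    proof (rule omodI)
      show "0 \<in> S'" using zero by (auto simp: S'_def omod_0 oS oT' lin_0[OF lg] intro!: bexI[of _ 0])
      fix x x' assume "x \<in> S'" "x' \<in> S'"
      then obtain y y' where *: "x \<in> S" "y \<in> T0" "g y \<in> sc (m + 1) T" "x - y \<in> sc 1 T"
        "x' \<in> S" "y' \<in> T0" "g y' \<in> sc (m + 1) T" "x' - y' \<in> sc 1 T" by (auto simp: S'_def)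
      have "x + x' - (y + y') \<in> sc 1 T" using omod_add[OF oT' *(4,8)] by (simp add: algebra_simps)
      then show "x + x' \<in> S'"
        using * by (auto simp: S'_def omod_add[OF oS] omod_add[OF oT'] addT0 lin_add[OF lg]
            intro!: bexI[of _ "y + y'"])
    next
      fix c x assume c: "c \<in> val_integers v" and "x \<in> S'"
      then obtain y where *: "x \<in> S" "y \<in> T0" "g y \<in> sc (m + 1) T" "x - y \<in> sc 1 T" by (auto simp: S'_def)
      have "c *s x - c *s y \<in> sc 1 T" using omod_scale[OF oT' c *(4)] by (simp add: algebra_simps)
      then show "c *s x \<in> S'"
        using * c by (auto simp: S'_def omod_scale[OF oS] omod_scale[OF oT'] scT0 lin_scale[OF lg]
            intro!: bexI[of _ "c *s y"])
    qed
    have sub: "sc 1 T \<subseteq> S'"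
      using zero S(2) by (auto simp: S'_def omod_0[OF oT'] lin_0[OF lg] intro!: bexI[of _ 0])
    have "S' \<subseteq> S" by (auto simp: S'_def)
    have N_stab: "\<rho> k ` S' \<subseteq> S'" if k: "k \<in> N" for k
    proof
      fix x' assume "x' \<in> \<rho> k ` S'"
      then obtain x y where *: "x' = \<rho> k x" "x \<in> S" "y \<in> T0" "g y \<in> sc (m + 1) T" "x - y \<in> sc 1 T"
        by (auto simp: S'_def)
      note lk = lin_rho[OF N_carrier[OF k]]
      have kT: "\<rho> k ` sc i T \<subseteq> sc i T" for i using sc_image_lin[OF lk stabT[of k]] k by simp
      have "\<rho> k y \<in> T0" using *(3) stabT[of k] k by (auto simp: T0_def Q(3)[symmetric])
      moreover have "g (\<rho> k y) \<in> sc (m + 1) T" using *(4) kT by (auto simp: gN[OF k])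
      moreover have "\<rho> k x - \<rho> k y \<in> sc 1 T" using *(5) kT by (auto simp flip: lin_diff[OF lk])
      ultimately show "x' \<in> S'" using *(1,2) stabS[of k] k by (auto simp: S'_def)
    qed
    have z_stab: "\<rho> z ` S' \<subseteq> S'"
    proof
      fix x' assume "x' \<in> \<rho> z ` S'"
      then obtain x y where *: "x' = \<rho> z x" "x \<in> S" "y \<in> T0" "g y \<in> sc (m + 1) T" "x - y \<in> sc 1 T"
        by (auto simp: S'_def)
      have "g (a y) \<in> sc (m + 1) T" using *(4) sc_image_lin[OF la aT] by (auto simp: ga)
      moreover have "\<rho> z (x - y) - (a y - \<rho> z y) \<in> sc 1 T"
        using z_sc *(5) by (intro omod_diff[OF oT' _ near[OF *(3)]]) auto
      then have "\<rho> z x - a y \<in> sc 1 T" by (simp add: lin_diff[OF lz])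
      ultimately show "x' \<in> S'" using *(1,2) aT0[OF *(3)] stabS[of z] by (auto simp: S'_def)
    qed
    have "S' = sc 1 T \<or> S' = S"
      using N_stab z_stab
      by (intro simple lat_between[OF oS' lat_sc[OF T, of 1] S(1)] sub \<open>S' \<subseteq> S\<close>) auto
    \<comment> \<open>If the kernel were everything, each \<open>y\<close> in \<open>T0\<close>
      could be corrected by an element of \<open>p T0\<close> so that \<open>g\<close> takes it into
      \<open>p^(m+1) T\<close>. The correction does not matter there, against the choice of
      \<open>m\<close>.\<close>
    moreover have "S' \<noteq> S"
    proof
      assume eq: "S' = S"
      have "g y \<in> sc (m + 1) T" if y: "y \<in> T0" for y
      proof -
        have "y \<in> S'" using y T0_S eq by auto
        then obtain y1 where y1: "y1 \<in> T0" "g y1 \<in> sc (m + 1) T" "y - y1 \<in> sc 1 T"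
          by (auto simp: S'_def)
        then obtain y2 where y2: "y2 \<in> T0" "y - y1 = p powi 1 *s y2"
          using T0_sc[of "y - y1" 1] y by (auto simp: T0_def lin_diff[OF Q(1)])
        have "g (y - y1) \<in> sc (m + 1) T"
          unfolding y2(2) lin_scale[OF lg] mem_sc_powi_iff using s(1)[OF y2(1)] by simp
        then show ?thesis using omod_add[OF oT' _ y1(2), of "g (y - y1)"] by (simp add: lin_diff[OF lg])
      qed
      then show False using s(2) by blast
    qed
    ultimately have "S' = sc 1 T" by blast
    moreover have "y0 \<in> S'" using y0 T0_S by (auto simp: S'_def omod_0[OF oT'] intro!: bexI[of _ y0])
    ultimately show ?thesis by simp
  qed

  have papp_sc: "papp u h y \<in> sc m T" if "y \<in> sc m T" for y m
    using that by (rule papp_mem[OF lu oT' sc_image_lin[OF lu uT]])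
  have u_sc: "u y \<in> sc m T" if "y \<in> sc m T" for y m
    using that sc_image_lin[OF lu uT] by blast

  have u_T0: "u y \<in> sc 1 T" if "y \<in> T0" for y
  proof (cases "i0 \<le> 1")
    case True
    have "(u ^^ 1) y \<in> sc 1 T"
      using u_deep[of y 1 1] that True by simp
    then show ?thesis by simp
  next
    case False
    then have i02: "2 \<le> i0" by simp
    \<comment> \<open>If \<open>p^s\<close> with \<open>s <= e\<close> is the exact divisibility of
      \<open>g\<close> on \<open>T0\<close>, consider a vector \<open>y'\<close> that is not
      divisible by \<open>p\<close> although \<open>u y'\<close> is. Both parts of the expansion of
      \<open>g y'\<close> are then divisible by \<open>p^(s+1)\<close>, which Schur's lemma
      excludes.\<close>
    have g_deep: "g y \<in> sc (int e + 1) T" if "y \<in> T0" for y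
    proof (rule ccontr)
      assume neg: "g y \<notin> sc (int e + 1) T"
      define s where "s = (LEAST s::nat. \<exists>y\<in>T0. g y \<notin> sc (int s + 1) T)"
      have ex: "\<exists>y\<in>T0. g y \<notin> sc (int e + 1) T" using neg that by blast
      have s1: "\<exists>y\<in>T0. g y \<notin> sc (int s + 1) T"
        unfolding s_def by (rule LeastI[of "\<lambda>s. \<exists>y\<in>T0. g y \<notin> sc (int s + 1) T", OF ex])
      have se: "s \<le> e" unfolding s_def using ex by (rule Least_le[of "\<lambda>s. \<exists>y\<in>T0. g y \<notin> sc (int s + 1) T"])
      have s0: "g y \<in> sc (int s) T" if "y \<in> T0" for y
      proof (cases s)
        case 0
        then show ?thesis using gT that by (auto simp: T0_def)
      next
        case (Suc s')
        then have "\<not> (\<exists>y\<in>T0. g y \<notin> sc (int s' + 1) T)"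
          using not_less_Least[of s' "\<lambda>s. \<exists>y\<in>T0. g y \<notin> sc (int s + 1) T"] by (simp add: s_def)
        then show ?thesis using that Suc by (auto simp: add.commute)
      qed
      obtain y1 where y1: "y1 \<in> T0" "(u ^^ (i0 - 1)) y1 \<notin> sc 1 T"
        using i0_min[of "i0 - 1"] i02 by auto
      define y' where "y' = (u ^^ (i0 - 1)) y1"
      have uy': "u y' \<in> sc 1 T"
        using i0[OF y1(1)] i02 by (cases i0) (auto simp: y'_def)
      have "(u ^^ l) y' = (u ^^ (l + (i0 - 1))) y1" by (simp add: y'_def funpow_add)
      \<comment> \<open>This amounts to \<open>s * i0 <= l - 1\<close>, which follows from
        \<open>s <= e\<close>.\<close>
      moreover have "Suc s * i0 \<le> l + (i0 - 1)"
        using mult_le_mono1[OF se, of i0] i0w i02 unfolding mult_Suc by linarith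
      ultimately have "(u ^^ l) y' \<in> sc (int s + 1) T"
        using u_deep[OF y1(1), of "Suc s"] by (simp add: add.commute)
      moreover have "of_nat l *s (u y' + papp u h (u (u y'))) \<in> sc (int e + 1) T"
        by (rule l_sc[OF omod_add[OF oT' uy' papp_sc[OF u_sc[OF uy']]]])
      then have "of_nat l *s (u y' + papp u h (u (u y'))) \<in> sc (int s + 1) T"
        using sc_mono[OF oT, of "int s + 1" "int e + 1"] se by auto
      ultimately have "g y' \<in> sc (int s + 1) T" unfolding g_u by (intro omod_add[OF oT'])
      then have "y' \<in> sc 1 T"
        using schur[OF s0 s1] upow_T0[OF y1(1)] by (simp add: y'_def)
      then show False using y1(2) by (simp add: y'_def)
    qed
    obtain y1 where y1: "y1 \<in> T0" "(u ^^ (i0 - 1)) y1 \<notin> sc 1 T"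
      using i0_min[of "i0 - 1"] i02 by auto
    \<comment> \<open>One factor \<open>u\<close> earlier, \<open>u y'\<close> is not divisible by
      \<open>p\<close> but \<open>u (u y')\<close> is. Of all terms in the expansion only
      \<open>l u y'\<close> is then not yet known to be divisible by \<open>p^(e+1)\<close>, and the
      expansion forces this too.\<close>
    define y' where "y' = (u ^^ (i0 - 2)) y1"
    have uy': "u y' = (u ^^ (i0 - 1)) y1"
    proof -
      have "i0 - 1 = Suc (i0 - 2)" using i02 by simp
      then show ?thesis by (simp add: y'_def)
    qed
    have uuy': "u (u y') \<in> sc 1 T"
    proof -
      have "i0 = Suc (i0 - 1)" using i02 by simp
      then have "u (u y') = (u ^^ i0) y1" unfolding uy' by (metis funpow.simps(2) comp_apply)
      then show ?thesis using i0[OF y1(1)] by simp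
    qed
    have "(u ^^ l) y' = (u ^^ (l + (i0 - 2))) y1" by (simp add: y'_def funpow_add)
    \<comment> \<open>Here \<open>e * i0 <= l - 2\<close> is used in full; this is the origin of the
      \<open>+ 1\<close> in the bound on \<open>l\<close>.\<close>
    moreover have "Suc e * i0 \<le> l + (i0 - 2)" using i0w i02 by simp
    ultimately have 1: "(u ^^ l) y' \<in> sc (int e + 1) T"
      using u_deep[OF y1(1), of "Suc e"] by (simp add: add.commute)
    have 2: "of_nat l *s papp u h (u (u y')) \<in> sc (int e + 1) T"
      using uuy' by (intro l_sc papp_sc)
    have "g y' \<in> sc (int e + 1) T"
      using g_deep[OF upow_T0[OF y1(1), of "i0 - 2"]] by (simp add: y'_def)
    from omod_diff[OF oT' omod_diff[OF oT' this 1] 2]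
    have "g y' - (u ^^ l) y' - of_nat l *s papp u h (u (u y')) \<in> sc (int e + 1) T" .
    then have "of_nat l *s u y' \<in> sc (int e + 1) T"
      by (simp add: g_u algebra_simps)
    moreover have "of_nat l \<noteq> (0::'a)" using prime_l by auto
    ultimately have "u y' \<in> sc 1 T"
      using mem_sc_iff_of_val[OF oT, of "of_nat l"] by (simp add: val_l)
    then show ?thesis using y1(2) uy' by simp
  qed
  define y where "y = Q x"
  have y: "y \<in> T0" using QT0 x S(3) by (auto simp: y_def)
  have xy: "y - x \<in> sc 1 T" using Q(5)[OF x] by (simp add: y_def)
  have "\<rho> z (y - x) \<in> sc 1 T" using z_sc xy by blast
  from omod_diff[OF oT' omod_diff[OF oT' u_T0[OF y] near[OF y]] omod_diff[OF oT' this xy]]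
  have "u y - (a y - \<rho> z y) - (\<rho> z (y - x) - (y - x)) \<in> sc 1 T" .
  then show ?thesis by (simp add: u_def lin_diff[OF lz] algebra_simps)
qed

end

section \<open>Symplectic forms and dual lattices\<close>

locale symplectic_space = lattice_space +
  fixes f :: "'b \<Rightarrow> 'b \<Rightarrow> 'a"
  assumes f_bilinear: "bilinear_form scale f" and f_nondeg: "nondegenerate_form f"
    and f_alternating: "alternating_form UNIV f"
begin

lemma f_add_right: "f x (y + z) = f x y + f x z"
  and f_scale_right: "f x (c *s y) = c * f x y"
  and f_add_left: "f (x + y) z = f x z + f y z"
  and f_scale_left: "f (c *s x) z = c * f x z"
  using f_bilinear by (auto simp: bilinear_form_def Vector_Spaces.linear_iff)

lemma f_self [simp]: "f x x = 0"
  using f_alternating by (simp add: alternating_form_def)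

lemma f_skew: "f x y = - f y x"
proof -
  have "f (x + y) (x + y) = (f x x + f y x) + (f x y + f y y)" by (simp only: f_add_left f_add_right)
  then have "f x y + f y x = 0" by (simp add: add.commute)
  then show ?thesis by (simp add: eq_neg_iff_add_eq_0)
qed

lemma f_0_left [simp]: "f 0 y = 0" and f_0_right [simp]: "f x 0 = 0"
  using f_scale_left[of 0 0 y] f_scale_right[of x 0 0] by auto

lemma f_minus_left: "f (- x) y = - f x y"
  using f_scale_left[of "-1" x y] by simp

lemma f_diff_left: "f (x - y) z = f x z - f y z"
  using f_add_left[of x "- y" z] by (simp add: f_minus_left)

lemma f_sum_right: "f x (sum g A) = (\<Sum>i\<in>A. f x (g i))"
  by (induction A rule: infinite_finite_induct) (auto simp: f_add_right)

lemma f_expand: "f x y = (\<Sum>i<n. co i y * f x (bv i))"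
  by (subst co_expand[of y, symmetric]) (simp add: f_sum_right f_scale_right)

lemma f_eq_0_imp: "(\<And>y. f x y = 0) \<Longrightarrow> x = 0"
  using f_nondeg by (auto simp: nondegenerate_form_def)

text \<open>The isomorphism of the space with its dual given by the form, where the dual is
  identified with the space through coordinates. As operators on one space, \<open>flat\<close> and
  its inverse \<open>sharp\<close> are covered by \<open>lin_bounded\<close>.\<close>

definition flat :: "'b \<Rightarrow> 'b" where
  "flat x = (\<Sum>i<n. f x (bv i) *s bv i)"

lemma lin_flat: "lin flat"
  by (rule linI) (simp_all add: flat_def f_add_left f_scale_left scale_left_distrib sum.distrib scale_sum_right)

lemma co_flat: "i < n \<Longrightarrow> co i (flat x) = f x (bv i)"
  unfolding flat_def by (rule co_comb)

lemma inj_flat: "inj flat"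
proof (rule injI)
  fix x y assume "flat x = flat y"
  then have "f x (bv i) = f y (bv i)" if "i < n" for i using co_flat[OF that] by metis
  then have "f x w = f y w" for w
    unfolding f_expand[of _ w] by (intro sum.cong) auto
  then show "x = y" using f_eq_0_imp[of "x - y"] by (simp add: f_diff_left)
qed

lemma surj_flat: "surj flat"
  using linear_inj_imp_surj[of flat] lin_flat inj_flat by (simp add: lin_iff_linear)

definition sharp :: "'b \<Rightarrow> 'b" where
  "sharp = inv_into UNIV flat"

lemma sharp_flat: "sharp (flat x) = x" and flat_sharp: "flat (sharp x) = x"
  using inj_flat surj_flat by (simp_all add: sharp_def surj_f_inv_f)

lemma lin_sharp: "lin sharp"
  by (rule linI)
    (metis flat_sharp sharp_flat lin_add[OF lin_flat], metis flat_sharp sharp_flat lin_scale[OF lin_flat])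

text \<open>Only the left argument is tested; by skew symmetry the right one would give the same
  module.\<close>

definition dual :: "'b set \<Rightarrow> 'b set" where
  "dual T = {x. \<forall>y\<in>T. f x y \<in> val_integers v}"

lemma omod_dual: "omod (dual T)"
  by (rule omodI) (auto simp: dual_def f_add_left f_scale_left intro: val_at_least_add val_integers_mult)

lemma dual_antimono: "T \<subseteq> T' \<Longrightarrow> dual T' \<subseteq> dual T"
  by (auto simp: dual_def)

lemma dual_sc: "dual (sc m T) = sc (- m) (dual T)"
proof -
  have "f (p powi m *s x) y = f x (p powi m *s y)" for x y
    by (simp only: f_scale_left f_scale_right)
  then show ?thesis
    by (auto simp: dual_def sc_def elim!: mem_scE intro: mem_sc_powi)
      (metis mem_scE mem_sc_powi sc_def mem_Collect_eq)+
qed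

text \<open>Boundedness of \<open>flat\<close> puts a box inside the dual, boundedness of
  \<open>sharp\<close> encloses the dual in a box.\<close>

lemma lat_dual:
  assumes T: "lat T"
  shows "lat (dual T)"
proof -
  obtain M M' where M: "box M \<subseteq> T" "T \<subseteq> box M'" using T by (auto simp: lat_def)
  obtain C where C: "\<And>M. flat ` box M \<subseteq> box (M + C)" using lin_bounded[OF lin_flat] by blast
  obtain C' where C': "\<And>M. sharp ` box M \<subseteq> box (M + C')" using lin_bounded[OF lin_sharp] by blast
  have "x \<in> dual T" if x: "x \<in> box (- M' - C)" for x
  proof -
    have "flat x \<in> box (- M')" using C[of "- M' - C"] x by auto
    then have *: "f x (bv i) \<in> val_at_least v (- M')" if "i < n" for i
      using that by (auto simp: box_def simp flip: co_flat)
    have "f x y \<in> val_integers v" if "y \<in> T" for y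
    proof -
      have "co i y * f x (bv i) \<in> val_at_least v (M' + - M')" if "i < n" for i
        using \<open>y \<in> T\<close> M(2) that by (intro val_at_least_mult *) (auto simp: box_def)
      then show ?thesis unfolding f_expand[of x y] by (intro val_at_least_sum) simp
    qed
    then show ?thesis by (simp add: dual_def)
  qed
  moreover have "x \<in> box (- M + C')" if x: "x \<in> dual T" for x
  proof -
    have "f x (bv i) \<in> val_at_least v (- M)" if "i < n" for i
    proof -
      have "p powi M *s bv i \<in> box M" using that by (auto simp: box_def co_scale co_bv powi_mem)
      then have "p powi M * f x (bv i) \<in> val_integers v"
        using x M(1) by (auto simp: dual_def simp flip: f_scale_right)
      then have "p powi (- M) * (p powi M * f x (bv i)) \<in> val_at_least v (- M + 0)"
        by (intro val_at_least_mult powi_mem)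
      moreover have "p powi (- M) * (p powi M * f x (bv i)) = f x (bv i)"
        by (simp add: power_int_minus)
      ultimately show ?thesis by simp
    qed
    then have "flat x \<in> box (- M)" by (simp add: box_def co_flat)
    then have "sharp (flat x) \<in> box (- M + C')" using C' by blast
    then show ?thesis by (simp add: sharp_flat)
  qed
  ultimately show ?thesis using omod_dual by (auto simp: lat_def)
qed

lemma functional_representable:
  assumes "Vector_Spaces.linear scale (*) \<phi>"
  obtains x where "\<And>y. f x y = \<phi> y"
proof
  fix y
  have \<phi>: "\<phi> (x + y) = \<phi> x + \<phi> y" "\<phi> (c *s x) = c * \<phi> x" for x y c
    using assms by (auto simp: Vector_Spaces.linear_iff)
  have "\<phi> (sum g A) = (\<Sum>i\<in>A. \<phi> (g i))" for g and A :: "nat set"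
    using \<phi>(2)[of 0 0] by (induction A rule: infinite_finite_induct) (auto simp: \<phi>(1))
  then have "\<phi> y = (\<Sum>i<n. co i y * \<phi> (bv i))"
    by (subst co_expand[of y, symmetric]) (simp add: \<phi>(2))
  moreover have "f (sharp (\<Sum>i<n. \<phi> (bv i) *s bv i)) (bv i) = \<phi> (bv i)" if "i < n" for i
    using co_flat[OF that] co_comb[OF that] by (metis flat_sharp)
  ultimately show "f (sharp (\<Sum>i<n. \<phi> (bv i) *s bv i)) y = \<phi> y"
    by (simp add: f_expand[of _ y])
qed

text \<open>A functional on \<open>T\<close> extends to the space through a basis of
  \<open>T\<close> and is represented there by a vector; integrality of its values puts this vector
  into the dual, which is \<open>T\<close>.\<close>

lemma self_dual_imp_perfect:
  assumes T: "lat T" and self_dual: "dual T = T"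
  shows "integral_bilinear_form v scale T f" "perfect_form v scale T f"
proof -
  note oT = lat_omod[OF T]
  have int: "f x y \<in> val_integers v" if "x \<in> T" "y \<in> T" for x y
    using that self_dual by (auto simp: dual_def)
  have left: "(\<lambda>y\<in>T. f x y) \<in> lattice_dual v scale T" if "x \<in> T" for x
    using int[OF that] by (auto simp: lattice_dual_def f_add_right f_scale_right omod_add[OF oT] omod_scale[OF oT])
  \<comment> \<open>Skew symmetry turns the second adjoint map into the first one composed with
    negation, so one bijection suffices.\<close>
  have right: "(\<lambda>x\<in>T. f x y) = (\<lambda>x\<in>T. f (- y) x)" for y
    by (rule restrict_ext) (simp add: f_minus_left f_skew[of _ y])
  show "integral_bilinear_form v scale T f"
    unfolding integral_bilinear_form_def right using left omod_minus[OF oT] by blast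
  obtain B where B: "finite B" "independent B" and BT: "\<And>b. b \<in> B \<Longrightarrow> b \<in> T"
    and TB: "T = {\<Sum>b\<in>B. c b *s b | c. \<forall>b\<in>B. c b \<in> val_integers v}"
    by (rule lattice_basis[OF T]) blast
  have bij: "bij_betw (\<lambda>x. \<lambda>y\<in>T. f x y) T (lattice_dual v scale T)"
  proof (rule bij_betw_imageI)
    show "inj_on (\<lambda>x. \<lambda>y\<in>T. f x y) T"
    proof (rule inj_onI)
      fix x x' assume eq: "(\<lambda>y\<in>T. f x y) = (\<lambda>y\<in>T. f x' y)"
      have "f (x - x') y = 0" for y
      proof -
        obtain m where "y \<in> sc m T" using lat_ex_sc[OF T] by blast
        then obtain w where w: "w \<in> T" "y = p powi m *s w" by (rule mem_scE)
        then have "f x w = f x' w" using fun_cong[OF eq, of w] by simp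
        then show ?thesis by (simp add: w(2) f_diff_left f_scale_right)
      qed
      then show "x = x'" using f_eq_0_imp[of "x - x'"] by simp
    qed
    show "(\<lambda>x. \<lambda>y\<in>T. f x y) ` T = lattice_dual v scale T"
    proof
      show "(\<lambda>x. \<lambda>y\<in>T. f x y) ` T \<subseteq> lattice_dual v scale T" using left by blast
      show "lattice_dual v scale T \<subseteq> (\<lambda>x. \<lambda>y\<in>T. f x y) ` T"
      proof
        fix \<phi> assume \<phi>: "\<phi> \<in> lattice_dual v scale T"
        interpret vector_space_pair scale "(*) :: 'a \<Rightarrow> 'a \<Rightarrow> 'a"
          by unfold_locales (auto simp: algebra_simps)
        obtain \<psi> where \<psi>: "Vector_Spaces.linear scale (*) \<psi>" "\<And>b. b \<in> B \<Longrightarrow> \<psi> b = \<phi> b"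
          using linear_independent_extend[OF B(2), of \<phi>] by auto
        obtain x where x: "\<And>y. f x y = \<psi> y" using functional_representable[OF \<psi>(1)] by blast
        have \<phi>_add: "\<phi> (a + b) = \<phi> a + \<phi> b" if "a \<in> T" "b \<in> T" for a b
          using \<phi> that by (auto simp: lattice_dual_def)
        have \<phi>_scale: "\<phi> (c *s a) = c * \<phi> a" if "c \<in> val_integers v" "a \<in> T" for c a
          using \<phi> that by (auto simp: lattice_dual_def)
        have \<phi>_0: "\<phi> 0 = 0" using \<phi>_scale[OF _ omod_0[OF oT], of 0] by simp
        \<comment> \<open>\<open>\<phi>\<close> is additive only on \<open>T\<close>, so the
          induction has to keep all partial sums in \<open>T\<close>.\<close>
        have \<phi>_sum: "\<phi> (\<Sum>b\<in>A. c b *s b) = (\<Sum>b\<in>A. c b * \<phi> b)"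
          if "finite A" "A \<subseteq> B" "\<forall>b\<in>B. c b \<in> val_integers v" for A c
          using that(1,2)
        proof (induction A)
          case (insert a A)
          have "(\<Sum>b\<in>A. c b *s b) \<in> T"
            using insert.prems that(3) BT by (intro omod_sum[OF oT] omod_scale[OF oT]) auto
          then show ?case
            using insert that(3) BT[of a] by (simp add: \<phi>_add \<phi>_scale omod_scale[OF oT])
        qed (simp add: \<phi>_0)
        have eq: "f x y = \<phi> y" if y: "y \<in> T" for y
        proof -
          obtain c where c: "y = (\<Sum>b\<in>B. c b *s b)" "\<forall>b\<in>B. c b \<in> val_integers v"
            using y unfolding TB by blast
          have "f x y = (\<Sum>b\<in>B. c b * f x b)" by (simp add: c(1) f_sum_right f_scale_right)
          also have "\<dots> = (\<Sum>b\<in>B. c b * \<phi> b)" by (rule sum.cong) (simp_all add: x \<psi>(2))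
          also have "\<dots> = \<phi> y" using \<phi>_sum[OF B(1) order_refl c(2)] by (simp add: c(1))
          finally show ?thesis .
        qed
        then have "x \<in> dual T" using \<phi> by (auto simp: dual_def lattice_dual_def)
        then have "x \<in> T" by (simp add: self_dual)
        moreover have "\<phi> = (\<lambda>y\<in>T. f x y)"
          using \<phi> eq by (auto simp: lattice_dual_def PiE_def extensional_def fun_eq_iff)
        ultimately show "\<phi> \<in> (\<lambda>x. \<lambda>y\<in>T. f x y) ` T" by blast
      qed
    qed
  qed
  have "bij_betw uminus T T"
    by (rule bij_betw_byWitness[where f' = uminus]) (auto simp: omod_minus[OF oT])
  from bij_betw_trans[OF this bij]
  have "bij_betw (\<lambda>y. \<lambda>x\<in>T. f x y) T (lattice_dual v scale T)"
    by (simp add: comp_def right)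
  with bij show "perfect_form v scale T f" by (simp add: perfect_form_def)
qed

end

section \<open>Maximal integral lattices\<close>

locale symplectic_lattice_rep = lattice_rep + symplectic_space +
  fixes d :: nat and t :: "'c"
  assumes f_invariant: "invariant_form G \<rho> UNIV f"
    and simple: "simple_rep scale G \<rho>"
    and n_eq: "n = 2 * d" and small: "e * d + 1 < l"
    and t: "t \<in> carrier G" and t_order: "\<exists>k. t [^] (l ^ k) = \<one>"
    and generated: "g \<in> carrier G \<Longrightarrow> \<exists>m\<in>N. \<exists>j::nat. g = m \<otimes> t [^] j"
begin

section \<open>Stable lattices and maximal integral ones\<close>

lemma f_inv: "g \<in> carrier G \<Longrightarrow> f (\<rho> g x) (\<rho> g y) = f x y"
  using f_invariant by (simp add: invariant_form_def)

lemma int_n: "int n = 2 * int d"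
  using n_eq by simp

lemma simple_subspace:
  assumes "subspace W" "stable G \<rho> W"
  shows "W = {0} \<or> W = UNIV"
  using simple assms by (auto simp: simple_rep_def)

lemma stable_sc: "stable G \<rho> L \<Longrightarrow> stable G \<rho> (sc m L)"
  unfolding stable_def using sc_image_lin[OF lin_rho] by blast

lemma stableD: "stable G \<rho> L \<Longrightarrow> g \<in> carrier G \<Longrightarrow> \<rho> g ` L \<subseteq> L"
  by (simp add: stable_def)

lemma stable_mem: "stable G \<rho> L \<Longrightarrow> g \<in> carrier G \<Longrightarrow> x \<in> L \<Longrightarrow> \<rho> g x \<in> L"
  by (auto simp: stable_def)

lemma stable_dual:
  assumes "stable G \<rho> L"
  shows "stable G \<rho> (dual L)"
  unfolding stable_def
proof (intro ballI image_subsetI)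
  fix g x assume g: "g \<in> carrier G" and x: "x \<in> dual L"
  have "f (\<rho> g x) y \<in> val_integers v" if "y \<in> L" for y
  proof -
    have "f (\<rho> g x) y = f x (\<rho> (inv g) y)"
      using f_inv[OF g, of x "\<rho> (inv g) y"] g by simp
    then show ?thesis using x stable_mem[OF assms inv_closed[OF g] that] by (simp add: dual_def)
  qed
  then show "\<rho> g x \<in> dual L" by (simp add: dual_def)
qed

lemma stable_lsum:
  assumes "stable G \<rho> L" "stable G \<rho> L'"
  shows "stable G \<rho> (lsum L L')"
  unfolding stable_def
proof (intro ballI image_subsetI)
  fix g x assume g: "g \<in> carrier G" and "x \<in> lsum L L'"
  then obtain y y' where y: "x = y + y'" "y \<in> L" "y' \<in> L'" by (auto simp: lsum_def)
  then show "\<rho> g x \<in> lsum L L'"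
    using stable_mem[OF assms(1) g y(2)] stable_mem[OF assms(2) g y(3)]
    by (auto simp: lin_add[OF lin_rho[OF g]] intro: lsumI)
qed

text \<open>The intersection of the finitely many translates of the standard lattice is
  stable.\<close>

lemma ex_stable_lattice: "\<exists>L. lat L \<and> stable G \<rho> L"
proof -
  define L where "L = {x. \<forall>g\<in>carrier G. \<rho> g x \<in> box 0}"
  have oL: "omod L"
    by (rule omodI)
      (auto simp: L_def lin_0[OF lin_rho] lin_add[OF lin_rho] lin_scale[OF lin_rho]
        omod_0[OF omod_box] omod_add[OF omod_box] omod_scale[OF omod_box])
  have "\<forall>g\<in>carrier G. \<exists>C. \<forall>M. \<rho> g ` box M \<subseteq> box (M + C)"
    using lin_bounded[OF lin_rho] by blast
  then obtain C where C: "\<And>g M. g \<in> carrier G \<Longrightarrow> \<rho> g ` box M \<subseteq> box (M + C g)" by metis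
  define M where "M = Max ((\<lambda>g. - C g) ` carrier G)"
  have "\<rho> g x \<in> box 0" if "g \<in> carrier G" "x \<in> box M" for g x
  proof -
    have "- C g \<le> M" using finite_G that(1) by (auto simp: M_def intro!: Max_ge)
    then show ?thesis using C[OF that(1), of M] box_mono[of 0 "M + C g"] that(2) by auto
  qed
  then have "box M \<subseteq> L" by (auto simp: L_def)
  moreover have "L \<subseteq> box 0" using rho_1 by (auto simp: L_def dest: bspec[OF _ one_closed])
  ultimately have "lat L" using oL by (auto simp: lat_def)
  moreover have "stable G \<rho> L"
    by (auto simp: stable_def L_def simp flip: rho_mult)
  ultimately show ?thesis by blast
qed

text \<open>A high multiple \<open>p^m\<close> of any stable lattice is integral, and every integral
  lattice above it lies in the dual of this multiple, which bounds the search from above.\<close>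

lemma ex_maximal_integral:
  obtains T where "lat T" "stable G \<rho> T" "T \<subseteq> dual T"
    "\<And>T'. lat T' \<Longrightarrow> stable G \<rho> T' \<Longrightarrow> T' \<subseteq> dual T' \<Longrightarrow> T \<subseteq> T' \<Longrightarrow> T' = T"
proof -
  obtain L where L: "lat L" "stable G \<rho> L" using ex_stable_lattice by blast
  obtain m0 where m0: "\<And>m. m \<ge> m0 \<Longrightarrow> sc m L \<subseteq> dual L" using lat_absorb[OF L(1) lat_dual[OF L(1)]] by blast
  define m where "m = max m0 0"
  \<comment> \<open>Multiplication by \<open>p^m\<close> shrinks the lattice and enlarges its dual
    by the same factor, so \<open>m + m\<close> is the exponent that counts.\<close>
  have "sc m (sc m L) \<subseteq> sc m (dual (sc m L))"
    using m0[of "m + m"] by (simp add: sc_sc dual_sc m_def)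
  then have int: "sc m L \<subseteq> dual (sc m L)" by (simp only: sc_subset_iff)
  show ?thesis
  proof (rule lat_maximal[of "sc m L" "\<lambda>T. stable G \<rho> T \<and> T \<subseteq> dual T" "dual (sc m L)"])
    show "lat (sc m L)" by (rule lat_sc[OF L(1)])
    show "stable G \<rho> (sc m L) \<and> sc m L \<subseteq> dual (sc m L)" using int stable_sc[OF L(2)] by blast
    show "L' \<subseteq> dual (sc m L)" if "stable G \<rho> L' \<and> L' \<subseteq> dual L'" "sc m L \<subseteq> L'" for L'
      using that dual_antimono[OF that(2)] by blast
    show "lat (dual (sc m L))" by (rule lat_dual[OF lat_sc[OF L(1)]])
    fix T assume "lat T" "stable G \<rho> T \<and> T \<subseteq> dual T"
      "\<And>L'. lat L' \<Longrightarrow> stable G \<rho> L' \<and> L' \<subseteq> dual L' \<Longrightarrow> T \<subseteq> L' \<Longrightarrow> L' = T"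
    then show thesis by (intro that[of T]) simp_all
  qed
qed

text \<open>Let \<open>j\<close> be least such that \<open>p^j\<close> times the dual lies in
  \<open>T\<close>. If \<open>j >= 2\<close>, then \<open>p^(j-1)\<close> times the dual could be
  added to \<open>T\<close>: on it the form is \<open>p^(j-2)\<close> times a pairing of the dual
  with \<open>T\<close>.\<close>

lemma maximal_integral_dual:
  assumes T: "lat T" "stable G \<rho> T" "T \<subseteq> dual T"
    and max: "\<And>T'. lat T' \<Longrightarrow> stable G \<rho> T' \<Longrightarrow> T' \<subseteq> dual T' \<Longrightarrow> T \<subseteq> T' \<Longrightarrow> T' = T"
  shows "sc 1 (dual T) \<subseteq> T"
proof -
  note oT = lat_omod[OF T(1)] and lD = lat_dual[OF T(1)]
  obtain m where m: "\<And>m'. m' \<ge> m \<Longrightarrow> sc m' (dual T) \<subseteq> T" using lat_absorb[OF lD T(1)] by blast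
  define j where "j = (LEAST j::nat. sc (int j) (dual T) \<subseteq> T)"
  have j: "sc (int j) (dual T) \<subseteq> T"
    unfolding j_def by (rule LeastI[of "\<lambda>j. sc (int j) (dual T) \<subseteq> T" "nat m"]) (rule m, simp)
  have "j \<le> 1"
  proof (rule ccontr)
    assume "\<not> j \<le> 1"
    then obtain i where i: "j = Suc (Suc i)" by (metis One_nat_def not_less_eq_eq old.nat.exhaust zero_le)
    define S where "S = lsum T (sc (int i + 1) (dual T))"
    have oS: "omod S" unfolding S_def by (intro omod_lsum omod_sc omod_dual oT)
    have sub: "T \<subseteq> S" unfolding S_def by (intro lsum_left omod_sc omod_dual)
    have i1: "sc (int i + 1) (dual T) \<subseteq> dual T" using sc_mono[OF omod_dual, of 0 "int i + 1" T] by simp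
    have "S \<subseteq> dual T" unfolding S_def using T(3) i1 by (intro lsum_least omod_dual)
    then have lS: "lat S" by (rule lat_between[OF oS T(1) lD sub])
    \<comment> \<open>One factor \<open>p\<close> is moved from \<open>a\<close> to
      \<open>b\<close>, which brings \<open>b\<close> into \<open>T\<close>; the power
      \<open>p^i\<close> that remains is integral.\<close>
    have aa: "f a b \<in> val_integers v" if a: "a \<in> sc (int i + 1) (dual T)" and b: "b \<in> sc (int i + 1) (dual T)" for a b
    proof -
      obtain a' where a': "a' \<in> dual T" "a = p powi (int i + 1) *s a'" using a by (rule mem_scE)
      have "p powi 1 *s b \<in> sc (int j) (dual T)"
        using b unfolding mem_sc_powi_iff by (simp add: i add.commute)
      then have "p powi 1 *s b \<in> T" using j by blast
      then have "f a' (p powi 1 *s b) \<in> val_integers v" using a'(1) unfolding dual_def by blast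
      then have "p powi int i * f a' (p powi 1 *s b) \<in> val_integers v"
        using val_at_least_mono[OF powi_mem, of 0 "int i"] by (intro val_integers_mult) auto
      then show ?thesis by (simp add: a'(2) f_scale_left f_scale_right power_int_add mult.assoc)
    qed
    have "S \<subseteq> dual S"
    proof
      fix x assume "x \<in> S"
      then obtain s a where x: "x = s + a" "s \<in> T" "a \<in> sc (int i + 1) (dual T)" by (auto simp: S_def lsum_def)
      have "f x y \<in> val_integers v" if "y \<in> S" for y
      proof -
        obtain s' b where y: "y = s' + b" "s' \<in> T" "b \<in> sc (int i + 1) (dual T)"
          using \<open>y \<in> S\<close> by (auto simp: S_def lsum_def)
        have 1: "f s s' \<in> val_integers v" using T(3) x(2) y(2) by (auto simp: dual_def)
        have 2: "f a s' \<in> val_integers v" using i1 x(3) y(2) by (auto simp: dual_def)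
        have "f b s \<in> val_integers v" using i1 y(3) x(2) by (auto simp: dual_def)
        then have 3: "f s b \<in> val_integers v" by (subst f_skew) (rule val_at_least_uminus)
        have "f x y = (f s s' + f s b) + (f a s' + f a b)"
          by (simp add: x(1) y(1) f_add_left f_add_right algebra_simps)
        then show ?thesis using 1 2 3 aa[OF x(3) y(3)] by (simp add: val_at_least_add)
      qed
      then show "x \<in> dual S" by (simp add: dual_def)
    qed
    moreover have "stable G \<rho> S" unfolding S_def by (intro stable_lsum stable_sc stable_dual T(2))
    ultimately have "S = T" using max[OF lS _ _ sub] by blast
    then have "sc (int (Suc i)) (dual T) \<subseteq> T"
      using lsum_right[OF oT, of "sc (int i + 1) (dual T)"] by (simp add: S_def add.commute)
    then have "j \<le> Suc i" unfolding j_def by (rule Least_le)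
    then show False using i by simp
  qed
  then show ?thesis using j sc_mono[OF omod_dual, of "int j" 1 T] by auto
qed

text \<open>The powers of \<open>t\<close> act trivially, so an \<open>N\<close>-equivariant
  idempotent commutes with all of \<open>G\<close>, and its fixed space is \<open>0\<close> or
  everything.\<close>

lemma N_simple_case:
  assumes t1: "\<And>x. \<rho> t x = x"
    and L: "lat L" "stable G \<rho> L" and T: "lat T" "stable G \<rho> T" "sc 1 L \<subseteq> T" "T \<subseteq> L"
  shows "T = L \<or> T = sc 1 L"
proof -
  obtain Q where Q: "lin Q" "\<And>x. Q (Q x) = Q x" "\<And>g x. g \<in> N \<Longrightarrow> \<rho> g (Q x) = Q (\<rho> g x)"
    "Q ` L \<subseteq> T" "\<And>x. x \<in> T \<Longrightarrow> Q x - x \<in> sc 1 L"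
    by (rule equivariant_idempotent[OF L(1) T(1,3,4) stableD[OF L(2) N_carrier] stableD[OF T(2) N_carrier]]) auto
  define W where "W = {x. Q x = x}"
  have "subspace W"
    by (auto simp: subspace_def W_def lin_0[OF Q(1)] lin_add[OF Q(1)] lin_scale[OF Q(1)])
  moreover have "stable G \<rho> W"
    unfolding stable_def
  proof (intro ballI image_subsetI)
    fix g x assume "g \<in> carrier G" "x \<in> W"
    then obtain m and j :: nat where m: "m \<in> N" "g = m \<otimes> t [^] j" using generated by blast
    have "\<rho> (t [^] j) x = x" for x unfolding rho_pow[OF t] by (induction j) (auto simp: t1)
    then have "\<rho> g x = \<rho> m x" using m t N_carrier by (simp add: rho_mult)
    then show "\<rho> g x \<in> W" using \<open>x \<in> W\<close> Q(3)[OF m(1), of x] by (simp add: W_def)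
  qed
  ultimately have "W = {0} \<or> W = UNIV" by (rule simple_subspace)
  then show ?thesis
  proof
    assume "W = {0}"
    then have Q0: "Q x = 0" for x using Q(2)[of x] by (auto simp: W_def)
    have "T \<subseteq> sc 1 L"
    proof
      fix x assume "x \<in> T"
      then have "- x \<in> sc 1 L" using Q(5) Q0 by force
      then show "x \<in> sc 1 L" using omod_minus[OF omod_sc[OF lat_omod[OF L(1)]]] by fastforce
    qed
    then show ?thesis using T(3) by blast
  next
    assume "W = UNIV"
    then have "Q x = x" for x by (auto simp: W_def)
    then show ?thesis using Q(4) T(4) by auto
  qed
qed

text \<open>In the sequence of the elements \<open>t^(l^k)\<close>, \<open>z\<close> is the one just
  before the first that acts trivially. As a power of \<open>t\<close> it commutes with
  \<open>t\<close>.\<close>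

lemma ex_power_of_prime_order:
  assumes "\<rho> t x0 \<noteq> x0"
  obtains z where "z \<in> carrier G" "\<And>x. (\<rho> z ^^ l) x = x" "\<exists>x. \<rho> z x \<noteq> x"
    "\<And>x. \<rho> z (\<rho> t x) = \<rho> t (\<rho> z x)"
proof -
  define P where "P k \<longleftrightarrow> (\<forall>x. \<rho> (t [^] (l ^ k)) x = x)" for k
  obtain k where "P k" using t_order rho_1 unfolding P_def by metis
  then have Pk: "P (LEAST k. P k)" by (rule LeastI)
  have "\<not> P 0" using assms t by (auto simp: P_def)
  then obtain i where i: "(LEAST k. P k) = Suc i" using Pk by (cases "LEAST k. P k") auto
  have notP: "\<not> P i" using not_less_Least[of i P] i by simp
  define z where "z = t [^] (l ^ i)"
  have z: "z \<in> carrier G" using t by (simp add: z_def)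
  show ?thesis
  proof (rule that[OF z])
    have "z [^] l = t [^] (l ^ Suc i)" using t by (simp add: z_def nat_pow_pow mult.commute)
    then show "(\<rho> z ^^ l) x = x" for x
      using Pk unfolding i by (simp add: P_def flip: rho_pow[OF z])
    show "\<exists>x. \<rho> z x \<noteq> x" using notP by (auto simp: P_def z_def)
    show "\<rho> z (\<rho> t x) = \<rho> t (\<rho> z x)" for x
      using t by (simp add: z_def rho_pow funpow_swap1)
  qed
qed

text \<open>The smallness of \<open>L / Y\<close> is used only to find one layer
  \<open>S / Y\<close> on which \<open>z\<close> is trivial. From it a \<open>G\<close>-stable
  module \<open>X2 / Y\<close> is built on which commutators of \<open>z\<close> with
  \<open>N\<close> are trivial. They lie in the kernel \<open>N1\<close> of \<open>N\<close> on it;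
  as the order of \<open>N1\<close> is prime to \<open>l\<close>, its fixed residue vectors lift,
  and simplicity makes \<open>N1\<close> act trivially on the whole space.\<close>

lemma central_from_small_quotient:
  assumes z: "z \<in> carrier G" "\<And>x. (\<rho> z ^^ l) x = x" "\<And>x. \<rho> z (\<rho> t x) = \<rho> t (\<rho> z x)"
    and Y: "lat Y" "stable G \<rho> Y" and L: "lat L" "stable G \<rho> L" "sc 1 L \<subseteq> Y" "Y \<subset> L"
    and small_vol: "vol Y - vol L \<le> int d"
    and g: "g \<in> carrier G"
  shows "\<rho> z (\<rho> g x) = \<rho> g (\<rho> z x)"
proof -
  note oY = lat_omod[OF Y(1)] and oL = lat_omod[OF L(1)] and lz = lin_rho[OF z(1)]
  \<comment> \<open>With this choice \<open>p T\<close> is \<open>Y\<close>, so that the result on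
    simple layers applies to modules just above \<open>Y\<close>.\<close>
  define T where "T = sc (- 1) Y"
  have lT: "lat T" unfolding T_def by (rule lat_sc[OF Y(1)])
  have TY: "sc 1 T = Y" by (simp add: T_def sc_sc)
  have "sc (-1) (sc 1 L) \<subseteq> T" unfolding T_def by (rule sc_subset[OF L(3)])
  then have LT: "L \<subseteq> T" by (simp add: sc_sc)
  define H where "H = insert z N"
  have H: "h \<in> carrier G" if "h \<in> H" for h using that z(1) N_carrier by (auto simp: H_def)
  obtain S where S: "lat S" "Y \<subset> S" "S \<subseteq> L" "\<And>h. h \<in> H \<Longrightarrow> \<rho> h ` S \<subseteq> S"
    and S_min: "\<And>S'. lat S' \<Longrightarrow> Y \<subset> S' \<and> S' \<subseteq> L \<and> (\<forall>h\<in>H. \<rho> h ` S' \<subseteq> S') \<Longrightarrow> S' \<subseteq> S \<Longrightarrow> S' = S"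
    by (rule lat_minimal[of L "\<lambda>S. Y \<subset> S \<and> S \<subseteq> L \<and> (\<forall>h\<in>H. \<rho> h ` S \<subseteq> S)" Y])
      (use L Y stableD[OF L(2) H] in auto)
  have zS: "\<rho> z x - x \<in> Y" if "x \<in> S" for x
    unfolding TY[symmetric]
  proof (rule prime_order_trivial_on_small_simple[OF z(1,2) lT S(1) _ _ _ _ _ _ _ that])
    show "sc 1 T \<subseteq> S" "S \<subseteq> T" using S(2,3) LT by (auto simp: TY)
    show "\<rho> h ` T \<subseteq> T" if "h \<in> insert z N" for h
      using that stableD[OF stable_sc[OF Y(2)] H] by (simp add: T_def H_def)
    show "\<rho> h ` S \<subseteq> S" if "h \<in> insert z N" for h using that S(4) by (simp add: H_def)
    show "vol (sc 1 T) - vol S \<le> int d"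
      using small_vol vol_antimono[OF S(1) L(1) S(3)] by (simp add: TY)
    show "e * d + 1 < l" by (rule small)
    fix S' assume S': "lat S'" "sc 1 T \<subseteq> S'" "S' \<subseteq> S" "\<And>h. h \<in> insert z N \<Longrightarrow> \<rho> h ` S' \<subseteq> S'"
    show "S' = sc 1 T \<or> S' = S"
    proof (cases "S' = Y")
      case False
      then have "Y \<subset> S'" using S'(2) by (auto simp: TY)
      then show ?thesis using S_min[OF S'(1) _ S'(3)] S'(3,4) S(3) by (auto simp: H_def)
    qed (simp add: TY)
  qed
  \<comment> \<open>The largest \<open>N\<close>-stable submodule of \<open>L\<close> on which
    \<open>z\<close> is trivial modulo \<open>Y\<close>. It is stable under \<open>t\<close> because
    \<open>t\<close> normalizes \<open>N\<close> and commutes with \<open>z\<close>.\<close>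
  define X2 where "X2 = {x \<in> L. \<forall>m\<in>N. \<rho> z (\<rho> m x) - \<rho> m x \<in> Y}"
  have X2_zY: "\<rho> z x - x \<in> Y" if "x \<in> X2" for x
  proof -
    have "\<rho> z (\<rho> \<one> x) - \<rho> \<one> x \<in> Y" using that subgroup.one_closed[OF subgroup_N] by (simp add: X2_def)
    then show ?thesis by (simp add: rho_1)
  qed
  have YX2: "Y \<subseteq> X2"
  proof
    fix x assume x: "x \<in> Y"
    have "\<rho> z (\<rho> m x) - \<rho> m x \<in> Y" if "m \<in> N" for m
      using stable_mem[OF Y(2)] x z(1) N_carrier[OF that] by (intro omod_diff[OF oY]) auto
    then show "x \<in> X2" using x L(4) by (auto simp: X2_def)
  qed
  have SX2: "S \<subseteq> X2"
  proof
    fix x assume x: "x \<in> S"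
    have "\<rho> z (\<rho> m x) - \<rho> m x \<in> Y" if "m \<in> N" for m
      using S(4)[of m] x that by (intro zS) (auto simp: H_def)
    then show "x \<in> X2" using x S(3) by (auto simp: X2_def)
  qed
  have X2_N: "\<rho> k x \<in> X2" if k: "k \<in> N" and x: "x \<in> X2" for k x
  proof -
    have "\<rho> z (\<rho> m (\<rho> k x)) - \<rho> m (\<rho> k x) \<in> Y" if m: "m \<in> N" for m
    proof -
      have "m \<otimes> k \<in> N" using m k subgroup.m_closed[OF subgroup_N] by blast
      then have "\<rho> z (\<rho> (m \<otimes> k) x) - \<rho> (m \<otimes> k) x \<in> Y" using x by (simp add: X2_def)
      then show ?thesis using m k N_carrier by (simp add: rho_mult)
    qed
    then show ?thesis using x stable_mem[OF L(2) N_carrier[OF k]] by (simp add: X2_def)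
  qed
  have X2_t: "\<rho> t x \<in> X2" if x: "x \<in> X2" for x
  proof -
    have "\<rho> z (\<rho> m (\<rho> t x)) - \<rho> m (\<rho> t x) \<in> Y" if m: "m \<in> N" for m
    proof -
      define m' where "m' = inv t \<otimes> m \<otimes> t"
      have m': "m' \<in> N" unfolding m'_def by (rule normal.inv_op_closed1[OF normal_N t m])
      have mt: "\<rho> m (\<rho> t x) = \<rho> t (\<rho> m' x)"
        using t N_carrier[OF m] by (simp add: m'_def rho_mult)
      have "\<rho> z (\<rho> m' x) - \<rho> m' x \<in> Y" using x m' by (simp add: X2_def)
      then have "\<rho> t (\<rho> z (\<rho> m' x) - \<rho> m' x) \<in> Y" by (rule stable_mem[OF Y(2) t])
      then show ?thesis by (simp add: mt z(3) lin_diff[OF lin_rho[OF t]])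
    qed
    then show ?thesis using x stable_mem[OF L(2) t] by (simp add: X2_def)
  qed
  have X2_G: "\<rho> h x \<in> X2" if h: "h \<in> carrier G" and x: "x \<in> X2" for h x
  proof -
    obtain m and j :: nat where m: "m \<in> N" "h = m \<otimes> t [^] j" using generated[OF h] by blast
    have "\<rho> (t [^] j) x \<in> X2" unfolding rho_pow[OF t] using x by (induction j) (auto intro: X2_t)
    then show ?thesis using m t N_carrier by (simp add: rho_mult X2_N)
  qed
  \<comment> \<open>The kernel of \<open>N\<close> on \<open>X2 / Y\<close>. Conjugation by
    \<open>G\<close> preserves it, since \<open>G\<close> preserves \<open>N\<close>,
    \<open>X2\<close> and \<open>Y\<close>; so its fixed space \<open>W\<close> is a
    subrepresentation.\<close>
  define N1 where "N1 = {m \<in> N. \<forall>x\<in>X2. \<rho> m x - x \<in> Y}"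
  have N1: "subgroup N1 G"
  proof (rule subgroupI)
    show "N1 \<subseteq> carrier G" using N_carrier by (auto simp: N1_def)
    show "N1 \<noteq> {}"
      using subgroup.one_closed[OF subgroup_N] omod_0[OF oY] by (auto simp: N1_def rho_1 intro!: exI[of _ \<one>])
    fix a assume a: "a \<in> N1"
    then have aN: "a \<in> N" by (simp add: N1_def)
    show "inv a \<in> N1"
    proof -
      have "\<rho> (inv a) x - x \<in> Y" if x: "x \<in> X2" for x
      proof -
        have ia: "inv a \<in> carrier G" using N_carrier[OF aN] by simp
        have "\<rho> a (\<rho> (inv a) x) - \<rho> (inv a) x \<in> Y" using a X2_G[OF ia x] by (simp add: N1_def)
        then have "x - \<rho> (inv a) x \<in> Y" using N_carrier[OF aN] by simp
        from omod_minus[OF oY this] show ?thesis by simp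
      qed
      then show ?thesis using subgroup.m_inv_closed[OF subgroup_N aN] by (simp add: N1_def)
    qed
    fix b assume b: "b \<in> N1"
    then have bN: "b \<in> N" by (simp add: N1_def)
    have "\<rho> (a \<otimes> b) x - x \<in> Y" if x: "x \<in> X2" for x
    proof -
      have "\<rho> a (\<rho> b x) - \<rho> b x \<in> Y" using a X2_N[OF bN x] by (simp add: N1_def)
      moreover have "\<rho> b x - x \<in> Y" using b x by (simp add: N1_def)
      ultimately have "(\<rho> a (\<rho> b x) - \<rho> b x) + (\<rho> b x - x) \<in> Y" by (rule omod_add[OF oY])
      then show ?thesis using N_carrier aN bN by (simp add: rho_mult)
    qed
    then show "a \<otimes> b \<in> N1" using subgroup.m_closed[OF subgroup_N aN bN] by (simp add: N1_def)
  qed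
  have "card N1 dvd card N"
  proof -
    have "subgroup N1 (G\<lparr>carrier := N\<rparr>)"
      by (rule subgroup_incl[OF N1 subgroup_N]) (auto simp: N1_def)
    then have "card (rcosets\<^bsub>G\<lparr>carrier := N\<rparr>\<^esub> N1) * card N1 = Coset.order (G\<lparr>carrier := N\<rparr>)"
      by (rule group.lagrange[OF subgroup_imp_group[OF subgroup_N]])
    then have "card N = card (rcosets\<^bsub>G\<lparr>carrier := N\<rparr>\<^esub> N1) * card N1"
      by (simp add: Coset.order_def)
    then show ?thesis by simp
  qed
  then have cop: "coprime (card N1) l"
    using coprime_N by (meson coprime_divisors dvd_refl)
  define W where "W = {x. \<forall>h\<in>N1. \<rho> h x = x}"
  have N1c: "h \<in> carrier G" if "h \<in> N1" for h using that N_carrier by (simp add: N1_def)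
  have "subspace W"
    using lin_rho[OF N1c] by (auto simp: subspace_def W_def lin_0 lin_add lin_scale)
  moreover have "stable G \<rho> W"
    unfolding stable_def
  proof (intro ballI image_subsetI)
    fix k x assume k: "k \<in> carrier G" and x: "x \<in> W"
    have "\<rho> h (\<rho> k x) = \<rho> k x" if h: "h \<in> N1" for h
    proof -
      define h' where "h' = inv k \<otimes> h \<otimes> k"
      have hN: "h \<in> N" using h by (simp add: N1_def)
      have "h' \<in> N" unfolding h'_def by (rule normal.inv_op_closed1[OF normal_N k hN])
      moreover have "\<rho> h' y - y \<in> Y" if y: "y \<in> X2" for y
      proof -
        have "\<rho> h (\<rho> k y) - \<rho> k y \<in> Y" using h X2_G[OF k y] by (simp add: N1_def)
        from stable_mem[OF Y(2) inv_closed[OF k] this]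
        show ?thesis using k N1c[OF h] by (simp add: h'_def rho_mult lin_diff[OF lin_rho])
      qed
      ultimately have "h' \<in> N1" by (simp add: N1_def)
      then have "\<rho> h' x = x" using x by (simp add: W_def)
      moreover have "\<rho> h (\<rho> k x) = \<rho> k (\<rho> h' x)" using k N1c[OF h] by (simp add: h'_def rho_mult)
      ultimately show ?thesis by simp
    qed
    then show "\<rho> k x \<in> W" by (simp add: W_def)
  qed
  ultimately have "W = {0} \<or> W = UNIV" by (rule simple_subspace)
  moreover have "W \<noteq> {0}"
  proof
    assume W0: "W = {0}"
    \<comment> \<open>Averaging changes \<open>x\<close> only modulo \<open>Y\<close>, so the fixed
      vector obtained from it is not \<open>0\<close>.\<close>
    obtain x where x: "x \<in> X2" "x \<notin> Y" using SX2 S(2) by blast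
    have "fixproj N1 x - x \<in> Y"
      using x(1) by (intro fixproj_near_id[OF N1 cop oY]) (simp add: N1_def)
    moreover have "fixproj N1 x \<in> W"
      using fixproj_fixed[OF N1 cop] by (simp add: W_def)
    ultimately have "- x \<in> Y" using W0 by simp
    then show False using x(2) omod_minus[OF oY] by fastforce
  qed
  ultimately have W: "\<rho> h x = x" if "h \<in> N1" for h x using that by (auto simp: W_def)
  have z_N: "\<rho> z (\<rho> m x) = \<rho> m (\<rho> z x)" if m: "m \<in> N" for m x
  proof -
    note mc = N_carrier[OF m]
    define c where "c = z \<otimes> m \<otimes> inv z \<otimes> inv m"
    have "c \<in> N"
      unfolding c_def using subgroup.m_closed[OF subgroup_N conj_N[OF z(1) m] subgroup.m_inv_closed[OF subgroup_N m]] .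
    moreover have "\<rho> c y - y \<in> Y" if y: "y \<in> X2" for y
    proof -
      \<comment> \<open>For this preimage of \<open>y\<close> under \<open>m z\<close>, both
        \<open>c y = z m w\<close> and \<open>y = m z w\<close> are congruent to \<open>m w\<close>
        modulo \<open>Y\<close>.\<close>
      define w where "w = \<rho> (inv z) (\<rho> (inv m) y)"
      have w: "w \<in> X2" unfolding w_def using y z(1) mc by (intro X2_G) auto
      have yw: "y = \<rho> m (\<rho> z w)" using z(1) mc by (simp add: w_def)
      have cy: "\<rho> c y = \<rho> z (\<rho> m w)" using z(1) mc by (simp add: c_def w_def rho_mult)
      have "\<rho> z (\<rho> m w) - \<rho> m w \<in> Y" using w m by (simp add: X2_def)
      moreover have "\<rho> m (\<rho> z w - w) \<in> Y" by (rule stable_mem[OF Y(2) mc X2_zY[OF w]])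
      ultimately have "(\<rho> z (\<rho> m w) - \<rho> m w) - \<rho> m (\<rho> z w - w) \<in> Y" by (rule omod_diff[OF oY])
      then show ?thesis by (simp add: cy yw[symmetric] lin_diff[OF lin_rho[OF mc]])
    qed
    ultimately have "c \<in> N1" by (simp add: N1_def)
    then have "\<rho> c (\<rho> m (\<rho> z x)) = \<rho> m (\<rho> z x)" by (rule W)
    then show ?thesis using z(1) mc by (simp add: c_def rho_mult)
  qed
  obtain m and j :: nat where m: "m \<in> N" "g = m \<otimes> t [^] j" using generated[OF g] by blast
  have "\<rho> z ((\<rho> t ^^ j) x) = (\<rho> t ^^ j) (\<rho> z x)" by (induction j) (simp_all add: z(3))
  then show ?thesis using m t N_carrier[OF m(1)] by (simp add: rho_mult rho_pow z_N)
qed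

text \<open>
  For central \<open>z\<close> of order \<open>l\<close>, the operator \<open>u = z - 1\<close> satisfies \<open>u ^ (l - 1) L = l L\<close>,
  so the index of \<open>u L\<close> in \<open>L\<close> is at most \<open>2 d e / (l - 1) < 2\<close>: the powers of \<open>u\<close> form a
  chain with one-dimensional quotients. As \<open>f\<close> is alternating, the last layer of the dual lattice
  outside \<open>T\<close> can be added to \<open>T\<close>.
\<close>

lemma central_case:
  assumes z: "z \<in> carrier G" "\<And>x. (\<rho> z ^^ l) x = x" "\<exists>x. \<rho> z x \<noteq> x"
    and central: "\<And>g x. g \<in> carrier G \<Longrightarrow> \<rho> z (\<rho> g x) = \<rho> g (\<rho> z x)"
    and T: "lat T" "stable G \<rho> T" "T \<subseteq> dual T" "sc 1 (dual T) \<subseteq> T"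
    and max: "\<And>T'. lat T' \<Longrightarrow> stable G \<rho> T' \<Longrightarrow> T' \<subseteq> dual T' \<Longrightarrow> T \<subseteq> T' \<Longrightarrow> T' = T"
  shows "dual T = T"
proof (rule ccontr)
  assume neq: "dual T \<noteq> T"
  note oT = lat_omod[OF T(1)] and lz = lin_rho[OF z(1)]
  define L where "L = dual T"
  have lL: "lat L" unfolding L_def by (rule lat_dual[OF T(1)])
  note oL = lat_omod[OF lL]
  have sL: "stable G \<rho> L" unfolding L_def by (rule stable_dual[OF T(2)])
  define u where "u x = \<rho> z x - x" for x
  have lu: "lin u" unfolding u_def by (intro lin_minus_fun lz lin_id)
  have uL: "u ` L \<subseteq> L" using stable_mem[OF sL z(1)] by (auto simp: u_def intro!: omod_diff[OF oL])
  have ug: "\<rho> g (u x) = u (\<rho> g x)" if "g \<in> carrier G" for g x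
    using central[OF that] by (simp add: u_def lin_diff[OF lin_rho[OF that]])
  have upow_g: "\<rho> g ((u ^^ i) x) = (u ^^ i) (\<rho> g x)" if "g \<in> carrier G" for g i x
    by (induction i) (simp_all add: ug[OF that])
  have upow_L: "(u ^^ i) x \<in> L" if "x \<in> L" for i x using uL that by (induction i) auto
  \<comment> \<open>Because \<open>z\<close> is central in the action, the kernel of
    \<open>u\<close> is stable, and simplicity makes \<open>u\<close> injective.\<close>
  define W where "W = {x. u x = 0}"
  have "subspace W" by (auto simp: subspace_def W_def lin_0[OF lu] lin_add[OF lu] lin_scale[OF lu])
  moreover have "stable G \<rho> W"
    by (auto simp: stable_def W_def ug[symmetric] lin_0[OF lin_rho])
  ultimately have "W = {0} \<or> W = UNIV" by (rule simple_subspace)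
  moreover have "W \<noteq> UNIV" using z(3) by (auto simp: W_def u_def)
  ultimately have u0: "x = 0" if "u x = 0" for x using that by (auto simp: W_def)
  have u_inj: "x = y" if "(u ^^ i) x = (u ^^ i) y" for i x y
  proof -
    have "(u ^^ i) w = 0 \<Longrightarrow> w = 0" for w by (induction i) (auto dest: u0)
    from this[of "x - y"] that show ?thesis by (simp add: lin_diff[OF lin_funpow[OF lu]])
  qed
  obtain h where h: "\<And>(u :: 'b \<Rightarrow> 'b) x. lin u \<Longrightarrow>
      ((\<lambda>x. x + u x) ^^ l) x = x + (u ^^ l) x + of_nat l *s (u x + papp u h (u (u x)))"
    using prime_power_operator[OF prime_l] by blast
  define k where "k = papp u h"
  have lk: "lin k" unfolding k_def by (rule lin_papp[OF lu])
  have ku: "k (u x) = u (k x)" for x unfolding k_def by (rule papp_commute[OF lu lu, symmetric]) simp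
  have kL: "k x \<in> L" if "x \<in> L" for x unfolding k_def by (rule papp_mem[OF lu oL uL that])
  have ul: "(u ^^ l) x + of_nat l *s (u x + u (u (k x))) = 0" for x
  proof -
    have "(\<lambda>x. x + u x) = \<rho> z" by (auto simp: u_def)
    then show ?thesis using h[OF lu, of x] z(2)[of x] by (simp add: ku add.assoc flip: k_def)
  qed
  obtain l' where l': "l = Suc l'" using prime_l by (cases l) auto
  \<comment> \<open>One factor \<open>u\<close> is cancelled from the expansion of
    \<open>z^l = 1\<close>, leaving \<open>u^(l-1) = - l (1 + u k)\<close>.\<close>
  have ul': "of_nat l *s x = - (u ^^ l') x - of_nat l *s u (k x)" for x
  proof -
    have "u ((u ^^ l') x + of_nat l *s (x + u (k x))) = 0"
      using ul[of x] by (simp add: l' lin_add[OF lu] lin_scale[OF lu])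
    then have "(u ^^ l') x + of_nat l *s (x + u (k x)) = 0" by (rule u0)
    then show ?thesis by (simp add: scale_right_distrib algebra_simps eq_neg_iff_add_eq_0)
  qed
  \<comment> \<open>This replaces the inversion of \<open>1 + u k\<close>: the remainder acquires
    ever higher powers of \<open>u\<close>, and at the exponent \<open>l - 1\<close> it is absorbed
    into the first term.\<close>
  have l_iter: "\<exists>y\<in>L. \<exists>w\<in>L. of_nat l *s x = (u ^^ l') y + of_nat l *s (u ^^ i) w" if x: "x \<in> L" for i x
  proof (induction i)
    case 0
    show ?case using x omod_0[OF oL] by (intro bexI[of _ 0] bexI[of _ x]) (simp_all add: lin_0[OF lin_funpow[OF lu]])
  next
    case (Suc i)
    then obtain y w where yw: "y \<in> L" "w \<in> L" "of_nat l *s x = (u ^^ l') y + of_nat l *s (u ^^ i) w" by blast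
    note lin_u = lin_funpow[OF lu]
    have "of_nat l *s (u ^^ i) w = (u ^^ i) (of_nat l *s w)" by (simp add: lin_scale[OF lin_u])
    also have "\<dots> = - (u ^^ i) ((u ^^ l') w) - of_nat l *s (u ^^ i) (u (k w))"
      unfolding ul'[of w] by (simp add: lin_diff[OF lin_u] lin_minus[OF lin_u] lin_scale[OF lin_u])
    also have "(u ^^ i) ((u ^^ l') w) = (u ^^ l') ((u ^^ i) w)"
      by (metis add.commute comp_apply funpow_add)
    finally have "of_nat l *s x = (u ^^ l') (y - (u ^^ i) w) + of_nat l *s (u ^^ Suc i) (- k w)"
      by (simp add: yw(3) lin_diff[OF lin_u] lin_minus[OF lin_u] lin_minus[OF lu] funpow_swap1)
    then show ?case
      using yw(1,2) upow_L kL by (intro bexI[of _ "y - (u ^^ i) w"] bexI[of _ "- k w"])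
        (auto intro: omod_diff[OF oL] omod_minus[OF oL])
  qed
  have lL_sub: "of_nat l *s x \<in> (u ^^ l') ` L" if x: "x \<in> L" for x
  proof -
    obtain y w where yw: "y \<in> L" "w \<in> L" "of_nat l *s x = (u ^^ l') y + of_nat l *s (u ^^ l') w"
      using l_iter[OF x, of l'] by blast
    have "of_nat l *s x = (u ^^ l') (y + of_nat l *s w)"
      by (simp add: yw(3) lin_add[OF lin_funpow[OF lu]] lin_scale[OF lin_funpow[OF lu]])
    then show ?thesis using yw(1,2) by (auto intro!: omod_add[OF oL] omod_scale[OF oL])
  qed
  have l0: "of_nat l \<noteq> (0::'a)" using prime_l by auto
  define A where "A i = (u ^^ i) ` L" for i
  have scA: "sc (int e) L \<subseteq> A l'"
  proof
    fix x assume x: "x \<in> sc (int e) L"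
    define x' where "x' = inverse (of_nat l) *s x"
    have xx: "x = of_nat l *s x'" using l0 by (simp add: x'_def)
    then have "x' \<in> L" using x mem_sc_iff_of_val[OF oL l0, of x' "int e"] by (simp add: val_l)
    then show "x \<in> A l'" unfolding xx A_def by (rule lL_sub)
  qed
  have A_Suc: "A (Suc i) \<subseteq> A i" for i
    using uL by (force simp: A_def funpow_swap1)
  have A_mono: "A j \<subseteq> A i" if "i \<le> j" for i j
    using lift_Suc_antimono_le[of A, OF A_Suc that] .
  have oA: "omod (A i)" for i unfolding A_def by (rule omod_image[OF lin_funpow[OF lu] oL])
  have lA: "lat (A i)" if "i \<le> l'" for i
    by (rule lat_between[OF oA lat_sc[OF lL] lL])
      (use scA A_mono[OF that] A_mono[of 0 i] in \<open>auto simp: A_def\<close>)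
  \<comment> \<open>Otherwise all \<open>l - 1\<close> steps of the chain down to
    \<open>A l'\<close> would have length at least two. As \<open>A l'\<close> contains
    \<open>p^e L\<close>, this would give \<open>l - 1 <= d * e\<close>.\<close>
  have "\<exists>i<l'. vol (A (Suc i)) \<le> vol (A i) + 1"
  proof (rule ccontr)
    assume "\<not> ?thesis"
    then have step: "vol (A i) + 2 \<le> vol (A (Suc i))" if "i < l'" for i using that by force
    have "vol (A 0) + 2 * int i \<le> vol (A i)" if "i \<le> l'" for i
      using that
    proof (induction i)
      case (Suc i)
      then show ?case using step[of i] by simp
    qed simp
    from this[of l'] have "vol L + 2 * int l' \<le> vol (A l')" by (simp add: A_def)
    moreover have "vol (A l') \<le> vol (sc (int e) L)" by (rule vol_antimono[OF lat_sc[OF lL] lA scA]) simp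
    moreover have "vol (sc (int e) L) = vol L + 2 * int (e * d)" unfolding vol_sc[OF lL] int_n by simp
    ultimately have "int l' \<le> int (e * d)" by linarith
    then have "l' \<le> e * d" by (simp only: of_nat_le_iff)
    then show False using small l' by simp
  qed
  then obtain i where i: "i < l'" "vol (A (Suc i)) \<le> vol (A i) + 1" by blast
  \<comment> \<open>In a step of length zero any vector will do; in a step of length one a vector
    outside the smaller module generates the rest, as there is no room for a module in
    between.\<close>
  have "\<exists>x\<in>L. A i \<subseteq> lsum (A (Suc i)) (oline ((u ^^ i) x))"
  proof (cases "A i = A (Suc i)")
    case True
    then show ?thesis using omod_0[OF oL] lsum_left[OF omod_oline] by blast
  next
    case False
    then obtain x where x: "x \<in> L" "(u ^^ i) x \<notin> A (Suc i)" using A_Suc by (force simp: A_def)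
    define S where "S = lsum (A (Suc i)) (oline ((u ^^ i) x))"
    have S1: "A (Suc i) \<subseteq> S" unfolding S_def by (rule lsum_left[OF omod_oline])
    have S2: "S \<subseteq> A i" unfolding S_def
      using x(1) A_Suc by (intro lsum_least oA oline_subset) (auto simp: A_def)
    have lS: "lat S"
      by (rule lat_between[OF _ lA lA S1 S2]) (use i(1) in \<open>auto simp: S_def intro: omod_lsum oA omod_oline\<close>)
    have "(u ^^ i) x \<in> S" unfolding S_def using lsum_right[OF oA] mem_oline by blast
    then have "A (Suc i) \<subset> S" using S1 x(2) by blast
    then have "vol S < vol (A (Suc i))" using i(1) by (intro vol_psubset lA lS) auto
    then have "S = A i" using i by (intro vol_strict[OF lS lA S2]) auto
    then show ?thesis using x(1) by (auto simp: S_def)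
  qed
  then obtain x where x: "x \<in> L" "A i \<subseteq> lsum (A (Suc i)) (oline ((u ^^ i) x))" by blast
  \<comment> \<open>Injectivity of \<open>u\<close> allows \<open>u^i\<close> to be cancelled. The
    generator found at index \<open>i\<close> thus works at the top of the chain, and from there at
    every index.\<close>
  have cyc: "\<exists>y'\<in>L. \<exists>c\<in>val_integers v. y = u y' + c *s x" if y: "y \<in> L" for y
  proof -
    have "(u ^^ i) y \<in> lsum (A (Suc i)) (oline ((u ^^ i) x))" using x(2) y by (auto simp: A_def)
    then obtain y' c where y': "y' \<in> L" "c \<in> val_integers v" "(u ^^ i) y = (u ^^ Suc i) y' + c *s (u ^^ i) x"
      by (auto simp: lsum_def oline_def A_def)
    then have "(u ^^ i) y = (u ^^ i) (u y' + c *s x)"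
      by (simp add: lin_add[OF lin_funpow[OF lu]] lin_scale[OF lin_funpow[OF lu]] funpow_swap1)
    then show ?thesis using y'(1,2) u_inj by blast
  qed
  \<comment> \<open>By the expansion of \<open>z^l = 1\<close>, the image of \<open>u^l\<close> lies
    in \<open>l L\<close>, hence in \<open>p L\<close>. So the chain does enter
    \<open>T\<close>.\<close>
  have "A l \<subseteq> T"
  proof
    fix y assume "y \<in> A l"
    then obtain w where w: "w \<in> L" "y = (u ^^ l) w" by (auto simp: A_def)
    have "y = - (of_nat l *s (u w + u (u (k w))))"
      unfolding w(2) using ul[of w] by (simp only: eq_neg_iff_add_eq_0)
    moreover have "u w + u (u (k w)) \<in> L"
      using w(1) uL kL by (intro omod_add[OF oL]) auto
    then have "of_nat l *s (u w + u (u (k w))) \<in> sc (int e) L"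
      using mem_sc_scale[OF oL, of "of_nat l" "int e"] by (simp add: val_at_least_def val_l)
    ultimately have "y \<in> sc (int e) L" using omod_minus[OF omod_sc[OF oL]] by simp
    then show "y \<in> T" using sc_mono[OF oL, of 1 "int e"] e_pos T(4) by (auto simp: L_def)
  qed
  define j where "j = (LEAST j. A j \<subseteq> T)"
  have Aj: "A j \<subseteq> T" unfolding j_def using \<open>A l \<subseteq> T\<close> by (rule LeastI)
  have "j \<noteq> 0" using Aj neq T(3) by (auto simp: A_def L_def intro!: Nat.gr0I)
  then obtain j' where j': "j = Suc j'" by (cases j) auto
  have nAj': "\<not> A j' \<subseteq> T" using not_less_Least[of j' "\<lambda>j. A j \<subseteq> T"] j' by (simp add: j_def)
  define r where "r = (u ^^ j') x"
  have rL: "r \<in> L" using upow_L[OF x(1)] by (simp add: r_def)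
  have A_sub: "A j' \<subseteq> lsum T (oline r)"
  proof
    fix y assume "y \<in> A j'"
    then obtain w where w: "w \<in> L" "y = (u ^^ j') w" by (auto simp: A_def)
    obtain y' c where y': "y' \<in> L" "c \<in> val_integers v" "w = u y' + c *s x" using cyc[OF w(1)] by blast
    have "y = (u ^^ Suc j') y' + c *s r"
      by (simp add: w(2) y'(3) r_def lin_add[OF lin_funpow[OF lu]] lin_scale[OF lin_funpow[OF lu]] funpow_swap1)
    moreover have "(u ^^ Suc j') y' \<in> T" using Aj y'(1) unfolding j' A_def by blast
    ultimately show "y \<in> lsum T (oline r)" using y'(2) by (auto simp: oline_def intro!: lsumI)
  qed
  define S where "S = lsum T (A j')"
  have S_sub: "S \<subseteq> lsum T (oline r)"
    unfolding S_def by (intro lsum_least omod_lsum oT omod_oline A_sub lsum_left)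
  have oS: "omod S" unfolding S_def by (intro omod_lsum oT oA)
  have TS: "T \<subseteq> S" unfolding S_def by (rule lsum_left[OF oA])
  have "S \<subseteq> L" unfolding S_def using T(3) upow_L by (intro lsum_least oL) (auto simp: A_def L_def)
  then have lS: "lat S" by (rule lat_between[OF oS T(1) lL TS])
  have "stable G \<rho> (A j')"
    using stable_mem[OF sL] by (auto simp: stable_def A_def upow_g)
  then have stS: "stable G \<rho> S" unfolding S_def by (intro stable_lsum T(2))
  have "S \<subseteq> dual S"
  proof
    fix a assume "a \<in> S"
    then obtain s c where a: "a = s + c *s r" "s \<in> T" "c \<in> val_integers v"
      using S_sub by (auto simp: lsum_def oline_def)
    have "f a b \<in> val_integers v" if b: "b \<in> S" for b
    proof -
      obtain s' c' where b': "b = s' + c' *s r" "s' \<in> T" "c' \<in> val_integers v"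
        using b S_sub by (auto simp: lsum_def oline_def)
      have 1: "f s s' \<in> val_integers v" using T(3) a(2) b'(2) by (auto simp: dual_def)
      have 2: "f r s' \<in> val_integers v" using rL b'(2) by (auto simp: L_def dual_def)
      have "f r s \<in> val_integers v" using rL a(2) by (auto simp: L_def dual_def)
      then have 3: "f s r \<in> val_integers v" by (subst f_skew) (rule val_at_least_uminus)
      \<comment> \<open>The missing term \<open>c * c' * f r r\<close> is zero because
        \<open>f\<close> is alternating. It is the one pairing that \<open>T\<close> and its dual do
        not control.\<close>
      have "f a b = f s s' + c' * f s r + c * f r s'"
        by (simp add: a(1) b'(1) f_add_left f_add_right f_scale_left f_scale_right algebra_simps)
      then show ?thesis
        using 1 2 3 a(3) b'(3) by (auto intro!: val_at_least_add val_integers_mult)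
    qed
    then show "a \<in> dual S" by (simp add: dual_def)
  qed
  then have "S = T" using max[OF lS stS _ TS] by blast
  then show False using nAj' lsum_right[OF oT, of "A j'"] by (simp add: S_def)
qed

lemma maximal_integral_almost_self_dual:
  assumes T: "lat T" "stable G \<rho> T" "T \<subseteq> dual T"
    and max: "\<And>T'. lat T' \<Longrightarrow> stable G \<rho> T' \<Longrightarrow> T' \<subseteq> dual T' \<Longrightarrow> T \<subseteq> T' \<Longrightarrow> T' = T"
  shows "dual T = T \<or> sc 1 (dual T) = T"
proof (rule ccontr)
  assume neg: "\<not> ?thesis"
  define L where "L = dual T"
  have lL: "lat L" unfolding L_def by (rule lat_dual[OF T(1)])
  have sL: "stable G \<rho> L" unfolding L_def by (rule stable_dual[OF T(2)])
  have LT: "sc 1 L \<subset> T" "T \<subset> L"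
    using maximal_integral_dual[OF T max] T(3) neg by (auto simp: L_def)
  show False
  proof (cases "\<forall>x. \<rho> t x = x")
    case True
    then show False using N_simple_case[OF _ lL sL T(1,2)] LT by auto
  next
    case False
    then obtain z where z: "z \<in> carrier G" "\<And>x. (\<rho> z ^^ l) x = x" "\<exists>x. \<rho> z x \<noteq> x"
      "\<And>x. \<rho> z (\<rho> t x) = \<rho> t (\<rho> z x)"
      using ex_power_of_prime_order by metis
    \<comment> \<open>The lengths of \<open>L / T\<close> and \<open>T / p L\<close> add up to
      \<open>2 d\<close>, so they cannot both exceed \<open>d\<close>.\<close>
    have "vol (sc 1 L) = vol L + 2 * int d" unfolding vol_sc[OF lL] int_n by simp
    then consider "vol T - vol L \<le> int d" | "vol (sc 1 L) - vol T \<le> int d" by linarith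
    then have "\<rho> z (\<rho> g x) = \<rho> g (\<rho> z x)" if "g \<in> carrier G" for g x
    proof cases
      case 1
      then show ?thesis
        using central_from_small_quotient[OF z(1,2,4) T(1,2) lL sL _ LT(2) _ that] LT(1) by blast
    next
      case 2
      have "sc 1 T \<subseteq> sc 1 L" using LT(2) by (intro sc_subset) auto
      then show ?thesis
        using central_from_small_quotient[OF z(1,2,4) lat_sc[OF lL] stable_sc[OF sL] T(1,2) _ LT(1) 2 that] by blast
    qed
    then have "dual T = T"
      using central_case[OF z(1-3) _ T maximal_integral_dual[OF T max] max] by blast
    then show False using neg by blast
  qed
qed

end

section \<open>Rescaling the form\<close>

context symplectic_lattice_rep
begin

lemma ex_perfect_lattice:
  "\<exists>T f'. is_lattice v scale T \<and> stable G \<rho> T \<and>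
     integral_bilinear_form v scale T f' \<and> perfect_form v scale T f' \<and>
     alternating_form T f' \<and> invariant_form G \<rho> T f'"
proof -
  obtain T where T: "lat T" "stable G \<rho> T" "T \<subseteq> dual T"
    "\<And>T'. lat T' \<Longrightarrow> stable G \<rho> T' \<Longrightarrow> T' \<subseteq> dual T' \<Longrightarrow> T \<subseteq> T' \<Longrightarrow> T' = T"
    using ex_maximal_integral by blast
  \<comment> \<open>Dividing the form by \<open>p\<close> multiplies the dual lattice by
    \<open>p\<close>, which turns the second alternative into self-duality.\<close>
  define c where "c = (if dual T = T then 1 else inverse p)"
  define f' where "f' x y = c * f x y" for x y
  have "c \<noteq> 0" by (simp add: c_def)
  interpret F: symplectic_space v scale Basis p n bv f'
  proof unfold_locales
    show "bilinear_form scale f'"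
      using vector_space_axioms f_bilinear
      by (auto simp: bilinear_form_def Vector_Spaces.linear_iff f'_def algebra_simps)
    show "nondegenerate_form f'"
      using f_nondeg \<open>c \<noteq> 0\<close> by (simp add: nondegenerate_form_def f'_def)
    show "alternating_form UNIV f'" by (simp add: alternating_form_def f'_def)
  qed
  have "F.dual T = T"
  proof (cases "dual T = T")
    case True
    then show ?thesis by (simp add: F.dual_def f'_def c_def flip: dual_def)
  next
    case False
    then have "sc 1 (dual T) = T" using maximal_integral_almost_self_dual[OF T] by blast
    moreover have "F.dual T = sc 1 (dual T)"
      using False by (simp add: F.dual_def f'_def c_def dual_def sc_def f_scale_left power_int_minus)
    ultimately show ?thesis by simp
  qed
  then have "integral_bilinear_form v scale T f'" "perfect_form v scale T f'"
    using F.self_dual_imp_perfect T(1) by blast+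
  moreover have "alternating_form T f'" by (simp add: alternating_form_def f'_def)
  moreover have "invariant_form G \<rho> T f'" by (simp add: invariant_form_def f'_def f_inv)
  ultimately show ?thesis using lat_is_lattice[OF T(1)] T(2) by blast
qed

end

section \<open>The residue characteristic and the structure of the group\<close>

text \<open>A multiple of the unit of the residue ring is zero exactly when the corresponding
  integer lies in the maximal ideal. The cosets are computed explicitly as translates of that
  ideal.\<close>

lemma (in discrete_valuation) residue_characteristic_eq:
  "residue_characteristic v = Gcd {m. of_nat m \<in> val_at_least v 1}"
proof -
  define I where "I = val_at_least v 1"
  have coset: "I +>\<^bsub>val_ring v\<^esub> x = {h + x |h. h \<in> I}" for x
    by (auto simp: a_r_coset_def r_coset_def val_ring_def)
  have add: "set_add (val_ring v) {h + x |h. h \<in> I} {h + y |h. h \<in> I} = {h + (x + y) |h. h \<in> I}" for x y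
  proof
    show "set_add (val_ring v) {h + x |h. h \<in> I} {h + y |h. h \<in> I} \<subseteq> {h + (x + y) |h. h \<in> I}"
    proof
      fix z assume "z \<in> set_add (val_ring v) {h + x |h. h \<in> I} {h + y |h. h \<in> I}"
      then obtain h h' where h: "h \<in> I" "h' \<in> I" "z = (h + x) + (h' + y)"
        by (auto simp: set_add_def set_mult_def val_ring_def)
      then have "z = (h + h') + (x + y)" "h + h' \<in> I"
        by (simp_all add: I_def val_at_least_add algebra_simps)
      then show "z \<in> {h + (x + y) |h. h \<in> I}" by blast
    qed
    show "{h + (x + y) |h. h \<in> I} \<subseteq> set_add (val_ring v) {h + x |h. h \<in> I} {h + y |h. h \<in> I}"
    proof
      fix z assume "z \<in> {h + (x + y) |h. h \<in> I}"
      then obtain h where "h \<in> I" "z = (h + x) + (0 + y)" by (auto simp: algebra_simps)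
      moreover have "0 \<in> I" by (simp add: I_def)
      ultimately show "z \<in> set_add (val_ring v) {h + x |h. h \<in> I} {h + y |h. h \<in> I}"
        unfolding set_add_def set_mult_def by (auto simp: val_ring_def)
    qed
  qed
  have pow: "add_pow (residue_field v) m \<one>\<^bsub>residue_field v\<^esub> = {h + of_nat m |h. h \<in> I}" for m :: nat
  proof (induction m)
    case 0
    then show ?case
      by (simp add: add_pow_def residue_field_def FactRing_def I_def)
  next
    case (Suc m)
    have "add_pow (residue_field v) (Suc m) \<one>\<^bsub>residue_field v\<^esub>
        = set_add (val_ring v) (add_pow (residue_field v) m \<one>\<^bsub>residue_field v\<^esub>) {h + 1 |h. h \<in> I}"
      unfolding add_pow_def by (simp add: residue_field_def FactRing_def coset flip: I_def)
        (simp add: val_ring_def)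
    then show ?case by (simp only: Suc add of_nat_Suc add.commute)
  qed
  have "{h + of_nat m |h. h \<in> I} = I \<longleftrightarrow> of_nat m \<in> I" for m
  proof
    assume "{h + of_nat m |h. h \<in> I} = I"
    moreover have "0 + of_nat m \<in> {h + of_nat m |h. h \<in> I}" unfolding I_def using val_at_least_0 by blast
    ultimately show "of_nat m \<in> I" by simp
  next
    assume m: "of_nat m \<in> I"
    show "{h + of_nat m |h. h \<in> I} = I"
    proof
      show "{h + of_nat m |h. h \<in> I} \<subseteq> I" using m by (auto simp: I_def intro: val_at_least_add)
      show "I \<subseteq> {h + of_nat m |h. h \<in> I}"
      proof
        fix x assume "x \<in> I"
        then have "x - of_nat m \<in> I" using m by (simp add: I_def val_at_least_diff)
        then show "x \<in> {h + of_nat m |h. h \<in> I}" by (intro CollectI exI[of _ "x - of_nat m"]) simp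
      qed
    qed
  qed
  moreover have "\<zero>\<^bsub>residue_field v\<^esub> = I" by (simp add: residue_field_def FactRing_def I_def)
  ultimately show ?thesis
    by (simp add: residue_characteristic_def ring_characteristic_def pow I_def)
qed

text \<open>Natural numbers of positive valuation are multiples of \<open>l\<close>, so those prime
  to \<open>l\<close> are units. As the gcd \<open>l\<close> is not \<open>0\<close>, some nonzero
  number has positive valuation, and only its factors \<open>l\<close> can be responsible.\<close>

lemma residue_characteristic_prime:
  fixes v :: "'k::field_char_0 \<Rightarrow> int"
  assumes "discrete_valuation v" "residue_characteristic v = l" "Factorial_Ring.prime l"
  shows "coprime m l \<Longrightarrow> v (of_nat m) = 0" "0 < v (of_nat l)"
proof -
  interpret discrete_valuation v by fact
  define A where "A = {m. of_nat m \<in> val_at_least v 1}"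
  have l: "Gcd A = l" using residue_characteristic_eq assms(2) by (simp add: A_def)
  have nonneg: "0 \<le> v (of_nat m)" if "m \<noteq> 0" for m
    using val_integers_of_nat[of m] that by (simp add: val_at_least_def)
  show unit: "v (of_nat m) = 0" if "coprime m l" for m
  proof (rule ccontr)
    assume "v (of_nat m) \<noteq> 0"
    have "m \<noteq> 0" using that assms(3) by (auto intro!: Nat.gr0I)
    then have "m \<in> A" using nonneg[of m] \<open>v (of_nat m) \<noteq> 0\<close> by (simp add: A_def val_at_least_def)
    then have "l dvd m" using l Gcd_dvd by blast
    then show False using that assms(3) by (meson coprime_absorb_right not_prime_unit)
  qed
  have "\<not> A \<subseteq> {0}"
  proof
    assume "A \<subseteq> {0}"
    then have "Gcd A = 0" by (simp add: Gcd_0_iff)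
    then show False using l assms(3) by simp
  qed
  then obtain m where m: "m \<in> A" "m \<noteq> 0" by auto
  obtain m' where m': "m = l ^ multiplicity l m * m'" "\<not> l dvd m'"
    using multiplicity_decompose'[of m l] m(2) not_prime_unit assms(3) by metis
  have "v (of_nat m') = 0" using m'(2) assms(3) by (intro unit) (metis coprime_commute prime_imp_coprime)
  have "of_nat m = of_nat l ^ multiplicity l m * (of_nat m' :: 'k)"
    using m'(1) by (metis of_nat_mult of_nat_power)
  moreover have "m' \<noteq> 0" "l \<noteq> 0" using m'(2) assms(3) by (metis dvd_0_right, auto)
  ultimately have "v (of_nat m) = int (multiplicity l m) * v (of_nat l)"
    using \<open>v (of_nat m') = 0\<close> by (simp add: v_mult val_power)
  moreover have "1 \<le> v (of_nat m)" using m by (simp add: A_def val_at_least_def)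
  ultimately show "0 < v (of_nat l)" using nonneg[OF \<open>l \<noteq> 0\<close>] by (cases "v (of_nat l) = 0") auto
qed

text \<open>A lift \<open>g0\<close> of a generator of the quotient has its power
  \<open>g0^(l^k)\<close> in \<open>N\<close>, so the order of \<open>t = g0^(card N)\<close>
  divides \<open>l^k\<close>. As \<open>card N\<close> is prime to \<open>l\<close>, the element
  \<open>t\<close> still generates modulo \<open>N\<close>.\<close>

lemma (in group) ex_generator_of_prime_power_order:
  assumes fin: "finite (carrier G)" and N: "N \<lhd> G" and cop: "coprime (card N) l"
    and cyc: "cyclic_group (G Mod N)" and ord: "Coset.order (G Mod N) = l ^ k"
  obtains t where "t \<in> carrier G" "t [^] (l ^ k) = \<one>"
    "\<And>g. g \<in> carrier G \<Longrightarrow> \<exists>m\<in>N. \<exists>j::nat. g = m \<otimes> t [^] j"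
proof -
  interpret N: normal N G by fact
  interpret Q: group "G Mod N" by (rule N.factorgroup_is_group)
  have sN: "subgroup N G" by (rule N.subgroup_axioms)
  have finQ: "finite (carrier (G Mod N))" using fin by (simp add: carrier_FactGroup)
  obtain C where C: "C \<in> carrier (G Mod N)" "subgroup_generated (G Mod N) {C} = G Mod N"
    using cyc by (auto simp: cyclic_group_def)
  have gen: "\<exists>j::nat. x = C [^]\<^bsub>G Mod N\<^esub> j" if x: "x \<in> carrier (G Mod N)" for x
  proof -
    have "carrier (G Mod N) = generate (G Mod N) {C}"
      using C carrier_subgroup_generated[of "G Mod N" "{C}"] by simp
    also have "\<dots> = {C [^]\<^bsub>G Mod N\<^esub> j |j. j \<in> (UNIV::nat set)}"
      by (rule Q.generate_pow_on_finite_carrier[OF finQ C(1)])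
    finally show ?thesis using x by blast
  qed
  obtain g0 where g0: "g0 \<in> carrier G" "C = N #> g0" using C(1) by (auto simp: carrier_FactGroup)
  have C_pow: "C [^]\<^bsub>G Mod N\<^esub> j = N #> g0 [^] j" for j :: nat
    unfolding g0(2) by (rule N.FactGroup_pow[OF g0(1)])
  define q where "q = l ^ k"
  have Cq: "C [^]\<^bsub>G Mod N\<^esub> q = \<one>\<^bsub>G Mod N\<^esub>"
    using Q.pow_order_eq_1[OF C(1)] by (simp add: ord q_def)
  define t where "t = g0 [^] card N"
  have t: "t \<in> carrier G" using g0 by (simp add: t_def)
  have g0q: "g0 [^] q \<in> N"
    using Cq coset_join1[OF _ _ sN, of "g0 [^] q"] g0(1) by (simp add: C_pow)
  interpret S: group "G\<lparr>carrier := N\<rparr>" by (rule subgroup_imp_group[OF sN])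
  have "(g0 [^] q) [^] card N = \<one>"
    using S.pow_order_eq_1[of "g0 [^] q"] g0q
    by (simp add: Coset.order_def flip: nat_pow_consistent)
  then have t1: "t [^] (l ^ k) = \<one>"
    using g0(1) by (simp add: t_def nat_pow_pow mult.commute flip: q_def)
  have "card N \<noteq> 0" using finite_subset[OF subgroup.subset[OF sN] fin] subgroup.one_closed[OF sN]
    by (metis card_0_eq empty_iff)
  then obtain i y where "card N * i = q * y + gcd (card N) q" using bezout_nat by blast
  \<comment> \<open>Bezout's identity: \<open>t^i = g0^(q y + 1)\<close> lies in the coset of
    \<open>g0\<close>.\<close>
  then have i: "card N * i = q * y + 1" using cop by (simp add: q_def)
  have C_t: "C [^]\<^bsub>G Mod N\<^esub> j = N #> t [^] (i * j)" for j :: nat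
  proof -
    have "card N * (i * j) = q * (y * j) + j"
      using arg_cong[OF i, of "\<lambda>a. a * j"] by (simp add: algebra_simps)
    then have "C [^]\<^bsub>G Mod N\<^esub> (card N * (i * j)) = C [^]\<^bsub>G Mod N\<^esub> (q * (y * j) + j)"
      by simp
    also have "\<dots> = C [^]\<^bsub>G Mod N\<^esub> j"
      using C(1) by (simp add: Cq del: one_FactGroup mult_FactGroup flip: Q.nat_pow_mult Q.nat_pow_pow)
    finally show ?thesis using g0(1) by (simp add: C_pow t_def nat_pow_pow)
  qed
  have "\<exists>m\<in>N. \<exists>j::nat. g = m \<otimes> t [^] j" if g: "g \<in> carrier G" for g
  proof -
    have "N #> g \<in> carrier (G Mod N)" using g by (auto simp: carrier_FactGroup)
    then obtain j :: nat where "N #> g = C [^]\<^bsub>G Mod N\<^esub> j" using gen by blast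
    then have "g \<in> N #> t [^] (i * j)" using rcos_self[OF g sN] by (simp add: C_t)
    then show ?thesis by (auto simp: r_coset_def)
  qed
  then show ?thesis using that t t1 by blast
qed

theorem theorem4p2:
  fixes l d :: nat
    and G :: "'g monoid" and N :: "'g set"
    and v :: "'k::field_char_0 \<Rightarrow> int"
    and scale :: "'k \<Rightarrow> 'v::ab_group_add \<Rightarrow> 'v" and Basis :: "'v set"
    and \<rho> :: "'g \<Rightarrow> 'v \<Rightarrow> 'v"
  assumes "Factorial_Ring.prime l"
    and "group G" and "finite (carrier G)"
    and "N \<lhd> G" and "coprime (card N) l"
    and "cyclic_group (G Mod N)" and "\<exists>k. Coset.order (G Mod N) = l ^ k"
    and "complete_discrete_valuation v" and "residue_characteristic v = l"
    and "finite_dimensional_vector_space scale Basis"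
    and "vector_space.dim scale (UNIV :: 'v set) = 2 * d"
    and "linear_rep scale G \<rho>" and "faithful_rep G \<rho>"
    and "simple_rep scale G \<rho>" and "symplectic_rep scale G \<rho>"
    and "int l > int d * v (of_nat l) + 1"
    and "quasisplit (group_algebra (G\<lparr>carrier := N\<rparr>) :: ('g \<Rightarrow> 'k) ring)"
  shows "\<exists>T f'. is_lattice v scale T \<and> stable G \<rho> T \<and>
           integral_bilinear_form v scale T f' \<and> perfect_form v scale T f' \<and>
           alternating_form T f' \<and> invariant_form G \<rho> T f'"
proof -
  interpret complete_discrete_valuation v by fact
  interpret V: finite_dimensional_vector_space scale Basis by fact
  note residue = residue_characteristic_prime[OF discrete_valuation_axioms assms(9,1)]
  obtain p where p: "p \<noteq> 0" "v p = 1" using v_normalized by blast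
  have card: "card Basis = 2 * d"
    using assms(11) by (simp add: V.dim_UNIV V.dimension_def)
  obtain bv where bv: "bij_betw bv {..<2 * d} Basis"
    using ex_bij_betw_nat_finite[OF V.finite_Basis] by (auto simp: card lessThan_atLeast0)
  obtain k where k: "Coset.order (G Mod N) = l ^ k" using assms(7) by blast
  obtain t where t: "t \<in> carrier G" "t [^]\<^bsub>G\<^esub> (l ^ k) = \<one>\<^bsub>G\<^esub>"
    "\<And>g. g \<in> carrier G \<Longrightarrow> \<exists>m\<in>N. \<exists>j::nat. g = m \<otimes>\<^bsub>G\<^esub> t [^]\<^bsub>G\<^esub> j"
    using group.ex_generator_of_prime_power_order[OF assms(2-6) k] by metis
  obtain f where f: "bilinear_form scale f" "nondegenerate_form f" "alternating_form UNIV f"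
    "invariant_form G \<rho> UNIV f"
    using assms(15) by (auto simp: symplectic_rep_def)
  define e where "e = nat (v (of_nat l))"
  have e: "v (of_nat l) = int e" "0 < e" using residue(2) by (auto simp: e_def)
  have "int (e * d + 1) < int l" using assms(16) by (simp add: e(1) mult.commute)
  then have small: "e * d + 1 < l" by (simp only: of_nat_less_iff)
  interpret normal N G by fact
  interpret symplectic_lattice_rep v scale Basis p "2 * d" bv G \<rho> N l e f d t
  proof unfold_locales
    show "p \<noteq> 0" "v p = 1" "bij_betw bv {..<2 * d} Basis" by fact+
    show "finite (carrier G)" "linear_rep scale G \<rho>" "coprime (card N) l"
      "Factorial_Ring.prime l" "simple_rep scale G \<rho>" by fact+
    show "0 < e" "v (of_nat l) = int e" "e * d + 1 < l" by fact+
    show "v (of_nat m) = 0" if "coprime m l" for m using that by (rule residue(1))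
    show "bilinear_form scale f" "nondegenerate_form f" "alternating_form UNIV f"
      "invariant_form G \<rho> UNIV f" by fact+
    show "2 * d = 2 * d" by (rule refl)
    show "t \<in> carrier G" "\<exists>k. t [^]\<^bsub>G\<^esub> (l ^ k) = \<one>\<^bsub>G\<^esub>" using t(1,2) by blast+
    show "\<exists>m\<in>N. \<exists>j::nat. g = m \<otimes>\<^bsub>G\<^esub> t [^]\<^bsub>G\<^esub> j" if "g \<in> carrier G" for g using that by (rule t(3))
  qed
  show ?thesis by (rule ex_perfect_lattice)
qed

end
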